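(* Let $y=\varphi(x,u)$ be an $(x,u)$-flat output of the system $\dot x=f(x,u)$ with $n$-dimensional state $x$ and $m$-dimensional input $u$, and let $R$ be the associated minimal multi-index. Then it is always possible to achieve a linear, decoupled and asymptotically stable tracking error dynamics with arbitrary eigenvalues by a control law which only depends on the state $x$ and the reference trajectory. That is, there exists a multi-index $\kappa=(\kappa^1,\dots,\kappa^m)\le R$ with $|\kappa|=n$ such that for every choice of real coefficients $a^{j,\beta}$, $j=1,\dots,m$, $\beta=0,\dots,\kappa^j-1$, there is a (locally defined) control law of the form $$u=\alpha\bigl(x,y^d_{[0,R]}(t)\bigr)$$ such that, for every sufficiently often differentiable reference trajectory $y^d(t)$, the tracking error $e=y-y^d$ of the closed-loop system satisfies $$e^{j}_{[\kappa^j]}+\sum_{\beta=0}^{\kappa^j-1}a^{j,\beta}\,e^{j}_{[\beta]}=0,\qquad j=1,\dots,m.$$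
   Context: Setting. $\mathcal X$ is an $n$-dimensional smooth manifold with local coordinates $x=(x^1,\dots,x^n)$, and $\dot x=f(x,u)$ is a smooth control system with $m$ inputs $u=(u^1,\dots,u^m)$. On the manifold $\mathcal X\times\mathcal U_{[0,l_u]}$ with coordinates $(x,u,u_{[1]},\dots,u_{[l_u]})$, where $u_{[\alpha]}$ denotes the $\alpha$-th time derivative of $u$ and $l_u$ is a sufficiently large finite integer, consider the vector field $$f_u=\sum_{i=1}^n f^i(x,u)\,\partial_{x^i}+\sum_{j=1}^m\sum_{\alpha=0}^{l_u-1}u^j_{[\alpha+1]}\,\partial_{u^j_{[\alpha]}}.$$ The Lie derivative $\mathrm L_{f_u}h$ is the time derivative of a function $h$ along trajectories, and $h_{[\alpha]}$ denotes the $\alpha$-th time derivative of $h$. All results are generically local: they hold locally on open dense subsets, and the control law is considered where it is defined, i.e. as long as the variables stay in the neighborhood under consideration. All Jacobian matrices and codistributions considered are assumed to have locally constant rank. Multi-index notation. A multi-index $A=(a^1,\dots,a^m)$ consists of nonnegative integers; $|A|=\sum_j a^j$; $A\le B$ is meant componentwise; $A-1=(a^1-1,\dots,a^m-1)$; $h_{[0,B]}$ is the collection of all $h^j_{[\beta]}$ with $0\le\beta\le b^j$, $j=1,\dots,m$. Flatness. An $m$-tuple of smooth functions $y^j=\varphi^j(x,u)$, $j=1,\dots,m$, is an $(x,u)$-flat output if there are smooth functions $F_x,F_u$ and a multi-index $R=(r^1,\dots,r^m)$ such that locally $x=F_x(\varphi_{[0,R-1]})$ and $u=F_u(\varphi_{[0,R]})$,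 where $\varphi_{[\alpha]}=\mathrm L_{f_u}^\alpha\varphi$. There is a unique minimal such multi-index, and $R$ always denotes this minimal one. The closed-loop system is $\dot x=f\bigl(x,\alpha(x,y^d_{[0,R]}(t))\bigr)$, and $y$ is evaluated along its trajectories as $y(t)=\varphi(x(t),u(t))$ with $u(t)=\alpha(x(t),y^d_{[0,R]}(t))$. The eigenvalues of the tracking error dynamics are the roots of the characteristic polynomials $\lambda^{\kappa^j}+\sum_{\beta=0}^{\kappa^j-1}a^{j,\beta}\lambda^\beta$, which are placed arbitrarily (e.g. in the open left half-plane, for asymptotic stability) by the choice of the coefficients $a^{j,\beta}$. *)

theory Defs
  imports "HOL-Analysis.Analysis"
begin

section \<open>Smooth maps between normed spaces\<close>

text \<open>Meant for open \<open>S\<close> and finite-dimensional domains, where continuity of all directional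
  derivatives up to order \<open>k\<close> is the usual notion of class \<open>C\<^sup>k\<close>.\<close>

primrec Ck_on :: "nat \<Rightarrow> 'a::real_normed_vector set \<Rightarrow> ('a \<Rightarrow> 'b::real_normed_vector) \<Rightarrow> bool" where
  "Ck_on 0 S f \<longleftrightarrow> continuous_on S f"
| "Ck_on (Suc k) S f \<longleftrightarrow>
     (\<forall>x\<in>S. f differentiable (at x)) \<and> (\<forall>v. Ck_on k S (\<lambda>x. frechet_derivative f (at x) v))"

definition smooth_on :: "'a::real_normed_vector set \<Rightarrow> ('a \<Rightarrow> 'b::real_normed_vector) \<Rightarrow> bool" where
  "smooth_on S f \<longleftrightarrow> (\<forall>k. Ck_on k S f)"


section \<open>Derivative orders\<close>

text \<open>The elements of a finite linearly ordered type \<open>'l\<close> serve, in increasing order, as the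
  derivative orders \<open>0, \<dots>, l\<^sub>u\<close> with \<open>l\<^sub>u = CARD('l) - 1\<close>.\<close>

definition ord_of :: "'l::{finite,linorder} \<Rightarrow> nat" where
  "ord_of k = card {..<k}"

definition slot :: "nat \<Rightarrow> 'l::{finite,linorder}" where
  "slot \<alpha> = (THE k. ord_of k = \<alpha>)"

lemma ord_of_less_iff: "ord_of i < ord_of k \<longleftrightarrow> i < (k::'l::{finite,linorder})"
proof -
  have less: "ord_of i < ord_of k" if "i < k" for i k :: 'l
  proof -
    have "{..<i} \<subset> {..<k}" using that by auto
    then show ?thesis unfolding ord_of_def by (intro psubset_card_mono) auto
  qed
  show ?thesis using less[of i k] less[of k i] by (metis less_asym linorder_less_linear)
qed

lemma bij_betw_ord_of: "bij_betw (ord_of :: 'l::{finite,linorder} \<Rightarrow> nat) UNIV {..<CARD('l)}"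
proof -
  have inj: "inj (ord_of :: 'l \<Rightarrow> nat)"
    by (rule injI) (metis less_irrefl linorder_less_linear ord_of_less_iff)
  have "ord_of k < CARD('l)" for k :: 'l
    unfolding ord_of_def by (rule psubset_card_mono) auto
  then have "range (ord_of :: 'l \<Rightarrow> nat) \<subseteq> {..<CARD('l)}" by auto
  moreover have "card (range (ord_of :: 'l \<Rightarrow> nat)) = card {..<CARD('l)}"
    using inj by (simp add: card_image)
  ultimately show ?thesis
    using inj by (simp add: bij_betw_def card_subset_eq)
qed

lemma slot_ord_of [simp]: "slot (ord_of k) = k"
  by (simp add: slot_def inj_eq[OF bij_betw_imp_inj_on[OF bij_betw_ord_of]])

lemma ord_of_slot [simp]:
  assumes "\<alpha> < CARD('l::{finite,linorder})"
  shows "ord_of (slot \<alpha> :: 'l) = \<alpha>"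
proof -
  obtain k :: 'l where "\<alpha> = ord_of k"
    using assms bij_betw_ord_of[where 'l='l] by (auto simp: bij_betw_def)
  then show ?thesis by simp
qed


section \<open>Prolonged system and time derivatives\<close>

text \<open>A point \<open>(x, w)\<close> of type \<open>jet\<close> has the coordinates \<open>x, u, u\<^sub>[\<^sub>1\<^sub>], \<dots>\<close>, where the \<open>\<alpha>\<close>-th time
  derivative of the input is \<open>w $ slot \<alpha>\<close>; in particular \<open>u = w $ slot 0\<close>.\<close>

type_synonym ('m, 'l) derivs = "((real, 'm) vec, 'l) vec"

type_synonym ('n, 'm, 'l) jet = "(real, 'n) vec \<times> ('m, 'l) derivs"

definition xu :: "('n::finite, 'm::finite, 'l::{finite,linorder}) jet \<Rightarrow> (real^'n) \<times> (real^'m)" where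
  "xu p = (fst p, snd p $ slot 0)"

definition prolonged_field ::
  "((real^'n) \<times> (real^'m) \<Rightarrow> real^'n) \<Rightarrow>
    ('n::finite, 'm::finite, 'l::{finite,linorder}) jet \<Rightarrow> ('n, 'm, 'l) jet" where
  "prolonged_field f p =
     (f (xu p), \<Sum>\<alpha><CARD('l) - 1. axis (slot \<alpha>) (snd p $ slot (Suc \<alpha>)))"

definition lie_derivative ::
  "('a::real_normed_vector \<Rightarrow> 'a) \<Rightarrow> ('a \<Rightarrow> 'b::real_normed_vector) \<Rightarrow> 'a \<Rightarrow> 'b" where
  "lie_derivative X h p = frechet_derivative h (at p) (X p)"

definition time_deriv ::
  "((real^'n) \<times> (real^'m) \<Rightarrow> real^'n) \<Rightarrow> ((real^'n) \<times> (real^'m) \<Rightarrow> real^'m) \<Rightarrow> nat \<Rightarrow>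
    ('n::finite, 'm::finite, 'l::{finite,linorder}) jet \<Rightarrow> real^'m" where
  "time_deriv f \<phi> \<alpha> = (lie_derivative (prolonged_field f) ^^ \<alpha>) (\<phi> \<circ> xu)"

text \<open>For a sequence \<open>h = (h\<^sub>[\<^sub>0\<^sub>], h\<^sub>[\<^sub>1\<^sub>], \<dots>)\<close> the collection of all \<open>h\<^sup>j\<^sub>[\<^sub>\<beta>\<^sub>]\<close> with \<open>\<beta> < B j\<close>. Entries of
  higher order are set to zero, so a function of \<open>collect B h\<close> is a function of these components
  only. Since multi-indices are natural numbers, \<open>h\<^bsub>[0,B-1]\<^esub>\<close> is \<open>collect B h\<close>, which for
  \<open>B j = 0\<close> contains nothing of \<open>h\<^sup>j\<close>, and \<open>h\<^bsub>[0,B]\<^esub>\<close> is \<open>collect (\<lambda>j. B j + 1) h\<close>.\<close>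

definition collect :: "('m::finite \<Rightarrow> nat) \<Rightarrow> (nat \<Rightarrow> real^'m) \<Rightarrow> ('m, 'l::{finite,linorder}) derivs" where
  "collect B h = (\<chi> k j. if ord_of k < B j then h (ord_of k) $ j else 0)"


section \<open>Flatness\<close>

definition flat_with ::
  "('n::finite, 'm::finite, 'l::{finite,linorder}) jet set \<Rightarrow>
    ((real^'n) \<times> (real^'m) \<Rightarrow> real^'n) \<Rightarrow> ((real^'n) \<times> (real^'m) \<Rightarrow> real^'m) \<Rightarrow>
    ('m \<Rightarrow> nat) \<Rightarrow> bool" where
  "flat_with V f \<phi> R \<longleftrightarrow>
     (\<forall>p\<in>V. \<exists>N Yx Yu (Fx :: ('m, 'l) derivs \<Rightarrow> real^'n) (Fu :: ('m, 'l) derivs \<Rightarrow> real^'m).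
        open N \<and> p \<in> N \<and> N \<subseteq> V \<and>
        open Yx \<and> smooth_on Yx Fx \<and> open Yu \<and> smooth_on Yu Fu \<and>
        (\<forall>q\<in>N.
           let yx = collect R (\<lambda>\<beta>. time_deriv f \<phi> \<beta> q);
               yu = collect (\<lambda>j. R j + 1) (\<lambda>\<beta>. time_deriv f \<phi> \<beta> q)
           in yx \<in> Yx \<and> yu \<in> Yu \<and> xu q = (Fx yx, Fu yu)))"

text \<open>\<open>\<phi>\<close> is an \<open>(x, u)\<close>-flat output on \<open>V\<close> and \<open>R\<close> its minimal multi-index.\<close>

definition xu_flat_output ::
  "('n::finite, 'm::finite, 'l::{finite,linorder}) jet set \<Rightarrow>
    ((real^'n) \<times> (real^'m) \<Rightarrow> real^'n) \<Rightarrow> ((real^'n) \<times> (real^'m) \<Rightarrow> real^'m) \<Rightarrow>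
    ('m \<Rightarrow> nat) \<Rightarrow> bool" where
  "xu_flat_output V f \<phi> R \<longleftrightarrow>
     flat_with V f \<phi> R \<and> (\<forall>R'. flat_with V f \<phi> R' \<and> R' \<le> R \<longrightarrow> R' = R)"


section \<open>Closed-loop tracking\<close>

definition times_differentiable_on :: "nat \<Rightarrow> real set \<Rightarrow> (real \<Rightarrow> real) \<Rightarrow> bool" where
  "times_differentiable_on k I g \<longleftrightarrow> (\<forall>\<beta><k. \<forall>t\<in>I. (deriv ^^ \<beta>) g differentiable (at t))"

definition ref_jet :: "('m::finite \<Rightarrow> nat) \<Rightarrow> (real \<Rightarrow> real^'m) \<Rightarrow> real \<Rightarrow> ('m, 'l::{finite,linorder}) derivs" where
  "ref_jet R yd t = collect (\<lambda>j. R j + 1) (\<lambda>\<beta>. \<chi> j. (deriv ^^ \<beta>) (\<lambda>s. yd s $ j) t)"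

definition closed_loop_solution ::
  "((real^'n::finite) \<times> (real^'m::finite) \<Rightarrow> real^'n) \<Rightarrow> ((real^'n) \<times> ('m, 'l::{finite,linorder}) derivs \<Rightarrow> real^'m) \<Rightarrow>
    ((real^'n) \<times> ('m, 'l) derivs) set \<Rightarrow> ('m \<Rightarrow> nat) \<Rightarrow> (real \<Rightarrow> real^'m) \<Rightarrow>
    real set \<Rightarrow> (real \<Rightarrow> real^'n) \<Rightarrow> bool" where
  "closed_loop_solution f \<alpha> W R yd I x \<longleftrightarrow>
     (\<forall>t\<in>I. (x t, ref_jet R yd t) \<in> W \<and>
        (x has_vector_derivative f (x t, \<alpha> (x t, ref_jet R yd t))) (at t))"

definition linear_error_dynamics ::
  "('m \<Rightarrow> nat) \<Rightarrow> ('m \<Rightarrow> nat \<Rightarrow> real) \<Rightarrow> real set \<Rightarrow> (real \<Rightarrow> real^'m::finite) \<Rightarrow> bool" where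
  "linear_error_dynamics \<kappa> a I e \<longleftrightarrow>
     (\<forall>j. times_differentiable_on (\<kappa> j) I (\<lambda>t. e t $ j) \<and>
        (\<forall>t\<in>I. (deriv ^^ \<kappa> j) (\<lambda>s. e s $ j) t
           + (\<Sum>\<beta><\<kappa> j. a j \<beta> * (deriv ^^ \<beta>) (\<lambda>s. e s $ j) t) = 0))"

text \<open>Around the jet \<open>q\<close> there is a smooth law \<open>u = \<alpha>(x, y\<^sup>d\<^bsub>[0,R]\<^esub>)\<close>, defined on an open set \<open>W\<close>, that
  enforces the error dynamics as long as the closed loop stays in \<open>W\<close>. Around \<open>q\<close> means that \<open>W\<close>
  is a neighbourhood of the state of \<open>q\<close> together with the jet of the flat output at \<open>q\<close>, and that
  \<open>\<alpha>\<close> returns there the input of \<open>q\<close>. \<open>S\<close> is the domain of the system.\<close>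

definition tracking_law_at ::
  "((real^'n) \<times> (real^'m)) set \<Rightarrow> ((real^'n) \<times> (real^'m) \<Rightarrow> real^'n) \<Rightarrow>
    ((real^'n) \<times> (real^'m) \<Rightarrow> real^'m) \<Rightarrow> ('m \<Rightarrow> nat) \<Rightarrow> ('m \<Rightarrow> nat) \<Rightarrow> ('m \<Rightarrow> nat \<Rightarrow> real) \<Rightarrow>
    ('n::finite, 'm::finite, 'l::{finite,linorder}) jet \<Rightarrow> bool" where
  "tracking_law_at S f \<phi> R \<kappa> a q \<longleftrightarrow>
     (\<exists>W (\<alpha> :: (real^'n) \<times> ('m, 'l) derivs \<Rightarrow> real^'m).
        let c = (fst q, collect (\<lambda>j. R j + 1) (\<lambda>\<beta>. time_deriv f \<phi> \<beta> q)) in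
        open W \<and> c \<in> W \<and> smooth_on W \<alpha> \<and> (fst c, \<alpha> c) = xu q \<and>
        (\<forall>\<xi>\<in>W. (fst \<xi>, \<alpha> \<xi>) \<in> S) \<and>
        (\<forall>I yd x. open I \<and> is_interval I \<and>
           (\<forall>j. times_differentiable_on (R j) I (\<lambda>t. yd t $ j)) \<and>
           closed_loop_solution f \<alpha> W R yd I x \<longrightarrow>
           linear_error_dynamics \<kappa> a I (\<lambda>t. \<phi> (x t, \<alpha> (x t, ref_jet R yd t)) - yd t)))"

end

theory Submission
  imports Defs
begin

text \<open>The multi-index \<open>\<kappa>\<close> comes from a structure algorithm. At a point where all ranks are locally
  constant, pick successively for \<open>\<beta> = 0, 1, \<dots>\<close> an increasing sequence of index sets \<open>J \<beta>\<close> such that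
  the \<open>dy\<^sup>j\<^sub>[\<^sub>\<beta>\<^sub>]\<close> with \<open>j \<in> J \<beta>\<close> form a basis of the differentials of order \<open>\<beta>\<close> modulo \<open>dx\<close> and the lower orders;
  \<open>\<kappa> j\<close> is the first \<open>\<beta>\<close> with \<open>j \<in> J \<beta>\<close>. That such a sequence increases, and that \<open>|\<kappa>| = n\<close>, follows
  by counting dimensions, since linear dependence of differentials is preserved by the Lie derivative and the
  \<open>dy\<^sup>j\<^sub>[\<^sub>\<beta>\<^sub>]\<close> are independent.

  For the control law, let the \<open>n\<close> numbers \<open>\<epsilon> = (e\<^sup>j\<^sub>[\<^sub>\<beta>\<^sub>])\<close> with \<open>\<beta> < \<kappa> j\<close> be unknown. The desired error dynamics
  extends them to all orders, so \<open>x = F\<^sub>x(y\<^sup>d + e)\<close> is a system of \<open>n\<close> equations for \<open>\<epsilon>\<close>, which by the triangular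
  structure of \<open>\<kappa>\<close> is regular for every choice of the coefficients. Solving it for \<open>\<epsilon>\<close> and inserting the
  result into \<open>F\<^sub>u\<close> gives \<open>\<alpha>\<close>. Along the closed loop \<open>\<epsilon>\<close> then satisfies the error dynamics, because the
  defect solves the linearised equations with right-hand side \<open>0\<close>.\<close>

section \<open>Calculus of smooth maps\<close>

text \<open>Flatness as assumed provides only the maps \<open>Fx\<close> and \<open>Fu\<close>;
  independence of the output differentials must be extracted from it with finitely many derivatives.
  Let \<open>m\<close> be the number of inputs and \<open>r\<close> the maximum of \<open>R\<close>.
  The differentials of the input derivatives up to order \<open>s\<close> are
  \<open>m (s + 1)\<close> independent coordinates, generated by the outputs up to order
  \<open>r + s\<close>. A dimension missing at some order up to \<open>r\<close> is missing at every
  later one, and over the \<open>s + 1\<close> orders from \<open>r\<close> on this loses more than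
  the surplus \<open>m r\<close> once \<open>s = m r\<close>; hence the size required of
  \<open>CARD('l)\<close>. Dependence persists only where ranks are locally constant, so the law
  exists on an open dense set, found by semicontinuity of the ranks of a finite family. Two
  constraints shape the law. A reference is differentiable only \<open>R j\<close> times, so the
  error must be solved from orders below \<open>R\<close>, and order \<open>R j\<close> enters the
  input alone. Moreover \<open>Fx\<close> and \<open>Fu\<close> say nothing about \<open>y\<close>
  at arbitrary arguments; the law is therefore confined to output jets attained by points of the jet
  space, which are abundant by the same independence.\<close>

lemma Ck_on_Suc_imp_Ck_on: "Ck_on (Suc k) S f \<Longrightarrow> Ck_on k S f"
proof (induction k arbitrary: f)
  case 0
  then have "\<forall>x\<in>S. f differentiable (at x)" by simp
  then show ?case
    by (auto intro!: differentiable_imp_continuous_on differentiable_at_imp_differentiable_on)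
next
  case (Suc k)
  then show ?case by (metis Ck_on.simps(2))
qed

lemma Ck_on_subset: "Ck_on k S f \<Longrightarrow> T \<subseteq> S \<Longrightarrow> Ck_on k T f"
  by (induction k arbitrary: f) (auto intro: continuous_on_subset)

lemma Ck_on_Suc_has_derivative:
  "Ck_on (Suc k) S f \<Longrightarrow> x \<in> S \<Longrightarrow> (f has_derivative frechet_derivative f (at x)) (at x)"
  using frechet_derivative_works by auto

lemma Ck_on_frechet_derivative:
  "Ck_on (Suc k) S f \<Longrightarrow> Ck_on k S (\<lambda>x. frechet_derivative f (at x) v)"
  by simp

lemma Ck_on_cong:
  assumes "open S" and "\<And>x. x \<in> S \<Longrightarrow> f x = g x" and "Ck_on k S f"
  shows "Ck_on k S g"
  using assms(2,3)
proof (induction k arbitrary: f g)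
  case 0
  then show ?case by (metis Ck_on.simps(1) continuous_on_cong)
next
  case (Suc k)
  have der: "(g has_derivative frechet_derivative f (at x)) (at x)" if "x \<in> S" for x
  proof (rule has_derivative_transform_within_open)
    show "(f has_derivative frechet_derivative f (at x)) (at x)"
      using Ck_on_Suc_has_derivative[OF Suc.prems(2) that] .
  qed (use Suc.prems that \<open>open S\<close> in auto)
  have eq: "frechet_derivative f (at x) = frechet_derivative g (at x)" if "x \<in> S" for x
    using frechet_derivative_at[OF der[OF that]] .
  have "Ck_on k S (\<lambda>x. frechet_derivative g (at x) v)" for v
    by (rule Suc.IH[of "\<lambda>x. frechet_derivative f (at x) v"]) (use eq Suc.prems(2) in auto)
  with der show ?case by (auto simp: differentiable_def)
qed

text \<open>Allows the derivative to be given by an explicit formula \<open>f'\<close> instead of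
  \<open>frechet_derivative\<close>; the inductions on the order below enter through it.\<close>

lemma Ck_on_SucI:
  assumes "open S" and "\<And>x. x \<in> S \<Longrightarrow> (f has_derivative f' x) (at x)"
    and "\<And>v. Ck_on k S (\<lambda>x. f' x v)"
  shows "Ck_on (Suc k) S f"
proof -
  have "Ck_on k S (\<lambda>x. frechet_derivative f (at x) v)" for v
    by (rule Ck_on_cong[OF assms(1) _ assms(3)]) (simp add: frechet_derivative_at[OF assms(2), symmetric])
  then show ?thesis using assms(2) by (auto simp: differentiable_def)
qed

lemma Ck_on_const: "open S \<Longrightarrow> Ck_on k S (\<lambda>x. c)"
proof (induction k arbitrary: c)
  case (Suc k)
  show ?case by (rule Ck_on_SucI[where f'="\<lambda>x v. 0"]) (use Suc in auto)
qed simp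

lemma Ck_on_linear:
  assumes "open S" and "bounded_linear f"
  shows "Ck_on k S f"
proof (cases k)
  case 0
  then show ?thesis
    using assms(2) by (simp add: linear_continuous_on)
next
  case (Suc j)
  show ?thesis unfolding Suc
    by (rule Ck_on_SucI[where f'="\<lambda>x. f"])
      (use assms in \<open>auto intro: Ck_on_const bounded_linear_imp_has_derivative\<close>)
qed

lemma Ck_on_linear_comp:
  assumes "open S" and "bounded_linear L" and "Ck_on k S f"
  shows "Ck_on k S (\<lambda>x. L (f x))"
  using assms(3)
proof (induction k arbitrary: f)
  case 0
  then show ?case
    by (auto intro: continuous_on_compose2[OF linear_continuous_on[OF assms(2)]])
next
  case (Suc k)
  show ?case
    by (rule Ck_on_SucI[where f'="\<lambda>x v. L (frechet_derivative f (at x) v)"])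
      (intro assms bounded_linear.has_derivative[OF assms(2)] Ck_on_Suc_has_derivative[OF Suc.prems]
        Suc.IH Ck_on_frechet_derivative[OF Suc.prems]; assumption)+
qed

lemma Ck_on_add:
  assumes "open S" and "Ck_on k S f" and "Ck_on k S g"
  shows "Ck_on k S (\<lambda>x. f x + g x)"
  using assms(2,3)
proof (induction k arbitrary: f g)
  case 0
  then show ?case by (auto intro: continuous_intros)
next
  case (Suc k)
  show ?case
    by (rule Ck_on_SucI[where
          f'="\<lambda>x v. frechet_derivative f (at x) v + frechet_derivative g (at x) v"])
      (intro assms has_derivative_add Suc.IH Ck_on_Suc_has_derivative[OF Suc.prems(1)]
        Ck_on_Suc_has_derivative[OF Suc.prems(2)] Ck_on_frechet_derivative Suc.prems; assumption)+
qed

lemma Ck_on_sum: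
  assumes "open S" and "\<And>i. i \<in> I \<Longrightarrow> Ck_on k S (f i)"
  shows "Ck_on k S (\<lambda>x. \<Sum>i\<in>I. f i x)"
  using assms(2)
  by (induction I rule: infinite_finite_induct)
    (auto intro: Ck_on_const Ck_on_add assms(1))

lemma Ck_on_scaleR:
  fixes f :: "'a::real_normed_vector \<Rightarrow> real"
  assumes "open S" and "Ck_on k S f" and "Ck_on k S g"
  shows "Ck_on k S (\<lambda>x. f x *\<^sub>R g x)"
  using assms(2,3)
proof (induction k arbitrary: f g)
  case 0
  then show ?case by (auto intro: continuous_intros)
next
  case (Suc k)
  have "Ck_on k S f" "Ck_on k S g" using Suc.prems Ck_on_Suc_imp_Ck_on by auto
  then show ?case
    by (intro Ck_on_SucI[where
          f'="\<lambda>x v. f x *\<^sub>R frechet_derivative g (at x) v + frechet_derivative f (at x) v *\<^sub>R g x"])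
      (intro assms has_derivative_scaleR Ck_on_add Suc.IH Ck_on_Suc_has_derivative[OF Suc.prems(1)]
        Ck_on_Suc_has_derivative[OF Suc.prems(2)] Ck_on_frechet_derivative Suc.prems; assumption)+
qed

lemma Ck_on_mult:
  fixes f g :: "'a::real_normed_vector \<Rightarrow> real"
  assumes "open S" and "Ck_on k S f" and "Ck_on k S g"
  shows "Ck_on k S (\<lambda>x. f x * g x)"
  using Ck_on_scaleR[OF assms] by simp

lemma Ck_on_prod:
  fixes f :: "'i \<Rightarrow> 'a::real_normed_vector \<Rightarrow> real"
  assumes "open S" and "\<And>i. i \<in> I \<Longrightarrow> Ck_on k S (f i)"
  shows "Ck_on k S (\<lambda>x. \<Prod>i\<in>I. f i x)"
  using assms(2)
  by (induction I rule: infinite_finite_induct)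
    (auto intro: Ck_on_const Ck_on_mult assms(1))

lemma Ck_on_componentwise:
  fixes f :: "'a::real_normed_vector \<Rightarrow> 'b::euclidean_space"
  assumes "open S" and "\<And>b. b \<in> Basis \<Longrightarrow> Ck_on k S (\<lambda>x. f x \<bullet> b)"
  shows "Ck_on k S f"
proof -
  have "Ck_on k S (\<lambda>x. \<Sum>b\<in>Basis. (f x \<bullet> b) *\<^sub>R b)"
    by (intro Ck_on_sum Ck_on_scaleR Ck_on_const assms)
  then show ?thesis by (simp add: euclidean_representation)
qed

lemma Ck_on_vec:
  fixes f :: "'a::real_normed_vector \<Rightarrow> real^'n"
  assumes "open S" and "\<And>i. Ck_on k S (\<lambda>x. f x $ i)"
  shows "Ck_on k S f"
  by (rule Ck_on_componentwise[OF assms(1)])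
    (use assms(2) in \<open>auto simp: Basis_vec_def inner_axis\<close>)

lemma Ck_on_Pair:
  assumes "open S" and "Ck_on k S f" and "Ck_on k S g"
  shows "Ck_on k S (\<lambda>x. (f x, g x))"
proof -
  have "Ck_on k S (\<lambda>x. (f x, 0) + (0, g x))"
    by (intro Ck_on_add assms(1)
        Ck_on_linear_comp[OF assms(1) _ assms(2), of "\<lambda>y. (y, 0)"]
        Ck_on_linear_comp[OF assms(1) _ assms(3), of "\<lambda>y. (0, y)"]
        bounded_linear_Pair bounded_linear_ident bounded_linear_zero)
  then show ?thesis by simp
qed

lemma linear_eq_sum_Basis:
  fixes L :: "'b::euclidean_space \<Rightarrow> 'c::real_vector"
  assumes "linear L"
  shows "L v = (\<Sum>b\<in>Basis. (v \<bullet> b) *\<^sub>R L b)"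
proof -
  have "L v = L (\<Sum>b\<in>Basis. (v \<bullet> b) *\<^sub>R b)" by (simp add: euclidean_representation)
  also have "\<dots> = (\<Sum>b\<in>Basis. (v \<bullet> b) *\<^sub>R L b)"
    by (simp add: linear_sum[OF assms] linear_scale[OF assms])
  finally show ?thesis .
qed

text \<open>\<open>Ck_on\<close> controls derivatives in fixed directions only, while the chain rule
  applies the derivative of \<open>g\<close> to a vector that moves with \<open>x\<close>. Expanding
  this vector in the basis of the intermediate space leaves scalar functions times derivatives in
  fixed directions.\<close>

lemma Ck_on_compose:
  fixes f :: "'a::real_normed_vector \<Rightarrow> 'b::euclidean_space"
  assumes "open S" and "open T" and "f ` S \<subseteq> T" and "Ck_on k S f" and "Ck_on k T g"
  shows "Ck_on k S (\<lambda>x. g (f x))"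
  using assms(4,5)
proof (induction k arbitrary: g)
  case 0
  then show ?case using assms(3) by (auto intro: continuous_on_compose2)
next
  case (Suc k)
  have f: "Ck_on k S f" using Suc.prems Ck_on_Suc_imp_Ck_on by auto
  define d where "d x v = (\<Sum>b\<in>Basis. (frechet_derivative f (at x) v \<bullet> b) *\<^sub>R
    frechet_derivative g (at (f x)) b)" for x v
  show ?case
  proof (rule Ck_on_SucI[where f'=d, OF assms(1)])
    fix x assume x: "x \<in> S"
    have gx: "(g has_derivative frechet_derivative g (at (f x))) (at (f x))"
      using Ck_on_Suc_has_derivative[OF Suc.prems(2)] x assms(3) by blast
    have "((\<lambda>x. g (f x)) has_derivative
        (\<lambda>v. frechet_derivative g (at (f x)) (frechet_derivative f (at x) v))) (at x)"
      using diff_chain_at[OF Ck_on_Suc_has_derivative[OF Suc.prems(1) x] gx] by (simp add: o_def)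
    moreover have "(\<lambda>v. frechet_derivative g (at (f x)) (frechet_derivative f (at x) v)) = d x"
      unfolding d_def
      by (rule ext, rule linear_eq_sum_Basis) (use gx has_derivative_linear in blast)
    ultimately show "((\<lambda>x. g (f x)) has_derivative d x) (at x)" by simp
  next
    fix v
    show "Ck_on k S (\<lambda>x. d x v)" unfolding d_def
    proof (rule Ck_on_sum[OF assms(1)], rule Ck_on_scaleR[OF assms(1)])
      fix b :: 'b
      show "Ck_on k S (\<lambda>x. frechet_derivative f (at x) v \<bullet> b)"
        by (rule Ck_on_linear_comp[OF assms(1) bounded_linear_inner_left
              Ck_on_frechet_derivative[OF Suc.prems(1)]])
      show "Ck_on k S (\<lambda>x. frechet_derivative g (at (f x)) b)"
        by (rule Suc.IH[OF f Ck_on_frechet_derivative[OF Suc.prems(2)]])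
    qed
  qed
qed

lemma Ck_on_inverse:
  fixes f :: "'a::real_normed_vector \<Rightarrow> real"
  assumes "open S" and "Ck_on k S f" and "\<And>x. x \<in> S \<Longrightarrow> f x \<noteq> 0"
  shows "Ck_on k S (\<lambda>x. inverse (f x))"
  using assms(2)
proof (induction k)
  case 0
  then show ?case using assms(3) by (auto intro!: continuous_intros)
next
  case (Suc k)
  then have IH: "Ck_on k S (\<lambda>x. inverse (f x))" using Ck_on_Suc_imp_Ck_on by auto
  show ?case
  proof (rule Ck_on_SucI[OF assms(1), where
        f'="\<lambda>x v. (- 1) * (inverse (f x) * (frechet_derivative f (at x) v * inverse (f x)))"])
    fix x assume "x \<in> S"
    then have "((\<lambda>x. inverse (f x)) has_derivative
      (\<lambda>v. - (inverse (f x) * frechet_derivative f (at x) v * inverse (f x)))) (at x)"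
      by (intro Deriv.has_derivative_inverse Ck_on_Suc_has_derivative[OF Suc.prems] assms(3))
    then show "((\<lambda>x. inverse (f x)) has_derivative (\<lambda>v. (- 1) *
        (inverse (f x) * (frechet_derivative f (at x) v * inverse (f x))))) (at x)"
      by (simp add: mult.assoc)
  next
    fix v
    show "Ck_on k S (\<lambda>x. (- 1) * (inverse (f x) * (frechet_derivative f (at x) v * inverse (f x))))"
      by (intro Ck_on_mult Ck_on_const assms(1) IH Ck_on_frechet_derivative[OF Suc.prems])
  qed
qed

lemma smooth_on_subset: "smooth_on S f \<Longrightarrow> T \<subseteq> S \<Longrightarrow> smooth_on T f"
  by (auto simp: smooth_on_def intro: Ck_on_subset)

lemma smooth_on_cong: "open S \<Longrightarrow> (\<And>x. x \<in> S \<Longrightarrow> f x = g x) \<Longrightarrow> smooth_on S f \<Longrightarrow> smooth_on S g"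
  unfolding smooth_on_def using Ck_on_cong by blast

lemma smooth_on_linear_comp:
  "open S \<Longrightarrow> bounded_linear L \<Longrightarrow> smooth_on S f \<Longrightarrow> smooth_on S (\<lambda>x. L (f x))"
  by (auto simp: smooth_on_def intro: Ck_on_linear_comp)

lemma smooth_on_linear: "open S \<Longrightarrow> bounded_linear f \<Longrightarrow> smooth_on S f"
  by (auto simp: smooth_on_def intro: Ck_on_linear)

lemma smooth_on_add:
  "open S \<Longrightarrow> smooth_on S f \<Longrightarrow> smooth_on S g \<Longrightarrow> smooth_on S (\<lambda>x. f x + g x)"
  by (auto simp: smooth_on_def intro: Ck_on_add)

lemma smooth_on_Pair:
  "open S \<Longrightarrow> smooth_on S f \<Longrightarrow> smooth_on S g \<Longrightarrow> smooth_on S (\<lambda>x. (f x, g x))"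
  by (auto simp: smooth_on_def intro: Ck_on_Pair)

lemma smooth_on_compose:
  fixes f :: "'a::real_normed_vector \<Rightarrow> 'b::euclidean_space"
  assumes "open S" and "open T" and "f ` S \<subseteq> T" and "smooth_on S f" and "smooth_on T g"
  shows "smooth_on S (\<lambda>x. g (f x))"
  using assms unfolding smooth_on_def by (auto intro: Ck_on_compose)

lemma smooth_on_frechet_derivative:
  "smooth_on S f \<Longrightarrow> smooth_on S (\<lambda>x. frechet_derivative f (at x) v)"
  unfolding smooth_on_def by (auto intro: Ck_on_frechet_derivative)

lemma smooth_on_has_derivative:
  "smooth_on S f \<Longrightarrow> x \<in> S \<Longrightarrow> (f has_derivative frechet_derivative f (at x)) (at x)"
  unfolding smooth_on_def by (auto intro: Ck_on_Suc_has_derivative)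

lemma smooth_on_imp_continuous_on: "smooth_on S f \<Longrightarrow> continuous_on S f"
  unfolding smooth_on_def by (drule spec[of _ 0]) simp

lemma smooth_on_lie_derivative:
  fixes X :: "'a::euclidean_space \<Rightarrow> 'a"
  assumes "open S" and "smooth_on S X" and "smooth_on S h"
  shows "smooth_on S (lie_derivative X h)"
proof (rule smooth_on_cong[OF assms(1)])
  show "smooth_on S (\<lambda>x. \<Sum>b\<in>Basis. (X x \<bullet> b) *\<^sub>R frechet_derivative h (at x) b)"
    unfolding smooth_on_def
  proof (intro allI, rule Ck_on_sum[OF assms(1)], rule Ck_on_scaleR[OF assms(1)])
    fix k and b :: 'a
    show "Ck_on k S (\<lambda>x. X x \<bullet> b)"
      using assms(2) unfolding smooth_on_def
      by (intro Ck_on_linear_comp[OF assms(1) bounded_linear_inner_left]) blast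
    show "Ck_on k S (\<lambda>x. frechet_derivative h (at x) b)"
      using smooth_on_frechet_derivative[OF assms(3)] by (auto simp: smooth_on_def)
  qed
next
  fix x assume "x \<in> S"
  then have "linear (frechet_derivative h (at x))"
    using smooth_on_has_derivative[OF assms(3)] has_derivative_linear by blast
  then show "(\<Sum>b\<in>Basis. (X x \<bullet> b) *\<^sub>R frechet_derivative h (at x) b) = lie_derivative X h x"
    unfolding lie_derivative_def by (rule linear_eq_sum_Basis[symmetric])
qed

section \<open>Symmetry of second derivatives\<close>

lemma second_difference_quotient_tendsto:
  fixes h :: "'a::real_normed_vector \<Rightarrow> real"
  assumes "open S" and "p \<in> S" and h: "\<And>x. x \<in> S \<Longrightarrow> (h has_derivative h' x) (at x)"
    and k: "((\<lambda>x. h' x v) has_derivative k') (at p)"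
  shows "((\<lambda>s. (h (p + s *\<^sub>R v + s *\<^sub>R w) - h (p + s *\<^sub>R v) - h (p + s *\<^sub>R w) + h p) / s\<^sup>2)
    \<longlongrightarrow> k' w) (at_right 0)"
    (is "(?\<Delta> \<longlongrightarrow> _) _")
proof (rule tendstoI)
  fix e :: real assume "e > 0"
  \<comment> \<open>All points met below lie within \<open>s * C\<close> of \<open>p\<close>, as
    both steps are at most \<open>s\<close>; the \<open>+ 1\<close> keeps \<open>C\<close> positive.
    With \<open>e / (4 * C)\<close> the two uses of the estimate cost \<open>s * (e / 2)\<close>
    together.\<close>
  define C where "C = norm v + norm w + 1"
  have C: "C > 0" unfolding C_def by (simp add: add_nonneg_pos)
  define e' where "e' = e / (4 * C)"
  have e': "e' > 0" using \<open>e > 0\<close> C by (simp add: e'_def)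
  obtain \<rho> where \<rho>: "\<rho> > 0" "ball p \<rho> \<subseteq> S" using assms(1,2) openE by blast
  obtain \<delta> where \<delta>: "\<delta> > 0" and
    small: "\<And>y. norm (y - p) < \<delta> \<Longrightarrow> \<bar>h' y v - h' p v - k' (y - p)\<bar> \<le> e' * norm (y - p)"
    using k e' unfolding has_derivative_at_alt by (metis real_norm_def)
  interpret k': bounded_linear k' using k has_derivative_bounded_linear by blast
  define s0 where "s0 = min \<rho> \<delta> / C"
  have s0: "s0 > 0" using \<rho> \<delta> C by (simp add: s0_def)
  have "dist (?\<Delta> s) (k' w) < e" if s: "0 < s" "s < s0" for s
  proof -
    have sC: "s * C < min \<rho> \<delta>" using s C by (simp add: s0_def field_simps)
    have nrm: "norm (\<tau> *\<^sub>R v + \<sigma> *\<^sub>R w) \<le> s * C" if "0 \<le> \<tau>" "\<tau> \<le> s" "0 \<le> \<sigma>" "\<sigma> \<le> s" for \<tau> \<sigma>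
    proof -
      have "norm (\<tau> *\<^sub>R v + \<sigma> *\<^sub>R w) \<le> \<tau> * norm v + \<sigma> * norm w"
        using norm_triangle_ineq[of "\<tau> *\<^sub>R v" "\<sigma> *\<^sub>R w"] that by simp
      also have "\<dots> \<le> s * norm v + s * norm w"
        using that by (intro add_mono mult_right_mono) auto
      also have "\<dots> \<le> s * C" using s by (simp add: C_def algebra_simps)
      finally show ?thesis .
    qed
    have inS: "p + \<tau> *\<^sub>R v + \<sigma> *\<^sub>R w \<in> S" if "0 \<le> \<tau>" "\<tau> \<le> s" "0 \<le> \<sigma>" "\<sigma> \<le> s" for \<tau> \<sigma>
    proof -
      have "dist p (p + \<tau> *\<^sub>R v + \<sigma> *\<^sub>R w) = norm (\<tau> *\<^sub>R v + \<sigma> *\<^sub>R w)"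
        unfolding add.assoc dist_norm by (metis add_diff_cancel_left' norm_minus_commute)
      then show ?thesis using nrm[OF that] sC \<rho>(2) by auto
    qed
    define \<phi> where "\<phi> \<tau> = h (p + \<tau> *\<^sub>R v + s *\<^sub>R w) - h (p + \<tau> *\<^sub>R v + 0 *\<^sub>R w)" for \<tau>
    have d1: "((\<lambda>\<tau>. h (p + \<tau> *\<^sub>R v + \<sigma> *\<^sub>R w)) has_real_derivative h' (p + \<tau> *\<^sub>R v + \<sigma> *\<^sub>R w) v) (at \<tau>)"
      if "0 \<le> \<tau>" "\<tau> \<le> s" "0 \<le> \<sigma>" "\<sigma> \<le> s" for \<tau> \<sigma>
    proof -
      have hd: "(h has_derivative h' (p + \<tau> *\<^sub>R v + \<sigma> *\<^sub>R w)) (at (p + \<tau> *\<^sub>R v + \<sigma> *\<^sub>R w))"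
        using h inS that by auto
      have "((\<lambda>\<tau>. p + \<tau> *\<^sub>R v + \<sigma> *\<^sub>R w) has_derivative (\<lambda>t. t *\<^sub>R v)) (at \<tau>)"
        by (auto intro!: derivative_eq_intros)
      from diff_chain_at[OF this hd]
      have "((\<lambda>\<tau>. h (p + \<tau> *\<^sub>R v + \<sigma> *\<^sub>R w)) has_derivative
          (\<lambda>t. h' (p + \<tau> *\<^sub>R v + \<sigma> *\<^sub>R w) (t *\<^sub>R v))) (at \<tau>)"
        by (simp add: o_def)
      moreover have "(\<lambda>t. h' (p + \<tau> *\<^sub>R v + \<sigma> *\<^sub>R w) (t *\<^sub>R v)) = (*) (h' (p + \<tau> *\<^sub>R v + \<sigma> *\<^sub>R w) v)"
        using linear_scale[OF has_derivative_linear[OF hd]] by (auto simp: mult.commute)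
      ultimately show ?thesis unfolding has_field_derivative_def by simp
    qed
    \<comment> \<open>The mean value theorem in direction \<open>v\<close> is applied to the
      difference taken in direction \<open>w\<close>. What remains are first derivatives of
      \<open>h\<close> at two points near \<open>p\<close>, and differentiability of
      \<open>h'\<close> at \<open>p\<close> alone compares them.\<close>
    have "\<exists>z. 0 < z \<and> z < s \<and> \<phi> s - \<phi> 0 =
        (s - 0) * (h' (p + z *\<^sub>R v + s *\<^sub>R w) v - h' (p + z *\<^sub>R v + 0 *\<^sub>R w) v)"
      unfolding \<phi>_def by (rule MVT2[OF s(1)]) (use s in \<open>intro DERIV_diff d1; simp\<close>)
    then obtain z where z: "0 < z" "z < s" and
      mv: "\<phi> s - \<phi> 0 = s * (h' (p + z *\<^sub>R v + s *\<^sub>R w) v - h' (p + z *\<^sub>R v + 0 *\<^sub>R w) v)"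
      by auto
    have est: "\<bar>h' (p + z *\<^sub>R v + \<sigma> *\<^sub>R w) v - h' p v - k' (z *\<^sub>R v + \<sigma> *\<^sub>R w)\<bar> \<le> e' * (s * C)"
      if "0 \<le> \<sigma>" "\<sigma> \<le> s" for \<sigma>
    proof -
      have n: "norm (z *\<^sub>R v + \<sigma> *\<^sub>R w) \<le> s * C" using nrm that z by simp
      have "\<bar>h' (p + z *\<^sub>R v + \<sigma> *\<^sub>R w) v - h' p v - k' (z *\<^sub>R v + \<sigma> *\<^sub>R w)\<bar>
          \<le> e' * norm (z *\<^sub>R v + \<sigma> *\<^sub>R w)"
        using small[of "p + z *\<^sub>R v + \<sigma> *\<^sub>R w"] n sC by (simp add: add.assoc)
      then show ?thesis using n e' by (smt (verit) mult_left_mono)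
    qed
    have "k' (z *\<^sub>R v + s *\<^sub>R w) - k' (z *\<^sub>R v + 0 *\<^sub>R w) = s * k' w"
      by (simp add: k'.add k'.scaleR)
    then have "\<bar>(h' (p + z *\<^sub>R v + s *\<^sub>R w) v - h' (p + z *\<^sub>R v + 0 *\<^sub>R w) v) - s * k' w\<bar>
        \<le> 2 * (e' * (s * C))"
      using est[of s] est[of 0] s by linarith
    also have "\<dots> = s * (e / 2)" using C by (simp add: e'_def field_simps)
    finally have *: "\<bar>(h' (p + z *\<^sub>R v + s *\<^sub>R w) v - h' (p + z *\<^sub>R v + 0 *\<^sub>R w) v) - s * k' w\<bar>
        \<le> s * (e / 2)" .
    have "?\<Delta> s = (\<phi> s - \<phi> 0) / s\<^sup>2" unfolding \<phi>_def by (simp add: algebra_simps)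
    also have "\<dots> = (h' (p + z *\<^sub>R v + s *\<^sub>R w) v - h' (p + z *\<^sub>R v + 0 *\<^sub>R w) v) / s"
      using s unfolding mv by (simp add: power2_eq_square)
    finally have "?\<Delta> s - k' w =
        ((h' (p + z *\<^sub>R v + s *\<^sub>R w) v - h' (p + z *\<^sub>R v + 0 *\<^sub>R w) v) - s * k' w) / s"
      using s by (simp add: field_simps)
    then have "\<bar>?\<Delta> s - k' w\<bar> \<le> e / 2"
      using * s by (simp add: abs_divide divide_le_eq mult.commute)
    then show ?thesis using \<open>e > 0\<close> by (simp add: dist_real_def)
  qed
  then show "\<forall>\<^sub>F s in at_right 0. dist (?\<Delta> s) (k' w) < e"
    using s0 unfolding eventually_at_right_field by blast
qed

text \<open>The mixed second difference quotient is unchanged when \<open>v\<close> and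
  \<open>w\<close> are exchanged, so its limit computes both sides.\<close>

lemma symmetric_second_derivative:
  fixes h :: "'a::real_normed_vector \<Rightarrow> real"
  assumes "open S" and "p \<in> S" and h: "smooth_on S h"
  shows "frechet_derivative (\<lambda>x. frechet_derivative h (at x) v) (at p) w
    = frechet_derivative (\<lambda>x. frechet_derivative h (at x) w) (at p) v"
proof -
  note h' = smooth_on_has_derivative[OF h]
  note k' = smooth_on_has_derivative[OF smooth_on_frechet_derivative[OF h] assms(2)]
  have *: "(\<lambda>s. (h (p + s *\<^sub>R w + s *\<^sub>R v) - h (p + s *\<^sub>R w) - h (p + s *\<^sub>R v) + h p) / s\<^sup>2)
    = (\<lambda>s. (h (p + s *\<^sub>R v + s *\<^sub>R w) - h (p + s *\<^sub>R v) - h (p + s *\<^sub>R w) + h p) / s\<^sup>2)"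
    by (simp add: algebra_simps)
  show ?thesis
    using second_difference_quotient_tendsto[OF assms(1,2) h' k', of v w]
      second_difference_quotient_tendsto[OF assms(1,2) h' k', of w v]
    unfolding * by (rule tendsto_unique[OF trivial_limit_at_right_real])
qed

section \<open>A smooth implicit function theorem with parameters\<close>

lemma Ck_on_det:
  fixes A :: "'a::real_normed_vector \<Rightarrow> real^'n^'n"
  assumes "open S" and "\<And>i j. Ck_on k S (\<lambda>x. A x $ i $ j)"
  shows "Ck_on k S (\<lambda>x. det (A x))"
  unfolding det_def
  by (rule Ck_on_sum[OF assms(1)], rule Ck_on_mult[OF assms(1) Ck_on_const[OF assms(1)]],
      rule Ck_on_prod[OF assms(1)], rule assms(2))

text \<open>The map sending \<open>(z, d)\<close> to \<open>(G (z, d), d)\<close> is inverted near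
  the given point. The inverse is at first only known to be differentiable; Cramer's rule writes its
  derivative as a quotient of determinants in derivatives of \<open>G\<close> at the inverse, which
  raises regularity one order at a time. The last conclusion keeps the partial derivative injective
  at nearby points, where it is needed again along trajectories.\<close>

lemma smooth_implicit_function:
  fixes G :: "(real^'n) \<times> 'd::euclidean_space \<Rightarrow> real^'n"
  assumes "open U" and G: "smooth_on U G" and "(z0, d0) \<in> U"
    and inj0: "\<And>v. frechet_derivative G (at (z0, d0)) (v, 0) = 0 \<Longrightarrow> v = 0"
  obtains T \<zeta> where "open T" and "(G (z0, d0), d0) \<in> T" and "smooth_on T \<zeta>"
    and "\<zeta> (G (z0, d0), d0) = z0"
    and "\<And>x d. (x, d) \<in> T \<Longrightarrow> (\<zeta> (x, d), d) \<in> U \<and> G (\<zeta> (x, d), d) = x"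
    and "\<And>x d v. (x, d) \<in> T \<Longrightarrow> frechet_derivative G (at (\<zeta> (x, d), d)) (v, 0) = 0 \<Longrightarrow> v = 0"
proof -
  define DG where "DG y v = frechet_derivative G (at y) v" for y v
  have DG: "(G has_derivative DG y) (at y)" if "y \<in> U" for y
    unfolding DG_def using smooth_on_has_derivative[OF G that] .
  define \<Psi> where "\<Psi> y = (G y, snd y)" for y
  define D\<Psi> where "D\<Psi> y v = (DG y v, snd v)" for y v
  have D\<Psi>: "(\<Psi> has_derivative D\<Psi> y) (at y)" if "y \<in> U" for y
    unfolding \<Psi>_def[abs_def] D\<Psi>_def
    by (rule has_derivative_Pair[OF DG[OF that] bounded_linear_imp_has_derivative[OF bounded_linear_snd]])
  have bl: "bounded_linear (D\<Psi> y)" if "y \<in> U" for y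
    using D\<Psi>[OF that] has_derivative_bounded_linear by blast
  define f' where "f' y = Blinfun (D\<Psi> y)" for y
  have f': "blinfun_apply (f' y) = D\<Psi> y" if "y \<in> U" for y
    unfolding f'_def using bl[OF that] by (rule bounded_linear_Blinfun_apply)
  have cont: "continuous_on U f'"
  proof (rule continuous_on_blinfun_componentwise)
    fix i :: "(real^'n) \<times> 'd"
    have "continuous_on U (\<lambda>y. D\<Psi> y i)"
      unfolding D\<Psi>_def DG_def
      by (intro continuous_on_Pair continuous_on_const smooth_on_imp_continuous_on
          smooth_on_frechet_derivative G)
    then show "continuous_on U (\<lambda>y. f' y i)"
      by (rule continuous_on_eq) (simp add: f')
  qed
  let ?y0 = "(z0, d0)"
  have lin0: "linear (D\<Psi> ?y0)" using bl[OF assms(3)] bounded_linear.linear by blast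
  have "inj (D\<Psi> ?y0)"
  proof (subst linear_injective_0[OF lin0], intro allI impI)
    fix v assume v: "D\<Psi> ?y0 v = 0"
    then have "snd v = 0" "DG ?y0 v = 0" by (auto simp: D\<Psi>_def zero_prod_def)
    then show "v = 0" using inj0[of "fst v"] unfolding DG_def by (metis prod.collapse zero_prod_def)
  qed
  then obtain j where j: "linear j" "j \<circ> D\<Psi> ?y0 = id"
    using linear_injective_left_inverse[OF lin0] by blast
  have jD: "j (D\<Psi> ?y0 i) = i" for i using fun_cong[OF j(2), of i] by simp
  have "bounded_linear j" using j(1) by (simp add: linear_conv_bounded_linear)
  then have "Blinfun j o\<^sub>L f' ?y0 = id_blinfun"
    by (intro blinfun_eqI) (simp only: blinfun_apply_blinfun_compose bounded_linear_Blinfun_apply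
        f'[OF assms(3)] jD blinfun_apply_id_blinfun id_apply)
  then obtain U' V g g' where U': "open U'" "U' \<subseteq> U" "?y0 \<in> U'" and V: "open V" "\<Psi> ?y0 \<in> V"
    and hom: "homeomorphism U' V \<Psi> g"
    and g': "\<And>y. y \<in> V \<Longrightarrow> (g has_derivative (g' y)) (at y)"
    and g'_inv: "\<And>y. y \<in> V \<Longrightarrow> g' y = inv (blinfun_apply (f' (g y)))"
    and bij: "\<And>y. y \<in> V \<Longrightarrow> bij (blinfun_apply (f' (g y)))"
    using inverse_function_theorem[OF assms(1) _ cont assms(3), of \<Psi>] D\<Psi> f' by metis
  have gU: "g y \<in> U" and \<Psi>g: "\<Psi> (g y) = y" if "y \<in> V" for y
    using hom U'(2) that unfolding homeomorphism_def by auto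
  define \<zeta> where "\<zeta> = fst \<circ> g"
  have g_eq: "g y = (\<zeta> y, snd y)" and Gg: "G (g y) = fst y" if "y \<in> V" for y
    using \<Psi>g[OF that] by (auto simp: \<Psi>_def \<zeta>_def prod_eq_iff)
  have inj: "v = 0" if "y \<in> V" "DG (g y) (v, 0) = 0" for y v
  proof -
    have "D\<Psi> (g y) (v, 0) = D\<Psi> (g y) 0"
      using that(2) has_derivative_linear[OF DG[OF gU[OF that(1)]]]
      by (simp add: D\<Psi>_def linear_0)
    then have "(v, 0 :: 'd) = 0"
      using bij[OF that(1)] f'[OF gU[OF that(1)]] by (auto dest!: bij_is_inj injD)
    then show ?thesis by (simp add: zero_prod_def)
  qed
  \<comment> \<open>The first component \<open>w\<close> of the derivative of the inverse in
    direction \<open>v\<close> solves \<open>M y *v w = b y v\<close>: the parameter component of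
    the direction is known and has been moved to the right-hand side.\<close>
  define M :: "(real^'n) \<times> 'd \<Rightarrow> real^'n^'n"
    where "M y = (\<chi> i j. DG (g y) (axis j 1, 0) $ i)" for y
  define b where "b y v = fst v - DG (g y) (0, snd v)" for y v
  have linM: "linear (\<lambda>w. DG (g y) (w, 0))" if "y \<in> V" for y
  proof -
    interpret DGy: bounded_linear "DG (g y)"
      using DG[OF gU[OF that]] has_derivative_bounded_linear by blast
    show ?thesis
    proof (rule linearI)
      show "DG (g y) (u + w, 0) = DG (g y) (u, 0) + DG (g y) (w, 0)" for u w
        using DGy.add[of "(u, 0)" "(w, 0)"] by simp
      show "DG (g y) (c *\<^sub>R w, 0) = c *\<^sub>R DG (g y) (w, 0)" for c w
        using DGy.scaleR[of c "(w, 0)"] by simp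
    qed
  qed
  have M_mult: "M y *v w = DG (g y) (w, 0)" if "y \<in> V" for y w
  proof -
    have "M y = matrix (\<lambda>w. DG (g y) (w, 0))" by (simp add: M_def matrix_def)
    then show ?thesis using fun_cong[OF matrix_vector_mul(2)[OF linM[OF that]]] by simp
  qed
  have detM: "det (M y) \<noteq> 0" if "y \<in> V" for y
  proof -
    have "inj ((*v) (M y))"
      unfolding linear_injective_0[OF matrix_vector_mul_linear]
      using inj[OF that] M_mult[OF that] by auto
    then show ?thesis using det_nz_iff_inj[OF matrix_vector_mul_linear[of "M y"]] by simp
  qed
  have fst_g': "fst (g' y v) = (\<chi> k. det (\<chi> i j. if j = k then b y v $ i else M y $ i $ j) / det (M y))"
    if y: "y \<in> V" for y v
  proof -
    have "D\<Psi> (g y) (g' y v) = v"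
      using bij[OF y] by (simp add: g'_inv[OF y] f'[OF gU[OF y], symmetric] bij_is_surj surj_f_inv_f)
    then have v: "DG (g y) (g' y v) = fst v" "snd (g' y v) = snd v"
      by (metis D\<Psi>_def fst_conv, metis D\<Psi>_def snd_conv)
    interpret DGy: bounded_linear "DG (g y)"
      using DG[OF gU[OF y]] has_derivative_bounded_linear by blast
    have "g' y v = (fst (g' y v), 0) + (0, snd v)" using v(2) by (simp add: prod_eq_iff)
    then have "DG (g y) (fst (g' y v), 0) = b y v"
      using v(1) DGy.add[of "(fst (g' y v), 0)" "(0, snd v)"] by (simp add: b_def algebra_simps)
    then have "M y *v fst (g' y v) = b y v" using M_mult[OF y] by simp
    then show ?thesis by (rule iffD1[OF cramer[OF detM[OF y]]])
  qed
  have "Ck_on k V \<zeta>" for k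
  proof (induction k)
    case 0
    have "continuous_on V g" using hom by (simp add: homeomorphism_def)
    then show ?case by (auto simp: \<zeta>_def intro: continuous_on_fst)
  next
    case (Suc k)
    \<comment> \<open>\<open>g\<close> is as regular as \<open>\<zeta>\<close>, its second component
      being linear. So the induction hypothesis already makes the Cramer quotient of class
      \<open>k\<close>, and \<open>\<zeta>\<close> gains one order.\<close>
    have "Ck_on k V (\<lambda>y. (\<zeta> y, snd y))"
      by (intro Ck_on_Pair V(1) Suc Ck_on_linear bounded_linear_snd)
    then have Ckg: "Ck_on k V g" by (rule Ck_on_cong[OF V(1), rotated]) (simp add: g_eq)
    have DGg: "Ck_on k V (\<lambda>y. DG (g y) v)" for v
      unfolding DG_def
      by (rule Ck_on_compose[OF V(1) assms(1) _ Ckg])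
        (use gU smooth_on_frechet_derivative[OF G] in \<open>auto simp: smooth_on_def\<close>)
    have M: "Ck_on k V (\<lambda>y. M y $ i $ j)" for i j
      unfolding M_def by (simp, rule Ck_on_linear_comp[OF V(1) bounded_linear_vec_nth DGg])
    have "Ck_on k V (\<lambda>y. fst v + (- 1) *\<^sub>R DG (g y) (0, snd v))" for v
      by (intro Ck_on_add Ck_on_scaleR Ck_on_const V(1) DGg)
    then have b: "Ck_on k V (\<lambda>y. b y v $ i)" for v i
      unfolding b_def by (intro Ck_on_linear_comp[OF V(1) bounded_linear_vec_nth]) simp
    show ?case
    proof (rule Ck_on_SucI[OF V(1)])
      show "(\<zeta> has_derivative (\<lambda>v. fst (g' y v))) (at y)" if "y \<in> V" for y
        unfolding \<zeta>_def o_def by (rule has_derivative_fst[OF g'[OF that]])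
      fix v
      have entry: "Ck_on k V (\<lambda>y. (\<chi> i j. if j = l then b y v $ i else M y $ i $ j) $ i $ j)" for l i j
        using b M by (cases "j = l") simp_all
      have "Ck_on k V (\<lambda>y. (\<chi> k. det (\<chi> i j. if j = k then b y v $ i else M y $ i $ j)
          * inverse (det (M y))))"
        by (rule Ck_on_vec[OF V(1)], subst vec_lambda_beta, rule Ck_on_mult[OF V(1)],
            rule Ck_on_det[OF V(1) entry],
            rule Ck_on_inverse[OF V(1) Ck_on_det[OF V(1) M] detM])
      then show "Ck_on k V (\<lambda>y. fst (g' y v))"
        by (rule Ck_on_cong[OF V(1), rotated]) (simp add: fst_g' divide_inverse)
    qed
  qed
  then have smooth: "smooth_on V \<zeta>" by (simp add: smooth_on_def)
  have "g (\<Psi> ?y0) = ?y0" using hom U'(3) by (simp add: homeomorphism_def)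
  then have center: "\<zeta> (G ?y0, d0) = z0" by (simp add: \<zeta>_def \<Psi>_def)
  have sol: "(\<zeta> (x, d), d) \<in> U \<and> G (\<zeta> (x, d), d) = x" if "(x, d) \<in> V" for x d
    using gU[OF that] Gg[OF that] g_eq[OF that] by simp
  have reg: "v = 0" if "(x, d) \<in> V" "frechet_derivative G (at (\<zeta> (x, d), d)) (v, 0) = 0" for x d v
    using inj[OF that(1)] that(2) g_eq[OF that(1)] by (simp add: DG_def)
  have "(G ?y0, d0) \<in> V" using V(2) by (simp add: \<Psi>_def)
  from that[OF V(1) this smooth center sol reg] show thesis .
qed

section \<open>Families of vectors\<close>

lemma span_image_finite:
  assumes "finite I"
  shows "x \<in> span (w ` I) \<longleftrightarrow> (\<exists>c. x = (\<Sum>i\<in>I. c i *\<^sub>R w i))"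
proof
  have "subspace {\<Sum>i\<in>I. c i *\<^sub>R w i | c. True}"
  proof (rule subspaceI)
    show "0 \<in> {\<Sum>i\<in>I. c i *\<^sub>R w i | c. True}" by (auto intro!: exI[of _ "\<lambda>_. 0"])
    show "x + y \<in> {\<Sum>i\<in>I. c i *\<^sub>R w i | c. True}"
      if x: "x \<in> {\<Sum>i\<in>I. c i *\<^sub>R w i | c. True}" and y: "y \<in> {\<Sum>i\<in>I. c i *\<^sub>R w i | c. True}" for x y
    proof -
      obtain c d where "x = (\<Sum>i\<in>I. c i *\<^sub>R w i)" "y = (\<Sum>i\<in>I. d i *\<^sub>R w i)" using x y by auto
      then have "x + y = (\<Sum>i\<in>I. (c i + d i) *\<^sub>R w i)" by (simp add: sum.distrib scaleR_left_distrib)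
      then show ?thesis by (auto intro: exI[of _ "\<lambda>i. c i + d i"])
    qed
    show "r *\<^sub>R x \<in> {\<Sum>i\<in>I. c i *\<^sub>R w i | c. True}" if x: "x \<in> {\<Sum>i\<in>I. c i *\<^sub>R w i | c. True}" for r x
    proof -
      obtain c where "x = (\<Sum>i\<in>I. c i *\<^sub>R w i)" using x by auto
      then have "r *\<^sub>R x = (\<Sum>i\<in>I. (r * c i) *\<^sub>R w i)" by (simp add: scaleR_sum_right)
      then show ?thesis by (auto intro: exI[of _ "\<lambda>i. r * c i"])
    qed
  qed
  moreover have "w ` I \<subseteq> {\<Sum>i\<in>I. c i *\<^sub>R w i | c. True}"
  proof
    fix y assume "y \<in> w ` I"
    then obtain i where i: "i \<in> I" "y = w i" by auto
    have "(\<Sum>k\<in>I. (if k = i then 1 else 0) *\<^sub>R w k) = (\<Sum>k\<in>I. if k = i then w k else 0)"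
      by (rule sum.cong) auto
    then have "y = (\<Sum>k\<in>I. (if k = i then 1 else 0) *\<^sub>R w k)"
      using i assms by simp
    then show "y \<in> {\<Sum>i\<in>I. c i *\<^sub>R w i | c. True}"
      by (intro CollectI exI[of _ "\<lambda>k. if k = i then 1 else 0"]) simp
  qed
  ultimately have "span (w ` I) \<subseteq> {\<Sum>i\<in>I. c i *\<^sub>R w i | c. True}" by (rule span_minimal[rotated])
  then show "x \<in> span (w ` I) \<Longrightarrow> \<exists>c. x = (\<Sum>i\<in>I. c i *\<^sub>R w i)" by auto
  show "\<exists>c. x = (\<Sum>i\<in>I. c i *\<^sub>R w i) \<Longrightarrow> x \<in> span (w ` I)"
    by (auto intro: span_sum span_scale span_base)
qed

lemma dim_Un_image_le:
  fixes w :: "'i \<Rightarrow> 'e::euclidean_space"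
  assumes "finite J"
  shows "dim (W \<union> w ` J) \<le> dim W + card J"
  using assms
proof (induction J)
  case (insert j J)
  have "dim (W \<union> w ` insert j J) = dim (insert (w j) (W \<union> w ` J))" by simp
  also have "\<dots> \<le> dim (W \<union> w ` J) + 1" by (simp add: dim_insert)
  finally show ?case using insert by simp
qed simp

lemma dim_image_le_card:
  fixes w :: "'i \<Rightarrow> 'e::euclidean_space"
  shows "finite J \<Longrightarrow> dim (w ` J) \<le> card J"
  using dim_Un_image_le[of J "{}" w] by simp

text \<open>The equation between a dimension and \<open>dim W + card J\<close> says that the family,
  counted with its indices, is independent modulo \<open>span W\<close>. A maximal such
  \<open>J\<close> generates everything, since a vector outside the span could be added.\<close>

lemma extend_independent_mod:
  fixes w :: "'i \<Rightarrow> 'e::euclidean_space"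
  assumes "finite I" and "J0 \<subseteq> I" and "dim (W \<union> w ` J0) = dim W + card J0"
  obtains J where "J0 \<subseteq> J" and "J \<subseteq> I" and "dim (W \<union> w ` J) = dim W + card J"
    and "w ` I \<subseteq> span (W \<union> w ` J)"
proof -
  define P where "P J \<longleftrightarrow> J0 \<subseteq> J \<and> J \<subseteq> I \<and> dim (W \<union> w ` J) = dim W + card J" for J
  have "P J0" using assms by (simp add: P_def)
  moreover have "finite {J. P J}"
    using assms(1) by (rule finite_subset[rotated, OF finite_Pow_iff[THEN iffD2]]) (auto simp: P_def)
  ultimately obtain J where J: "P J" "\<And>K. P K \<Longrightarrow> J \<subseteq> K \<Longrightarrow> K = J"
    using finite_has_maximal[of "{J. P J}"] by blast
  have "w i \<in> span (W \<union> w ` J)" if i: "i \<in> I" for i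
  proof (rule ccontr)
    assume no: "w i \<notin> span (W \<union> w ` J)"
    then have iJ: "i \<notin> J" by (auto intro: span_base)
    have "dim (W \<union> w ` insert i J) = dim (insert (w i) (W \<union> w ` J))" by simp
    also have "\<dots> = dim W + card J + 1" using no J(1) by (simp add: dim_insert P_def)
    also have "\<dots> = dim W + card (insert i J)"
      using iJ J(1) assms(1) by (simp add: P_def card_insert_if finite_subset[of J I])
    finally have "P (insert i J)" using i J(1) by (auto simp: P_def)
    then show False using J(2) iJ by blast
  qed
  then have "w ` I \<subseteq> span (W \<union> w ` J)" by auto
  then show thesis using that[of J] J(1) by (simp add: P_def)
qed

lemma basis_subfamily:
  fixes w :: "'i \<Rightarrow> 'e::euclidean_space"
  assumes "finite I"
  obtains J where "J \<subseteq> I" and "dim (w ` J) = card J" and "w ` I \<subseteq> span (w ` J)"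
  using extend_independent_mod[OF assms, of "{}" "{}" w] by auto

lemma full_dim_imp_independent:
  fixes w :: "'i \<Rightarrow> 'e::euclidean_space"
  assumes "finite I" and "dim (w ` I) = card I"
  shows "inj_on w I" and "independent (w ` I)"
proof -
  have "dim (w ` I) \<le> card (w ` I)" using assms(1) by (intro dim_le_card') simp
  then have c: "card (w ` I) = card I" using assms card_image_le[OF assms(1), of w] by simp
  show "inj_on w I" using c assms(1) by (simp add: eq_card_imp_inj_on)
  show "independent (w ` I)"
    by (rule card_le_dim_spanning[of _ "w ` I"]) (use assms c in \<open>auto intro: span_base\<close>)
qed

lemma full_dim_imp_not_in_span:
  fixes w :: "'i \<Rightarrow> 'e::euclidean_space"
  assumes "finite I" and "dim (w ` I) = card I" and "i \<in> I"
  shows "w i \<notin> span (w ` (I - {i}))"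
proof
  assume "w i \<in> span (w ` (I - {i}))"
  moreover have "w ` I = insert (w i) (w ` (I - {i}))" using assms(3) by auto
  ultimately have "dim (w ` I) = dim (w ` (I - {i}))" by (simp add: dim_insert)
  also have "\<dots> \<le> card (I - {i})" using assms(1) by (intro dim_image_le_card) simp
  also have "\<dots> < card I" using assms(1,3) by (intro card_Diff1_less) auto
  finally show False using assms(2) by simp
qed

lemma dual_vector:
  fixes w :: "'i \<Rightarrow> 'e::euclidean_space"
  assumes "finite I" and "dim (w ` I) = card I"
  obtains \<delta> where "\<And>i. i \<in> I \<Longrightarrow> w i \<bullet> \<delta> = c i"
proof -
  note ind = full_dim_imp_independent[OF assms]
  obtain g :: "'e \<Rightarrow> real" where g: "linear g" "\<And>x. x \<in> w ` I \<Longrightarrow> g x = c (the_inv_into I w x)"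
    using linear_independent_extend[OF ind(2), of "\<lambda>x. c (the_inv_into I w x)"] by blast
  have "w i \<bullet> (\<Sum>b\<in>Basis. g b *\<^sub>R b) = c i" if "i \<in> I" for i
  proof -
    have "w i \<bullet> (\<Sum>b\<in>Basis. g b *\<^sub>R b) = g (w i)"
      by (subst linear_eq_sum_Basis[OF g(1)]) (simp add: inner_sum_right mult.commute)
    then show ?thesis using g(2)[of "w i"] that by (simp add: the_inv_into_f_f[OF ind(1)])
  qed
  then show thesis by (rule that)
qed

text \<open>Dual vectors recover each coefficient from a sum over \<open>w\<close>. For a nearby
  family the recovery is off by a small fraction of the sum of all coefficients, which is absorbed
  on the left. The bound is uniform in \<open>w'\<close>; this later takes the place of smooth
  coefficient functions.\<close>

lemma coefficient_bound_perturbed: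
  fixes w :: "'i \<Rightarrow> 'e::euclidean_space"
  assumes "finite I" and "dim (w ` I) = card I"
  shows "\<exists>\<epsilon>>0. \<exists>K\<ge>0. \<forall>w'. (\<forall>i\<in>I. norm (w' i - w i) < \<epsilon>) \<longrightarrow>
      (\<forall>c. \<forall>i\<in>I. \<bar>c i\<bar> \<le> K * norm (\<Sum>i\<in>I. c i *\<^sub>R w' i))"
proof -
  have "\<forall>j. \<exists>\<delta>. \<forall>i\<in>I. w i \<bullet> \<delta> = (if i = j then 1 else 0)"
  proof
    fix j
    obtain \<delta> where "\<And>i. i \<in> I \<Longrightarrow> w i \<bullet> \<delta> = (if i = j then 1 else 0)"
      using dual_vector[OF assms, of "\<lambda>i. if i = j then 1 else 0"] by blast
    then show "\<exists>\<delta>. \<forall>i\<in>I. w i \<bullet> \<delta> = (if i = j then 1 else 0)" by blast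
  qed
  then obtain d where d: "\<And>i j. i \<in> I \<Longrightarrow> w i \<bullet> d j = (if i = j then 1 else 0)" by metis
  \<comment> \<open>The \<open>+ 1\<close> keeps \<open>D\<close> positive also for empty
    \<open>I\<close>. Perturbations below \<open>1 / (2 * D)\<close> contribute at most half of the
    sum of the coefficients, hence the final factor \<open>2 * D\<close>.\<close>
  define D where "D = (\<Sum>j\<in>I. norm (d j)) + 1"
  have D: "D > 0" unfolding D_def by (simp add: add_nonneg_pos sum_nonneg)
  have "\<bar>c k\<bar> \<le> (2 * D) * norm (\<Sum>i\<in>I. c i *\<^sub>R w' i)"
    if near: "\<And>i. i \<in> I \<Longrightarrow> norm (w' i - w i) < 1 / (2 * D)" and k: "k \<in> I" for w' c k
  proof -
    define s where "s = (\<Sum>i\<in>I. c i *\<^sub>R w' i)"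
    define C where "C = (\<Sum>i\<in>I. \<bar>c i\<bar>)"
    have C0: "C \<ge> 0" by (simp add: C_def sum_nonneg)
    have cj: "\<bar>c j\<bar> \<le> norm (d j) * (norm s + C / (2 * D))" if "j \<in> I" for j
    proof -
      have "s = (\<Sum>i\<in>I. c i *\<^sub>R w i) + (\<Sum>i\<in>I. c i *\<^sub>R (w' i - w i))"
        by (simp add: s_def sum.distrib[symmetric] scaleR_right_diff_distrib)
      then have "s \<bullet> d j = (\<Sum>i\<in>I. c i * (w i \<bullet> d j)) + (\<Sum>i\<in>I. c i *\<^sub>R (w' i - w i)) \<bullet> d j"
        by (simp add: inner_add_left inner_sum_left)
      also have "(\<Sum>i\<in>I. c i * (w i \<bullet> d j)) = (\<Sum>i\<in>I. if i = j then c i else 0)"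
        by (rule sum.cong) (auto simp: d)
      also have "\<dots> = c j" using assms(1) that by simp
      finally have "c j = (s - (\<Sum>i\<in>I. c i *\<^sub>R (w' i - w i))) \<bullet> d j"
        by (simp add: inner_diff_left)
      then have "\<bar>c j\<bar> \<le> norm (d j) * norm (s - (\<Sum>i\<in>I. c i *\<^sub>R (w' i - w i)))"
        using Cauchy_Schwarz_ineq2[of "s - (\<Sum>i\<in>I. c i *\<^sub>R (w' i - w i))" "d j"]
        by (simp add: mult.commute)
      also have "\<dots> \<le> norm (d j) * (norm s + C / (2 * D))"
      proof (rule mult_left_mono)
        have "norm (\<Sum>i\<in>I. c i *\<^sub>R (w' i - w i)) \<le> (\<Sum>i\<in>I. \<bar>c i\<bar> * (1 / (2 * D)))"
          by (rule sum_norm_le, subst norm_scaleR, rule mult_left_mono)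
            (use near in \<open>auto intro: less_imp_le\<close>)
        also have "\<dots> = C / (2 * D)" by (simp add: C_def sum_divide_distrib)
        finally show "norm (s - (\<Sum>i\<in>I. c i *\<^sub>R (w' i - w i))) \<le> norm s + C / (2 * D)"
          using norm_triangle_ineq4[of s "\<Sum>i\<in>I. c i *\<^sub>R (w' i - w i)"] by linarith
      qed simp
      finally show ?thesis .
    qed
    have "C \<le> (\<Sum>j\<in>I. norm (d j) * (norm s + C / (2 * D)))"
      unfolding C_def by (rule sum_mono) (use cj C_def in auto)
    also have "\<dots> \<le> D * (norm s + C / (2 * D))"
      unfolding sum_distrib_right[symmetric] using C0 D by (intro mult_right_mono) (auto simp: D_def)
    also have "\<dots> = D * norm s + C / 2" using D by (simp add: field_simps)
    finally have "C \<le> 2 * D * norm s" by simp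
    moreover have "\<bar>c k\<bar> \<le> C" unfolding C_def using assms(1) k by (intro member_le_sum) auto
    ultimately show ?thesis by (simp add: s_def)
  qed
  then show ?thesis
    using D by (intro exI[of _ "1 / (2 * D)"] exI[of _ "2 * D"] conjI) (simp_all add: Ball_def)
qed

text \<open>If a nearby family were dependent, a relation with one coefficient equal to 1 would
  contradict the bound of the coefficients by the norm of the sum, which is 0.\<close>

lemma eventually_full_dim:
  fixes w :: "'p::topological_space \<Rightarrow> 'i \<Rightarrow> 'e::euclidean_space"
  assumes "finite I" and "dim (w p ` I) = card I"
    and "\<And>i. i \<in> I \<Longrightarrow> ((\<lambda>q. w q i) \<longlongrightarrow> w p i) (nhds p)"
  shows "\<forall>\<^sub>F q in nhds p. dim (w q ` I) = card I"
proof -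
  obtain \<epsilon> K where \<epsilon>: "\<epsilon> > 0" and K: "\<forall>w'. (\<forall>i\<in>I. norm (w' i - w p i) < \<epsilon>) \<longrightarrow>
      (\<forall>c. \<forall>i\<in>I. \<bar>c i\<bar> \<le> K * norm (\<Sum>i\<in>I. c i *\<^sub>R w' i))"
    using coefficient_bound_perturbed[OF assms(1,2)] by blast
  have "\<forall>\<^sub>F q in nhds p. \<forall>i\<in>I. norm (w q i - w p i) < \<epsilon>"
    using assms(1,3) \<epsilon> by (intro eventually_ball_finite ballI) (auto simp: tendsto_iff dist_norm)
  then show ?thesis
  proof (rule eventually_mono)
    fix q assume "\<forall>i\<in>I. norm (w q i - w p i) < \<epsilon>"
    then have bd: "\<bar>c i\<bar> \<le> K * norm (\<Sum>i\<in>I. c i *\<^sub>R w q i)" if "i \<in> I" for c i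
      using K that by blast
    obtain J where J: "J \<subseteq> I" "dim (w q ` J) = card J" "w q ` I \<subseteq> span (w q ` J)"
      using basis_subfamily[OF assms(1)] by metis
    have "J = I"
    proof (rule ccontr)
      assume "J \<noteq> I"
      then obtain i where i: "i \<in> I" "i \<notin> J" using J(1) by blast
      have fJ: "finite J" using J(1) assms(1) finite_subset by blast
      obtain c where c: "w q i = (\<Sum>k\<in>J. c k *\<^sub>R w q k)"
        using J(3) i(1) span_image_finite[OF fJ] by blast
      define c' where "c' k = (if k = i then 1 else if k \<in> J then - c k else 0)" for k
      have "(\<Sum>k\<in>I. c' k *\<^sub>R w q k) = (\<Sum>k\<in>insert i J. c' k *\<^sub>R w q k)"
        using assms(1) J(1) i(1) by (intro sum.mono_neutral_right) (auto simp: c'_def)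
      also have "\<dots> = w q i + (\<Sum>k\<in>J. c' k *\<^sub>R w q k)"
        using fJ i by (simp add: c'_def)
      also have "(\<Sum>k\<in>J. c' k *\<^sub>R w q k) = (\<Sum>k\<in>J. - (c k *\<^sub>R w q k))"
        using i by (intro sum.cong) (auto simp: c'_def)
      finally have "(\<Sum>k\<in>I. c' k *\<^sub>R w q k) = 0" using c by (simp add: sum_negf)
      then show False using bd[of i c'] i by (simp add: c'_def)
    qed
    then show "dim (w q ` I) = card I" using J by simp
  qed
qed

lemma eventually_dim_ge:
  fixes w :: "'p::topological_space \<Rightarrow> 'i \<Rightarrow> 'e::euclidean_space"
  assumes "finite I" and "\<And>i. i \<in> I \<Longrightarrow> ((\<lambda>q. w q i) \<longlongrightarrow> w p i) (nhds p)"
  shows "\<forall>\<^sub>F q in nhds p. dim (w p ` I) \<le> dim (w q ` I)"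
proof -
  obtain J where J: "J \<subseteq> I" "dim (w p ` J) = card J" "w p ` I \<subseteq> span (w p ` J)"
    using basis_subfamily[OF assms(1)] by metis
  have "finite J" using J(1) assms(1) finite_subset by blast
  then have "\<forall>\<^sub>F q in nhds p. dim (w q ` J) = card J"
    using J assms(2) by (intro eventually_full_dim) auto
  then show ?thesis
  proof (rule eventually_mono)
    fix q assume q: "dim (w q ` J) = card J"
    have "dim (w p ` I) \<le> dim (w p ` J)" using J(3) by (metis dim_mono dim_span)
    also have "\<dots> \<le> dim (w q ` I)" using J(1,2) q by (metis dim_subset image_mono)
    finally show "dim (w p ` I) \<le> dim (w q ` I)" .
  qed
qed

text \<open>A set \<open>J\<close> that is a basis of the \<open>v\<close> modulo \<open>W\<close>
  still generates the \<open>v'\<close> modulo \<open>W'\<close>, so the number of new dimensions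
  cannot grow. The increments are compared without subtraction of natural numbers.\<close>

lemma rank_increment_mono:
  fixes v v' :: "'m::finite \<Rightarrow> 'e::euclidean_space"
  assumes "\<And>J j. v j \<in> span (W \<union> v ` J) \<Longrightarrow> v' j \<in> span (W' \<union> v' ` J)"
  shows "dim (W' \<union> range v') + dim W \<le> dim (W \<union> range v) + dim W'"
proof -
  obtain J where J: "dim (W \<union> v ` J) = dim W + card J" "range v \<subseteq> span (W \<union> v ` J)"
    using extend_independent_mod[of UNIV "{}" W v] by auto
  have "range v' \<subseteq> span (W' \<union> v' ` J)" using J(2) assms by blast
  then have "dim (W' \<union> range v') \<le> dim (W' \<union> v' ` J)"
    by (metis dim_mono dim_span le_sup_iff span_superset)
  also have "\<dots> \<le> dim W' + card J" by (rule dim_Un_image_le) simp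
  finally have "dim (W' \<union> range v') \<le> dim W' + card J" .
  moreover have "dim W + card J \<le> dim (W \<union> range v)"
    unfolding J(1)[symmetric] by (rule dim_subset) auto
  ultimately show ?thesis by simp
qed

section \<open>Differentials of Lie derivatives\<close>

text \<open>The differential as a vector via the inner product, which makes \<open>span\<close>,
  \<open>dim\<close> and orthogonality available for codistributions.\<close>

definition gradient :: "('e::euclidean_space \<Rightarrow> real) \<Rightarrow> 'e \<Rightarrow> 'e" where
  "gradient h q = (\<Sum>b\<in>Basis. frechet_derivative h (at q) b *\<^sub>R b)"

lemma gradient_inner:
  assumes "linear (frechet_derivative h (at q))"
  shows "gradient h q \<bullet> v = frechet_derivative h (at q) v"
  by (subst linear_eq_sum_Basis[OF assms])
    (simp add: gradient_def inner_sum_left mult.commute inner_commute[of v])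

lemma gradient_eqI:
  assumes "(h has_derivative (\<lambda>v. g \<bullet> v)) (at q)"
  shows "gradient h q = g"
  using frechet_derivative_at[OF assms, symmetric]
  by (simp add: gradient_def euclidean_representation)

lemma has_derivative_gradient:
  assumes "smooth_on S h" and "q \<in> S"
  shows "(h has_derivative (\<lambda>v. gradient h q \<bullet> v)) (at q)"
  using smooth_on_has_derivative[OF assms]
  by (simp add: gradient_inner[OF has_derivative_linear[OF smooth_on_has_derivative[OF assms]]])

lemma gradient_tendsto:
  fixes h :: "'e::euclidean_space \<Rightarrow> real"
  assumes "open S" and "p \<in> S" and "smooth_on S h"
  shows "(gradient h \<longlongrightarrow> gradient h p) (nhds p)"
proof -
  have "continuous_on S (gradient h)" unfolding gradient_def[abs_def]
    by (intro continuous_intros smooth_on_imp_continuous_on smooth_on_frechet_derivative assms(3))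
  then show ?thesis
    using assms(1,2) by (simp add: continuous_on_eq_continuous_at isCont_def tendsto_at_iff_tendsto_nhds)
qed

text \<open>The differential commutes with the Lie derivative. The product rule leaves derivatives
  in direction \<open>v\<close> of the partial derivatives of \<open>h\<close>; symmetry exchanges
  \<open>v\<close> with the field \<open>X p\<close>.\<close>

lemma frechet_derivative_lie_derivative:
  fixes X :: "'e::euclidean_space \<Rightarrow> 'e" and h :: "'e \<Rightarrow> real"
  assumes "open S" and "p \<in> S" and X: "smooth_on S X" and h: "smooth_on S h"
  shows "frechet_derivative (lie_derivative X h) (at p) v =
    frechet_derivative (\<lambda>q. frechet_derivative h (at q) v) (at p) (X p)
    + frechet_derivative h (at p) (frechet_derivative X (at p) v)"
proof -
  define D2 where "D2 b = frechet_derivative (\<lambda>q. frechet_derivative h (at q) b) (at p)" for b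
  define DX where "DX = frechet_derivative X (at p)"
  define Dh where "Dh q = frechet_derivative h (at q)" for q
  have D2: "((\<lambda>q. Dh q b) has_derivative D2 b) (at p)" for b
    unfolding D2_def Dh_def by (rule smooth_on_has_derivative[OF smooth_on_frechet_derivative[OF h] assms(2)])
  have DX: "(X has_derivative DX) (at p)"
    unfolding DX_def by (rule smooth_on_has_derivative[OF X assms(2)])
  have lin: "linear (Dh q)" if "q \<in> S" for q
    unfolding Dh_def using smooth_on_has_derivative[OF h that] has_derivative_linear by blast
  have "((\<lambda>q. \<Sum>b\<in>Basis. (X q \<bullet> b) * Dh q b) has_derivative
      (\<lambda>v. \<Sum>b\<in>Basis. (X p \<bullet> b) * D2 b v + (DX v \<bullet> b) * Dh p b)) (at p)"
    by (intro has_derivative_sum has_derivative_mult D2 has_derivative_inner_left DX)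
  then have "(lie_derivative X h has_derivative
      (\<lambda>v. \<Sum>b\<in>Basis. (X p \<bullet> b) * D2 b v + (DX v \<bullet> b) * Dh p b)) (at p)"
    by (rule has_derivative_transform_within_open[OF _ assms(1,2)])
      (simp add: lie_derivative_def linear_eq_sum_Basis[OF lin, symmetric] Dh_def[symmetric]
        linear_eq_sum_Basis[OF lin, of _ "X _", unfolded real_scaleR_def])
  from frechet_derivative_at[OF this, symmetric]
  have "frechet_derivative (lie_derivative X h) (at p) v =
      (\<Sum>b\<in>Basis. (X p \<bullet> b) * D2 b v) + (\<Sum>b\<in>Basis. (DX v \<bullet> b) * Dh p b)"
    by (simp add: sum.distrib)
  also have "(\<Sum>b\<in>Basis. (DX v \<bullet> b) * Dh p b) = Dh p (DX v)"
    using linear_eq_sum_Basis[OF lin[OF assms(2)], of "DX v"] by simp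
  also have "(\<Sum>b\<in>Basis. (X p \<bullet> b) * D2 b v) = (\<Sum>b\<in>Basis. (X p \<bullet> b) * D2 v b)"
    unfolding D2_def using symmetric_second_derivative[OF assms(1,2) h, of _ v] by simp
  also have "\<dots> = D2 v (X p)"
    using linear_eq_sum_Basis[OF has_derivative_linear[OF D2[of v]], of "X p"] by simp
  finally show ?thesis by (simp add: D2_def DX_def Dh_def)
qed

text \<open>Classically one writes the \<open>j\<close>-th differential near \<open>p\<close> as a
  combination of the others with smooth coefficients and differentiates. Bounded coefficients
  suffice: evaluated along the line through \<open>p\<close> in direction \<open>X p\<close> on a
  vector \<open>v\<close> orthogonal to the claimed span, the differentials over \<open>I\<close>
  vanish to second order at \<open>p\<close>, and the bound passes this on to the
  \<open>j\<close>-th one. Constant rank makes the relation persist near \<open>p\<close>.\<close>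

lemma gradient_lie_derivative_in_span:
  fixes X :: "'e::euclidean_space \<Rightarrow> 'e" and h :: "'i \<Rightarrow> 'e \<Rightarrow> real"
  assumes "open S" and "p \<in> S" and X: "smooth_on S X"
    and h: "\<And>i. i \<in> insert j H \<Longrightarrow> smooth_on S (h i)" and "finite H"
    and const_rank: "\<And>K. K \<subseteq> insert j H \<Longrightarrow>
      \<forall>\<^sub>F q in nhds p. dim ((\<lambda>i. gradient (h i) q) ` K) = dim ((\<lambda>i. gradient (h i) p) ` K)"
    and j: "gradient (h j) p \<in> span ((\<lambda>i. gradient (h i) p) ` H)"
  shows "gradient (lie_derivative X (h j)) p
    \<in> span ((\<lambda>i. gradient (h i) p) ` H \<union> (\<lambda>i. gradient (lie_derivative X (h i)) p) ` H)"
proof -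
  define g where "g q i = gradient (h i) q" for q i
  define gL where "gL i = gradient (lie_derivative X (h i)) p" for i
  obtain I where I: "I \<subseteq> H" "dim (g p ` I) = card I" "g p ` H \<subseteq> span (g p ` I)"
    using basis_subfamily[OF \<open>finite H\<close>] by metis
  have fI: "finite I" using I(1) \<open>finite H\<close> finite_subset by blast
  obtain \<epsilon> K where \<epsilon>: "\<epsilon> > 0" and "K \<ge> 0" and
    K: "\<forall>w'. (\<forall>i\<in>I. norm (w' i - g p i) < \<epsilon>) \<longrightarrow>
      (\<forall>c. \<forall>i\<in>I. \<bar>c i\<bar> \<le> K * norm (\<Sum>i\<in>I. c i *\<^sub>R w' i))"
    using coefficient_bound_perturbed[OF fI I(2)] by blast
  have g_tendsto: "((\<lambda>q. g q i) \<longlongrightarrow> g p i) (nhds p)" if "i \<in> insert j H" for i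
    unfolding g_def using gradient_tendsto[OF assms(1,2) h[OF that]] by simp
  \<comment> \<open>\<open>v\<close> is the part of \<open>gL j\<close> orthogonal to the target
    space. The rest of the proof shows \<open>gL j \<bullet> v = 0\<close>, which forces
    \<open>v = 0\<close>.\<close>
  obtain y v where y: "y \<in> span (g p ` I \<union> gL ` I)"
    and v: "\<And>w. w \<in> span (g p ` I \<union> gL ` I) \<Longrightarrow> orthogonal v w" and yv: "gL j = y + v"
    using orthogonal_subspace_decomp_exists by blast
  have gv: "g p i \<bullet> v = 0" "gL i \<bullet> v = 0" if "i \<in> I" for i
    using v[OF span_base, of "g p i"] v[OF span_base, of "gL i"] that
    by (auto simp: orthogonal_def inner_commute)
  define \<gamma> where "\<gamma> t = p + t *\<^sub>R X p" for t :: real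
  define w where "w = frechet_derivative X (at p) v"
  \<comment> \<open>The derivative of \<open>\<Lambda> i\<close> at \<open>0\<close> is the differential of the Lie derivative of \<open>h i\<close>, applied
    to \<open>v\<close>; the correction \<open>t w\<close> accounts for the variation of \<open>X\<close>.\<close>
  define \<Lambda> where "\<Lambda> i t = g (\<gamma> t) i \<bullet> (v + t *\<^sub>R w)" for i t
  have \<gamma>_cont: "(\<gamma> \<longlongrightarrow> p) (nhds 0)"
  proof -
    have "isCont \<gamma> 0" unfolding \<gamma>_def by (intro continuous_intros)
    then have "(\<gamma> \<longlongrightarrow> \<gamma> 0) (nhds 0)" by (simp add: isCont_def tendsto_at_iff_tendsto_nhds)
    then show ?thesis by (simp add: \<gamma>_def)
  qed
  have \<gamma>0: "\<gamma> 0 = p" by (simp add: \<gamma>_def)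
  have \<Lambda>_deriv: "(\<Lambda> i has_real_derivative gL i \<bullet> v) (at 0)" if i: "i \<in> insert j H" for i
  proof -
    define Dh where "Dh q = frechet_derivative (h i) (at q)" for q
    have lin: "linear (Dh q)" if "q \<in> S" for q
      unfolding Dh_def using smooth_on_has_derivative[OF h[OF i] that] has_derivative_linear by blast
    have D2: "((\<lambda>q. Dh q b) has_derivative frechet_derivative (\<lambda>q. Dh q b) (at p)) (at (\<gamma> 0))" for b
      unfolding \<gamma>0 unfolding Dh_def
      by (rule smooth_on_has_derivative[OF smooth_on_frechet_derivative[OF h[OF i]] assms(2)])
    have d\<gamma>: "(\<gamma> has_derivative (\<lambda>s. s *\<^sub>R X p)) (at 0)"
      unfolding \<gamma>_def by (auto intro!: derivative_eq_intros)
    have d: "((\<lambda>t. Dh (\<gamma> t) b) has_real_derivative frechet_derivative (\<lambda>q. Dh q b) (at p) (X p)) (at 0)" for b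
    proof -
      have "((\<lambda>t. Dh (\<gamma> t) b) has_derivative (\<lambda>s. frechet_derivative (\<lambda>q. Dh q b) (at p) (s *\<^sub>R X p))) (at 0)"
        using diff_chain_at[OF d\<gamma> D2] by (simp add: o_def)
      then show ?thesis
        unfolding has_field_derivative_def
        by (rule has_derivative_eq_rhs)
          (simp add: fun_eq_iff linear_scale[OF has_derivative_linear[OF D2]] mult.commute)
    qed
    have "((\<lambda>t. Dh (\<gamma> t) v + t * Dh (\<gamma> t) w) has_real_derivative
        frechet_derivative (\<lambda>q. Dh q v) (at p) (X p) + Dh p w) (at 0)"
      by (rule derivative_eq_intros d refl)+ (simp add: \<gamma>0)
    moreover have "frechet_derivative (\<lambda>q. Dh q v) (at p) (X p) + Dh p w = gL i \<bullet> v"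
    proof -
      have "smooth_on S (lie_derivative X (h i))"
        by (intro smooth_on_lie_derivative assms(1) X h i)
      then have "gL i \<bullet> v = frechet_derivative (lie_derivative X (h i)) (at p) v"
        unfolding gL_def
        by (intro gradient_inner has_derivative_linear[OF smooth_on_has_derivative[OF _ assms(2)]])
      then show ?thesis
        unfolding frechet_derivative_lie_derivative[OF assms(1,2) X h[OF i]] by (simp add: Dh_def w_def)
    qed
    moreover have "\<forall>\<^sub>F t in nhds 0. Dh (\<gamma> t) v + t * Dh (\<gamma> t) w = \<Lambda> i t"
    proof -
      have "\<forall>\<^sub>F t in nhds 0. \<gamma> t \<in> S"
        using \<gamma>_cont assms(1,2) topological_tendstoD by blast
      then show ?thesis
      proof (rule eventually_mono)
        fix t assume t: "\<gamma> t \<in> S"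
        have "\<Lambda> i t = Dh (\<gamma> t) (v + t *\<^sub>R w)"
          using gradient_inner[of "h i" "\<gamma> t"] lin[OF t] by (simp add: \<Lambda>_def g_def Dh_def)
        then show "Dh (\<gamma> t) v + t * Dh (\<gamma> t) w = \<Lambda> i t"
          using lin[OF t] by (simp add: linear_add linear_scale)
      qed
    qed
    ultimately show ?thesis
      using DERIV_cong_ev[of 0 0 "\<lambda>t. Dh (\<gamma> t) v + t * Dh (\<gamma> t) w" "\<Lambda> i"] by simp
  qed
  have \<Lambda>0: "\<Lambda> i 0 = g p i \<bullet> v" for i by (simp add: \<Lambda>_def \<gamma>0)
  have jI: "g p j \<in> span (g p ` I)"
    using j I(3) span_mono[OF I(3)] unfolding g_def by (auto simp: span_span)
  define K' where "K' = K * (norm (g p j) + 1)"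
  \<comment> \<open>Near \<open>p\<close> the ranks over \<open>I\<close> and over
    \<open>insert j I\<close> stay equal, so the \<open>j\<close>-th gradient stays in the span of
    those over \<open>I\<close>; the other two conditions bound its coefficients by
    \<open>K'\<close>.\<close>
  have ev: "\<forall>\<^sub>F q in nhds p. (\<forall>i\<in>I. norm (g q i - g p i) < \<epsilon>) \<and> norm (g q j) < norm (g p j) + 1
      \<and> g q j \<in> span (g q ` I)"
  proof (intro eventually_conj eventually_ball_finite fI ballI)
    show "\<forall>\<^sub>F q in nhds p. norm (g q i - g p i) < \<epsilon>" if "i \<in> I" for i
      using g_tendsto[of i] that I(1) \<epsilon> by (auto simp: tendsto_iff dist_norm)
    have "((\<lambda>q. norm (g q j)) \<longlongrightarrow> norm (g p j)) (nhds p)"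
      by (intro tendsto_norm g_tendsto) simp
    then show "\<forall>\<^sub>F q in nhds p. norm (g q j) < norm (g p j) + 1"
      by (rule order_tendstoD) simp
    have "\<forall>\<^sub>F q in nhds p. dim (g q ` I) = dim (g p ` I)"
      using const_rank[of I] I(1) by (auto simp: g_def[abs_def])
    moreover have "\<forall>\<^sub>F q in nhds p. dim (g q ` insert j I) = dim (g p ` insert j I)"
      using const_rank[of "insert j I"] I(1) by (auto simp: g_def[abs_def])
    ultimately show "\<forall>\<^sub>F q in nhds p. g q j \<in> span (g q ` I)"
    proof eventually_elim
      case (elim q)
      have "dim (g p ` insert j I) = dim (g p ` I)" using jI by (simp add: dim_insert)
      then have "dim (insert (g q j) (g q ` I)) = dim (g q ` I)" using elim by simp
      then show ?case by (metis dim_insert add_eq_self_zero one_neq_zero)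
    qed
  qed
  have bound: "\<forall>\<^sub>F t in nhds 0. \<bar>\<Lambda> j t\<bar> \<le> (\<Sum>i\<in>I. K' * \<bar>\<Lambda> i t\<bar>)"
    using filterlim_iff[THEN iffD1, OF \<gamma>_cont, rule_format, OF ev]
  proof (rule eventually_mono, elim conjE)
    fix t assume near: "\<forall>i\<in>I. norm (g (\<gamma> t) i - g p i) < \<epsilon>"
      and n: "norm (g (\<gamma> t) j) < norm (g p j) + 1" and sp: "g (\<gamma> t) j \<in> span (g (\<gamma> t) ` I)"
    obtain c where c: "g (\<gamma> t) j = (\<Sum>i\<in>I. c i *\<^sub>R g (\<gamma> t) i)"
      using sp span_image_finite[OF fI] by blast
    have c_le: "\<bar>c i\<bar> \<le> K'" if "i \<in> I" for i
    proof -
      have "\<bar>c i\<bar> \<le> K * norm (g (\<gamma> t) j)" unfolding c using K near that by blast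
      also have "\<dots> \<le> K'" unfolding K'_def using n \<open>K \<ge> 0\<close> by (intro mult_left_mono) auto
      finally show ?thesis .
    qed
    have "\<Lambda> j t = (\<Sum>i\<in>I. c i * \<Lambda> i t)"
      unfolding \<Lambda>_def c by (simp add: inner_sum_left)
    then have "\<bar>\<Lambda> j t\<bar> \<le> (\<Sum>i\<in>I. \<bar>c i * \<Lambda> i t\<bar>)" by simp
    also have "\<dots> \<le> (\<Sum>i\<in>I. K' * \<bar>\<Lambda> i t\<bar>)"
      by (rule sum_mono) (simp add: abs_mult c_le mult_right_mono)
    finally show "\<bar>\<Lambda> j t\<bar> \<le> (\<Sum>i\<in>I. K' * \<bar>\<Lambda> i t\<bar>)" .
  qed
  have \<Lambda>j0: "\<Lambda> j 0 = 0"
    using eventually_nhds_x_imp_x[OF bound] gv by (simp add: \<Lambda>0)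
  have quot: "((\<lambda>t. \<Lambda> i t / t) \<longlongrightarrow> gL i \<bullet> v) (at 0)" if "i \<in> insert j H" "\<Lambda> i 0 = 0" for i
    using \<Lambda>_deriv[OF that(1)] that(2) by (simp add: has_field_derivative_iff)
  have "((\<lambda>t. \<Sum>i\<in>I. K' * \<bar>\<Lambda> i t / t\<bar>) \<longlongrightarrow> (\<Sum>i\<in>I. K' * \<bar>gL i \<bullet> v\<bar>)) (at 0)"
    by (intro tendsto_intros quot) (use I(1) \<Lambda>0 gv in auto)
  then have "((\<lambda>t. \<Sum>i\<in>I. K' * \<bar>\<Lambda> i t / t\<bar>) \<longlongrightarrow> 0) (at 0)" using gv by simp
  moreover have "\<forall>\<^sub>F t in at 0. norm (\<Lambda> j t / t) \<le> (\<Sum>i\<in>I. K' * \<bar>\<Lambda> i t / t\<bar>)"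
    unfolding eventually_at_filter
    by (rule eventually_mono[OF bound])
      (simp add: abs_divide sum_divide_distrib[symmetric] divide_right_mono)
  ultimately have "((\<lambda>t. \<Lambda> j t / t) \<longlongrightarrow> 0) (at 0)" by (rule Lim_null_comparison[rotated])
  then have "gL j \<bullet> v = 0" using quot[of j] \<Lambda>j0 tendsto_unique[OF at_neq_bot] by blast
  moreover have "y \<bullet> v = 0" using v[OF y] by (simp add: orthogonal_def inner_commute)
  ultimately have "v = 0" using yv by (simp add: inner_add_left)
  then have "gL j \<in> span (g p ` I \<union> gL ` I)" using y yv by simp
  moreover have "g p ` I \<union> gL ` I \<subseteq> g p ` H \<union> gL ` H" using I(1) by auto
  ultimately show ?thesis using span_mono unfolding g_def gL_def by blast
qed

section \<open>Choice of the multi-index\<close>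

text \<open>A subset of \<open>J\<close> that is a basis modulo the smaller \<open>W\<close> still
  generates modulo \<open>W'\<close>, where all of \<open>J\<close> is independent; so it cannot be
  proper.\<close>

lemma independent_mod_mono:
  fixes w :: "'i \<Rightarrow> 'e::euclidean_space"
  assumes "finite J" and "W \<subseteq> span W'" and "dim (W' \<union> w ` J) = dim W' + card J"
  shows "dim (W \<union> w ` J) = dim W + card J"
proof -
  obtain K where K: "K \<subseteq> J" "dim (W \<union> w ` K) = dim W + card K" "w ` J \<subseteq> span (W \<union> w ` K)"
    using extend_independent_mod[OF assms(1), of "{}" W w] by auto
  have fK: "finite K" using K(1) assms(1) finite_subset by blast
  have "W \<union> w ` K \<subseteq> span (W' \<union> w ` K)"
    using assms(2) span_mono[of W' "W' \<union> w ` K"] by (auto intro: span_base)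
  then have "span (W \<union> w ` K) \<subseteq> span (W' \<union> w ` K)" by (rule span_minimal) simp
  then have "W' \<union> w ` J \<subseteq> span (W' \<union> w ` K)" using K(3) by (auto intro: span_base)
  then have "dim W' + card J \<le> dim (W' \<union> w ` K)" unfolding assms(3)[symmetric]
    by (metis dim_mono dim_span)
  also have "\<dots> \<le> dim W' + card K" using fK by (rule dim_Un_image_le)
  finally have "K = J" using K(1) assms(1) by (intro card_seteq) auto
  then show ?thesis using K(2) by simp
qed

lemma dim_Un_absorb:
  fixes A :: "'e::euclidean_space set"
  assumes "A \<subseteq> span B"
  shows "dim (A \<union> B) = dim B"
proof -
  have "A \<union> B \<subseteq> span B" using assms span_superset by blast
  then show ?thesis by (intro antisym dim_mono dim_subset) auto
qed

lemma antimono_upto: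
  fixes s :: "nat \<Rightarrow> int"
  assumes "\<And>k. k < N \<Longrightarrow> s (Suc k) \<le> s k" and "i \<le> k" and "k \<le> N"
  shows "s k \<le> s i"
  using assms(2,3)
proof (induction k rule: dec_induct)
  case (step k)
  then show ?case using assms(1)[of k] by simp
qed simp

section \<open>Families of differentials graded by their order\<close>

definition lower :: "(nat \<Rightarrow> 'm \<Rightarrow> 'e) \<Rightarrow> nat \<Rightarrow> 'e set" where
  "lower Y \<beta> = (\<Union>\<gamma><\<beta>. range (Y \<gamma>))"

lemma lower_0 [simp]: "lower Y 0 = {}"
  by (simp add: lower_def)

lemma lower_Suc: "lower Y (Suc \<beta>) = lower Y \<beta> \<union> range (Y \<beta>)"
  unfolding lower_def lessThan_Suc by auto

lemma in_lower_iff: "x \<in> lower Y \<beta> \<longleftrightarrow> (\<exists>\<gamma> j. \<gamma> < \<beta> \<and> x = Y \<gamma> j)"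
  by (auto simp: lower_def)

lemma lower_mono: "\<beta> \<le> \<gamma> \<Longrightarrow> lower Y \<beta> \<subseteq> lower Y \<gamma>"
  unfolding lower_def by (intro UN_mono) auto

lemma lower_eq_image: "lower Y \<beta> = (\<lambda>(\<gamma>, j). Y \<gamma> j) ` ({..<\<beta>} \<times> UNIV)"
  by (auto simp: lower_def)

text \<open>The vectors \<open>Y \<beta> j\<close> stand for the differentials of the derivatives of the flat output, and
  \<open>U \<alpha> j\<close> for those of the derivatives of the input. A deficit in the dimension at order \<open>r\<close>
  would persist in all higher orders, so that the \<open>Y\<close> could not generate the \<open>U\<close>.\<close>

lemma flat_output_independent:
  fixes Y U :: "nat \<Rightarrow> 'm::finite \<Rightarrow> 'e::euclidean_space" and r :: nat
  defines "s \<equiv> CARD('m) * r"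
  assumes step: "\<And>\<beta> J j. \<beta> < r + s \<Longrightarrow> Y \<beta> j \<in> span (lower Y \<beta> \<union> Y \<beta> ` J) \<Longrightarrow>
      Y (Suc \<beta>) j \<in> span (lower Y (Suc \<beta>) \<union> Y (Suc \<beta>) ` J)"
    and U: "\<And>\<alpha> j. \<alpha> \<le> s \<Longrightarrow> U \<alpha> j \<in> span (lower Y (Suc (r + \<alpha>)))"
    and dim_U: "dim (lower U (Suc s)) = CARD('m) * Suc s"
    and "\<beta> \<le> Suc r"
  shows "dim (lower Y \<beta>) = CARD('m) * \<beta>"
proof -
  let ?m = "int CARD('m)"
  define a where "a \<beta> = int (dim (lower Y \<beta>))" for \<beta>
  define \<sigma> where "\<sigma> \<beta> = a (Suc \<beta>) - a \<beta>" for \<beta>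
  have anti: "\<sigma> (Suc \<beta>) \<le> \<sigma> \<beta>" if "\<beta> < r + s" for \<beta>
    using rank_increment_mono[of "Y \<beta>" "lower Y \<beta>" "Y (Suc \<beta>)" "lower Y (Suc \<beta>)", OF step[OF that]]
    by (simp add: lower_Suc[symmetric] \<sigma>_def a_def)
  have a_sum: "a k = (\<Sum>\<beta><k. \<sigma> \<beta>)" for k
    using sum_lessThan_telescope[of a k] by (simp add: \<sigma>_def) (simp add: a_def)
  have \<sigma>_le: "\<sigma> \<beta> \<le> ?m" for \<beta>
    using dim_Un_image_le[of UNIV "lower Y \<beta>" "Y \<beta>"] by (simp add: \<sigma>_def a_def lower_Suc)
  have top: "\<sigma> \<beta> = ?m" if "\<beta> \<le> r" for \<beta>
  proof (rule ccontr)
    assume "\<sigma> \<beta> \<noteq> ?m"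
    then have less: "\<sigma> \<beta> \<le> ?m - 1" using \<sigma>_le[of \<beta>] by simp
    have high: "\<sigma> \<gamma> \<le> ?m - 1" if "r \<le> \<gamma>" "\<gamma> \<le> r + s" for \<gamma>
      using antimono_upto[of "r + s" \<sigma> \<beta> \<gamma>, OF anti] that \<open>\<beta> \<le> r\<close> less by simp
    have "lower U (Suc s) \<subseteq> span (lower Y (Suc (r + s)))"
    proof
      fix x assume "x \<in> lower U (Suc s)"
      then obtain \<alpha> j where \<alpha>: "\<alpha> \<le> s" "x = U \<alpha> j" by (auto simp: in_lower_iff less_Suc_eq_le)
      then show "x \<in> span (lower Y (Suc (r + s)))"
        using U[OF \<alpha>(1)] span_mono[OF lower_mono[of "Suc (r + \<alpha>)" "Suc (r + s)" Y]] by auto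
    qed
    then have "dim (lower U (Suc s)) \<le> dim (lower Y (Suc (r + s)))" by (rule dim_mono)
    \<comment> \<open>Each of the \<open>s + 1\<close> orders from \<open>r\<close> to
      \<open>r + s\<close> falls short by at least one, which bounds the dimension by
      \<open>m r + (m - 1) (s + 1)\<close>. As the \<open>U\<close> need \<open>m (s + 1)\<close>,
      this would give \<open>s + 1 \<le> m r\<close>, and \<open>s\<close> was chosen as
      \<open>m r\<close>.\<close>
    then have "?m * int (Suc s) \<le> a (Suc (r + s))"
      unfolding a_def dim_U of_nat_mult[symmetric] by (rule of_nat_mono)
    also have "\<dots> = (\<Sum>\<beta><r. \<sigma> \<beta>) + (\<Sum>\<beta>\<in>{r..r + s}. \<sigma> \<beta>)"
    proof -
      have "{..<Suc (r + s)} = {..<r} \<union> {r..r + s}" by auto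
      then show ?thesis unfolding a_sum by (simp add: sum.union_disjoint ivl_disj_int)
    qed
    also have "\<dots> \<le> (\<Sum>\<beta><r. ?m) + (\<Sum>\<beta>\<in>{r..r + s}. ?m - 1)"
      by (intro add_mono sum_mono \<sigma>_le high) auto
    also have "\<dots> = ?m * int r + (?m - 1) * int (Suc s)" by (simp add: algebra_simps)
    finally show False by (simp add: s_def algebra_simps)
  qed
  have "a \<beta> = (\<Sum>\<gamma><\<beta>. ?m)" unfolding a_sum using top \<open>\<beta> \<le> Suc r\<close> by (intro sum.cong) auto
  then show ?thesis by (simp add: a_def mult.commute flip: of_nat_mult)
qed

text \<open>With \<open>X\<close> the differentials of the state, \<open>J \<beta>\<close> below is a basis of the differentials of
  order \<open>\<beta>\<close> modulo the state and the lower orders. The idea is that dependence at order \<open>\<beta>\<close> is passed on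
  to order \<open>\<beta> + 1\<close> once \<open>du\<close> is added to the state (\<open>step_XU\<close>), and a comparison of the total dimensions
  shows that no further dependence arises. Hence \<open>J \<beta>\<close> remains independent at order \<open>\<beta> + 1\<close>.\<close>

lemma exists_triangular_multi_index:
  fixes Y :: "nat \<Rightarrow> 'm::finite \<Rightarrow> 'e::euclidean_space" and X U :: "'e set"
  assumes Y: "\<And>\<beta>. \<beta> \<le> Suc r \<Longrightarrow> dim (lower Y \<beta>) = CARD('m) * \<beta>"
    and step_XU: "\<And>\<beta> J j. \<beta> < r \<Longrightarrow> Y \<beta> j \<in> span (X \<union> lower Y \<beta> \<union> Y \<beta> ` J) \<Longrightarrow>
      Y (Suc \<beta>) j \<in> span (X \<union> U \<union> lower Y (Suc \<beta>) \<union> Y (Suc \<beta>) ` J)"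
    and Y0: "\<And>j. Y 0 j \<in> span (X \<union> U)"
    and dim_X: "dim X = n" and dim_XU: "dim (X \<union> U) = n + CARD('m)"
    and R: "\<And>j. R j \<le> r" and X: "X \<subseteq> span {Y \<gamma> j |\<gamma> j. \<gamma> < R j}"
    and U: "U \<subseteq> span (lower Y (Suc r))"
  obtains \<kappa> where "\<kappa> \<le> R" and "(\<Sum>j\<in>UNIV. \<kappa> j) = n"
    and "\<And>j \<beta>. \<beta> < \<kappa> j \<Longrightarrow> Y \<beta> j \<in> span (X \<union> lower Y \<beta> \<union> Y \<beta> ` {i. \<kappa> i \<le> \<beta>})"
proof -
  let ?m = "CARD('m)"
  define q where "q \<beta> = dim (X \<union> lower Y \<beta>)" for \<beta>
  define q' where "q' \<beta> = dim (X \<union> U \<union> lower Y \<beta>)" for \<beta>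
  have X_sub: "X \<subseteq> span (lower Y r)"
  proof -
    have "{Y \<gamma> j |\<gamma> j. \<gamma> < R j} \<subseteq> lower Y r"
      using order_less_le_trans[OF _ R] by (auto simp: in_lower_iff) blast
    then show ?thesis using X span_mono by blast
  qed
  have q_top: "q \<beta> = ?m * \<beta>" if "r \<le> \<beta>" "\<beta> \<le> Suc r" for \<beta>
  proof -
    have "X \<subseteq> span (lower Y \<beta>)" using X_sub span_mono[OF lower_mono[OF that(1), of Y]] by blast
    then show ?thesis unfolding q_def Y[OF that(2), symmetric] by (rule dim_Un_absorb)
  qed
  have q'_top: "q' (Suc r) = ?m * Suc r"
  proof -
    have "X \<subseteq> span (lower Y (Suc r))" using X_sub span_mono[OF lower_mono[of r "Suc r" Y]] by auto
    then have "X \<union> U \<subseteq> span (lower Y (Suc r))" using U by simp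
    then show ?thesis unfolding q'_def Y[OF order_refl, symmetric] by (rule dim_Un_absorb)
  qed
  have q'_bot: "q' (Suc 0) = n + ?m"
  proof -
    have "range (Y 0) \<subseteq> span (X \<union> U)" using Y0 by auto
    from dim_Un_absorb[OF this] show ?thesis
      unfolding q'_def dim_XU[symmetric] lower_Suc lower_0 Un_empty_left by (simp add: Un_commute)
  qed
  \<comment> \<open>Compares the space with \<open>U\<close> to the one without, at one order less.
    \<open>D\<close> never increases and has the value \<open>CARD('m)\<close> at both ends, hence
    it is constant.\<close>
  define D where "D \<beta> = int (q' (Suc \<beta>)) - int (q \<beta>)" for \<beta>
  have D_anti: "D (Suc \<beta>) \<le> D \<beta>" if "\<beta> < r" for \<beta>
    using rank_increment_mono[of "Y \<beta>" "X \<union> lower Y \<beta>" "Y (Suc \<beta>)" "X \<union> U \<union> lower Y (Suc \<beta>)",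
        OF step_XU[OF that]]
    by (simp add: D_def q_def q'_def lower_Suc Un_assoc)
  have D0: "D 0 = ?m" using q'_bot by (simp add: D_def q_def dim_X)
  have Dr: "D r = ?m" using q'_top q_top[of r] by (simp add: D_def)
  have D: "q' (Suc \<beta>) = q \<beta> + ?m" if "\<beta> \<le> r" for \<beta>
    using antimono_upto[of r D 0 \<beta>, OF D_anti] antimono_upto[of r D \<beta> r, OF D_anti] that D0 Dr
    by (simp add: D_def)
  define B where "B \<beta> J \<longleftrightarrow> dim (X \<union> lower Y \<beta> \<union> Y \<beta> ` J) = q \<beta> + card J \<and>
    range (Y \<beta>) \<subseteq> span (X \<union> lower Y \<beta> \<union> Y \<beta> ` J)" for \<beta> and J :: "'m set"
  have span_B: "span (X \<union> lower Y (Suc \<beta>)) = span (X \<union> lower Y \<beta> \<union> Y \<beta> ` J)" if "B \<beta> J" for \<beta> J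
  proof (rule antisym)
    have "X \<union> lower Y (Suc \<beta>) \<subseteq> span (X \<union> lower Y \<beta> \<union> Y \<beta> ` J)"
      using that unfolding B_def lower_Suc by (auto intro: span_base)
    then show "span (X \<union> lower Y (Suc \<beta>)) \<subseteq> span (X \<union> lower Y \<beta> \<union> Y \<beta> ` J)"
      by (rule span_minimal) simp
    show "span (X \<union> lower Y \<beta> \<union> Y \<beta> ` J) \<subseteq> span (X \<union> lower Y (Suc \<beta>))"
      unfolding lower_Suc by (rule span_mono) auto
  qed
  have q_B: "q (Suc \<beta>) = q \<beta> + card J" if "B \<beta> J" for \<beta> J
    using span_eq_dim[OF span_B[OF that]] that unfolding q_def B_def by simp
  have start: "\<exists>J. B 0 J"
  proof -
    obtain J where "dim (X \<union> lower Y 0 \<union> Y 0 ` J) = dim (X \<union> lower Y 0) + card J"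
      "range (Y 0) \<subseteq> span (X \<union> lower Y 0 \<union> Y 0 ` J)"
      using extend_independent_mod[of UNIV "{}" "X \<union> lower Y 0" "Y 0"] by auto
    then show ?thesis unfolding B_def q_def by blast
  qed
  have extend: "\<exists>J'. B (Suc \<beta>) J' \<and> J \<subseteq> J'" if "\<beta> < r" "B \<beta> J" for \<beta> J
  proof -
    let ?W' = "X \<union> U \<union> lower Y (Suc \<beta>)"
    have "range (Y (Suc \<beta>)) \<subseteq> span (?W' \<union> Y (Suc \<beta>) ` J)"
      using step_XU[OF that(1)] that(2) by (auto simp: B_def)
    then have "span (X \<union> U \<union> lower Y (Suc (Suc \<beta>))) = span (?W' \<union> Y (Suc \<beta>) ` J)"
      by (intro antisym span_minimal) (auto simp: lower_Suc[of _ "Suc \<beta>"] intro: span_base)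
    then have "dim (?W' \<union> Y (Suc \<beta>) ` J) = q' (Suc (Suc \<beta>))"
      unfolding q'_def by (intro span_eq_dim) simp
    \<comment> \<open>Constancy of \<open>D\<close> at \<open>\<beta>\<close> and
      \<open>Suc \<beta>\<close> shows that \<open>J\<close> is independent at the next order modulo
      the space enlarged by \<open>U\<close>, and all the more modulo the smaller space without
      \<open>U\<close>.\<close>
    also have "\<dots> = dim ?W' + card J"
      using D[of "Suc \<beta>"] D[of \<beta>] that q_B[OF that(2)] by (simp add: q'_def)
    finally have ind': "dim (?W' \<union> Y (Suc \<beta>) ` J) = dim ?W' + card J" .
    have "X \<union> lower Y (Suc \<beta>) \<subseteq> span ?W'" using span_superset[of ?W'] by blast
    from independent_mod_mono[OF finite this ind'] obtain J' where "J \<subseteq> J'"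
      "dim (X \<union> lower Y (Suc \<beta>) \<union> Y (Suc \<beta>) ` J') = dim (X \<union> lower Y (Suc \<beta>)) + card J'"
      "range (Y (Suc \<beta>)) \<subseteq> span (X \<union> lower Y (Suc \<beta>) \<union> Y (Suc \<beta>) ` J')"
      using extend_independent_mod[of UNIV J "X \<union> lower Y (Suc \<beta>)" "Y (Suc \<beta>)"] by auto
    then show ?thesis unfolding B_def q_def by blast
  qed
  obtain J where J: "\<And>\<beta>. \<beta> \<le> r \<Longrightarrow> B \<beta> (J \<beta>)" and J_mono: "\<And>\<beta>. \<beta> < r \<Longrightarrow> J \<beta> \<subseteq> J (Suc \<beta>)"
  proof -
    have "\<exists>J. \<forall>\<beta>. (\<beta> \<le> r \<longrightarrow> B \<beta> (J \<beta>)) \<and> (\<beta> < r \<longrightarrow> J \<beta> \<subseteq> J (Suc \<beta>))"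
    proof (rule dependent_nat_choice)
      show "\<exists>J. 0 \<le> r \<longrightarrow> B 0 J" using start by blast
      show "\<exists>J'. (Suc \<beta> \<le> r \<longrightarrow> B (Suc \<beta>) J') \<and> (\<beta> < r \<longrightarrow> J \<subseteq> J')" if "\<beta> \<le> r \<longrightarrow> B \<beta> J" for J \<beta>
        using extend[of \<beta> J] that by (cases "\<beta> < r") auto
    qed
    then show thesis using that by blast
  qed
  have J_le: "J \<beta> \<subseteq> J \<gamma>" if "\<beta> \<le> \<gamma>" "\<gamma> \<le> r" for \<beta> \<gamma>
    using that
  proof (induction \<gamma> rule: dec_induct)
    case (step \<gamma>)
    then show ?case using J_mono[of \<gamma>] by auto
  qed simp
  have "card (J r) = ?m" using q_B[OF J[of r]] q_top[of r] q_top[of "Suc r"] by simp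
  then have J_top: "J r = UNIV" by (simp add: card_eq_UNIV_imp_eq_UNIV)
  define \<kappa> where "\<kappa> j = (LEAST \<beta>. j \<in> J \<beta>)" for j
  have \<kappa>_le: "\<kappa> j \<le> r" for j unfolding \<kappa>_def by (rule Least_le) (simp add: J_top)
  have in_J: "j \<in> J (\<kappa> j)" for j unfolding \<kappa>_def by (rule LeastI[of _ r]) (simp add: J_top)
  have J_iff: "j \<in> J \<beta> \<longleftrightarrow> \<kappa> j \<le> \<beta>" if "\<beta> \<le> r" for j \<beta>
    using J_le[of "\<kappa> j" \<beta>] in_J[of j] that Least_le[of "\<lambda>\<beta>. j \<in> J \<beta>" \<beta>] by (auto simp: \<kappa>_def)
  have dep: "Y \<beta> j \<in> span (X \<union> lower Y \<beta> \<union> Y \<beta> ` {i. \<kappa> i \<le> \<beta>})" if "\<beta> < \<kappa> j" for j \<beta>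
  proof -
    have "\<beta> \<le> r" using that \<kappa>_le[of j] by simp
    moreover from this have "J \<beta> = {i. \<kappa> i \<le> \<beta>}" using J_iff by auto
    ultimately show ?thesis using J[of \<beta>] by (auto simp: B_def)
  qed
  \<comment> \<open>Otherwise the dependence at order \<open>R j\<close> expresses
    \<open>Y (R j) j\<close> by other members of the independent family of orders up to
    \<open>r\<close>: \<open>X\<close> needs only orders below \<open>R i\<close> in each component
    \<open>i\<close>, and \<open>j\<close> is not among the indices with
    \<open>\<kappa> i \<le> R j\<close>.\<close>
  have "\<kappa> j \<le> R j" for j
  proof (rule ccontr)
    assume "\<not> \<kappa> j \<le> R j"
    then have less: "R j < \<kappa> j" by simp
    let ?I = "{..<Suc r} \<times> (UNIV :: 'm set)" and ?Y = "\<lambda>(\<gamma>, j). Y \<gamma> j"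
    let ?Z = "?Y ` (?I - {(R j, j)})"
    have "X \<subseteq> span ?Z"
    proof -
      have "{Y \<gamma> i |\<gamma> i. \<gamma> < R i} \<subseteq> ?Z"
      proof clarify
        fix \<gamma> i assume "\<gamma> < R i"
        then have "(\<gamma>, i) \<in> ?I - {(R j, j)}" using R[of i] by auto
        then show "Y \<gamma> i \<in> ?Z" by force
      qed
      then show ?thesis using X span_mono by blast
    qed
    moreover have "lower Y (R j) \<subseteq> span ?Z"
    proof
      fix x assume "x \<in> lower Y (R j)"
      then obtain \<gamma> i where "\<gamma> < R j" and x: "x = Y \<gamma> i" by (auto simp: in_lower_iff)
      then have "(\<gamma>, i) \<in> ?I - {(R j, j)}" using R[of j] by auto
      then show "x \<in> span ?Z" unfolding x by (intro span_base) force
    qed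
    moreover have "Y (R j) ` {i. \<kappa> i \<le> R j} \<subseteq> span ?Z"
    proof
      fix x assume "x \<in> Y (R j) ` {i. \<kappa> i \<le> R j}"
      then obtain i where "\<kappa> i \<le> R j" and x: "x = Y (R j) i" by auto
      then have "(R j, i) \<in> ?I - {(R j, j)}" using R[of j] less by auto
      then show "x \<in> span ?Z" unfolding x by (intro span_base) force
    qed
    ultimately have "span (X \<union> lower Y (R j) \<union> Y (R j) ` {i. \<kappa> i \<le> R j}) \<subseteq> span ?Z"
      by (intro span_minimal) auto
    then have "?Y (R j, j) \<in> span ?Z" using dep[OF less] by auto
    moreover have "dim (?Y ` ?I) = card ?I"
      using Y[of "Suc r"] unfolding lower_eq_image by (simp add: mult.commute)
    moreover have "(R j, j) \<in> ?I" using R[of j] by simp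
    moreover have "finite ?I" by simp
    ultimately show False using full_dim_imp_not_in_span[of ?I ?Y "(R j, j)"] by blast
  qed
  then have "\<kappa> \<le> R" by (simp add: le_fun_def)
  moreover have "(\<Sum>j\<in>UNIV. \<kappa> j) = n"
  proof -
    \<comment> \<open>The pairs with \<open>\<beta> < \<kappa> j\<close> are counted by order: each
      \<open>\<beta>\<close> contributes \<open>CARD('m) - card (J \<beta>)\<close>. The sum
      telescopes to \<open>CARD('m) * r - q r + q 0\<close>, where \<open>q r = CARD('m) * r\<close>
      and \<open>q 0 = n\<close>.\<close>
    have "\<kappa> j = (\<Sum>\<beta><r. of_bool (\<beta> < \<kappa> j))" for j
    proof -
      have "(\<Sum>\<beta><r. of_bool (\<beta> < \<kappa> j)) = card ({..<r} \<inter> {\<beta>. \<beta> < \<kappa> j})" by simp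
      also have "{..<r} \<inter> {\<beta>. \<beta> < \<kappa> j} = {..<\<kappa> j}" using \<kappa>_le[of j] by auto
      finally show ?thesis by simp
    qed
    then have "(\<Sum>j\<in>UNIV. \<kappa> j) = (\<Sum>j\<in>UNIV. \<Sum>\<beta><r. of_bool (\<beta> < \<kappa> j))" by simp
    also have "\<dots> = (\<Sum>\<beta><r. \<Sum>j\<in>UNIV. of_bool (\<beta> < \<kappa> j))" by (rule sum.swap)
    finally have "int (\<Sum>j\<in>UNIV. \<kappa> j) = int (\<Sum>\<beta><r. \<Sum>j\<in>UNIV. of_bool (\<beta> < \<kappa> j))" by (rule arg_cong)
    also have "\<dots> = (\<Sum>\<beta><r. int (\<Sum>j\<in>UNIV. of_bool (\<beta> < \<kappa> j)))" by (rule of_nat_sum)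
    also have "\<dots> = (\<Sum>\<beta><r. int ?m - (int (q (Suc \<beta>)) - int (q \<beta>)))"
    proof (rule sum.cong[OF refl])
      fix \<beta> assume "\<beta> \<in> {..<r}"
      then have \<beta>: "\<beta> \<le> r" by simp
      have "{j. \<beta> < \<kappa> j} = - J \<beta>" using J_iff[OF \<beta>] by auto
      then have "(\<Sum>j\<in>UNIV. of_bool (\<beta> < \<kappa> j)) = card (- J \<beta>)" by simp
      then have "int (\<Sum>j\<in>UNIV. of_bool (\<beta> < \<kappa> j)) = int ?m - int (card (J \<beta>))"
        by (simp add: Compl_eq_Diff_UNIV card_Diff_subset of_nat_diff card_mono)
      then show "int (\<Sum>j\<in>UNIV. of_bool (\<beta> < \<kappa> j)) = int ?m - (int (q (Suc \<beta>)) - int (q \<beta>))"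
        using q_B[OF J[OF \<beta>]] by simp
    qed
    also have "\<dots> = int ?m * int r - (int (q r) - int (q 0))"
      by (subst sum_subtractf, subst sum_lessThan_telescope) (simp add: mult.commute)
    also have "\<dots> = int n" using q_top[of r] by (simp add: q_def dim_X)
    finally show ?thesis by (rule of_nat_eq_iff[THEN iffD1])
  qed
  ultimately show thesis using dep by (rule that)
qed

section \<open>Differentials on the jet space\<close>

text \<open>Double orthogonal complement: membership in a codistribution is checked on the tangent
  vectors which its generators annihilate.\<close>

lemma in_span_if_orthogonal:
  fixes x :: "'e::euclidean_space"
  assumes "\<And>v. (\<And>t. t \<in> T \<Longrightarrow> t \<bullet> v = 0) \<Longrightarrow> x \<bullet> v = 0"
  shows "x \<in> span T"
proof -
  obtain y z where y: "y \<in> span T" and z: "\<And>w. w \<in> span T \<Longrightarrow> orthogonal z w" and x: "x = y + z"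
    using orthogonal_subspace_decomp_exists by blast
  have "t \<bullet> z = 0" if "t \<in> T" for t
    using z[OF span_base[OF that]] by (simp add: orthogonal_def inner_commute)
  then have "x \<bullet> z = 0" by (rule assms)
  moreover have "y \<bullet> z = 0" using z[OF y] by (simp add: orthogonal_def inner_commute)
  ultimately have "z = 0" by (simp add: x inner_add_left)
  then show ?thesis using x y by simp
qed

lemma span_orthogonal:
  fixes x :: "'e::euclidean_space"
  assumes "x \<in> span T" and "\<And>t. t \<in> T \<Longrightarrow> t \<bullet> v = 0"
  shows "x \<bullet> v = 0"
  using assms(1)
  by (rule span_induct_alt) (auto simp: inner_add_left assms(2))

text \<open>Ranks are lower semicontinuous, and their sum over all subfamilies is bounded. Where
  this sum is maximal within an open set, no single rank can rise nearby without increasing it, so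
  all ranks are locally constant there; every open set meeting \<open>V\<close> contains such a
  point.\<close>

lemma dense_constant_dim:
  fixes w :: "'p::topological_space \<Rightarrow> 'i \<Rightarrow> 'e::euclidean_space"
  assumes "open V" and "finite I"
    and w: "\<And>p i. p \<in> V \<Longrightarrow> i \<in> I \<Longrightarrow> ((\<lambda>q. w q i) \<longlongrightarrow> w p i) (nhds p)"
  obtains D where "open D" and "D \<subseteq> V" and "V \<subseteq> closure D"
    and "\<And>p. p \<in> D \<Longrightarrow> \<exists>N. open N \<and> p \<in> N \<and> N \<subseteq> D \<and>
      (\<forall>q\<in>N. \<forall>K\<subseteq>I. dim (w q ` K) = dim (w p ` K))"
proof -
  define good where "good N p \<longleftrightarrow> open N \<and> p \<in> N \<and> N \<subseteq> V \<and>
    (\<forall>q\<in>N. \<forall>K\<subseteq>I. dim (w q ` K) = dim (w p ` K))" for N p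
  define D where "D = {p. \<exists>N. good N p}"
  have sub: "N \<subseteq> D" if "good N p" for N p
  proof
    fix q assume "q \<in> N"
    have N: "open N" "N \<subseteq> V" and dim_N: "\<And>q K. q \<in> N \<Longrightarrow> K \<subseteq> I \<Longrightarrow> dim (w q ` K) = dim (w p ` K)"
      using that unfolding good_def by blast+
    have "dim (w q' ` K) = dim (w q ` K)" if "q' \<in> N" "K \<subseteq> I" for q' K
      by (rule trans[OF dim_N[OF that] dim_N[OF \<open>q \<in> N\<close> that(2), symmetric]])
    then have "good N q" using N \<open>q \<in> N\<close> unfolding good_def by blast
    then show "q \<in> D" by (auto simp: D_def)
  qed
  have ex: "\<exists>N. open N \<and> p \<in> N \<and> N \<subseteq> D \<and> (\<forall>q\<in>N. \<forall>K\<subseteq>I. dim (w q ` K) = dim (w p ` K))"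
    if "p \<in> D" for p
  proof -
    obtain N where "good N p" using \<open>p \<in> D\<close> by (auto simp: D_def)
    with sub[OF this] show ?thesis unfolding good_def by blast
  qed
  have "open D"
  proof (subst open_subopen, intro ballI)
    fix p assume "p \<in> D"
    then obtain N where "open N" "p \<in> N" "N \<subseteq> D" using ex[of p] by metis
    then show "\<exists>T. open T \<and> p \<in> T \<and> T \<subseteq> D" by metis
  qed
  moreover have "D \<subseteq> V" by (auto simp: D_def good_def)
  moreover have "V \<subseteq> closure D"
  proof
    fix p assume p: "p \<in> V"
    have "D \<inter> T \<noteq> {}" if T: "open T" "p \<in> T" for T
    proof -
      define Q where "Q = T \<inter> V"
      have Q: "open Q" "p \<in> Q" "Q \<subseteq> V" using T p assms(1) by (auto simp: Q_def)
      define total where "total q = (\<Sum>K\<in>Pow I. dim (w q ` K))" for q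
      have "total q \<le> (\<Sum>K\<in>Pow I. DIM('e))" for q
        unfolding total_def by (intro sum_mono dim_subset_UNIV)
      then obtain q where q: "q \<in> Q" "\<And>q'. q' \<in> Q \<Longrightarrow> total q' \<le> total q"
        using ex_has_greatest_nat[of "\<lambda>q. q \<in> Q" p total "Suc (\<Sum>K\<in>Pow I. DIM('e))"] Q(2)
        by (auto simp: less_Suc_eq_le)
      have "\<forall>\<^sub>F q' in nhds q. \<forall>K\<in>Pow I. dim (w q ` K) \<le> dim (w q' ` K)"
      proof (intro eventually_ball_finite ballI)
        fix K assume K: "K \<in> Pow I"
        then have "finite K" using assms(2) finite_subset by blast
        then show "\<forall>\<^sub>F q' in nhds q. dim (w q ` K) \<le> dim (w q' ` K)"
          using K q(1) Q(3) by (intro eventually_dim_ge w) auto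
      qed (use assms(2) in simp)
      then obtain N' where N': "open N'" "q \<in> N'"
        "\<And>q' K. q' \<in> N' \<Longrightarrow> K \<subseteq> I \<Longrightarrow> dim (w q ` K) \<le> dim (w q' ` K)"
        unfolding eventually_nhds by auto
      have "dim (w q' ` K) = dim (w q ` K)" if q': "q' \<in> N' \<inter> Q" and K: "K \<subseteq> I" for q' K
      proof -
        have "total q \<le> total q'" unfolding total_def using N'(3) q' by (intro sum_mono) auto
        then have "total q = total q'" using q(2)[of q'] q' by simp
        then show ?thesis
          unfolding total_def using sum_mono_inv[of "\<lambda>K. dim (w q ` K)" "Pow I" "\<lambda>K. dim (w q' ` K)" K]
            N'(3) q' K assms(2) by simp
      qed
      then have "good (N' \<inter> Q) q"
        unfolding good_def using N'(1,2) q(1) Q(1,3) by (intro conjI open_Int) blast+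
      then have "q \<in> D" by (auto simp: D_def)
      then show ?thesis using q(1) by (auto simp: Q_def)
    qed
    then show "p \<in> closure D" by (auto simp: closure_iff_nhds_not_empty)
  qed
  ultimately show thesis using ex by (rule that)
qed

section \<open>Derivatives of jets and of their coordinates\<close>

lemma gradient_cong:
  assumes "open S" and "p \<in> S" and "\<And>q. q \<in> S \<Longrightarrow> h q = k q" and "smooth_on S h"
  shows "gradient h p = gradient k p"
proof -
  have "(k has_derivative (\<lambda>v. gradient h p \<bullet> v)) (at p)"
    by (rule has_derivative_transform_within_open[OF has_derivative_gradient[OF assms(4,2)] assms(1,2)])
      (rule assms(3))
  then show ?thesis by (rule gradient_eqI[symmetric])
qed

lemma has_derivative_vecI:
  fixes f :: "'a::real_normed_vector \<Rightarrow> 'b::euclidean_space ^ 'n"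
  assumes "\<And>i. ((\<lambda>x. f x $ i) has_derivative (\<lambda>v. f' v $ i)) (at a)"
  shows "(f has_derivative f') (at a)"
  unfolding has_derivative_componentwise_within[of f]
proof
  fix b :: "'b ^ 'n" assume "b \<in> Basis"
  then obtain i c where b: "b = axis i c" by (auto simp: Basis_vec_def)
  show "((\<lambda>x. f x \<bullet> b) has_derivative (\<lambda>x. f' x \<bullet> b)) (at a)"
    unfolding b inner_axis by (rule has_derivative_inner_left[OF assms])
qed

lemma collect_nth: "collect B h $ k $ j = (if ord_of k < B j then h (ord_of k) $ j else 0)"
  by (simp add: collect_def)

lemma has_derivative_collect:
  fixes h :: "nat \<Rightarrow> 'a::real_normed_vector \<Rightarrow> real^'m::finite"
  assumes "\<And>\<beta>. (h \<beta> has_derivative h' \<beta>) (at p)"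
  shows "((\<lambda>q. collect B (\<lambda>\<beta>. h \<beta> q) :: ('m, 'l::{finite,linorder}) derivs) has_derivative
    (\<lambda>v. collect B (\<lambda>\<beta>. h' \<beta> v))) (at p)"
proof (intro has_derivative_vecI)
  fix k :: 'l and j :: 'm
  have "((\<lambda>q. h (ord_of k) q $ j) has_derivative (\<lambda>v. h' (ord_of k) v $ j)) (at p)"
    by (rule bounded_linear.has_derivative[OF bounded_linear_vec_nth assms])
  then show "((\<lambda>q. (collect B (\<lambda>\<beta>. h \<beta> q) :: ('m, 'l) derivs) $ k $ j) has_derivative
      (\<lambda>v. (collect B (\<lambda>\<beta>. h' \<beta> v) :: ('m, 'l) derivs) $ k $ j)) (at p)"
    unfolding collect_nth by (cases "ord_of k < B j") simp_all
qed

lemma bounded_linear_xu: "bounded_linear (xu :: ('n::finite, 'm::finite, 'l::{finite,linorder}) jet \<Rightarrow> _)"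
  unfolding xu_def[abs_def]
  by (intro bounded_linear_Pair bounded_linear_fst
      bounded_linear_compose[OF bounded_linear_vec_nth bounded_linear_snd])

text \<open>A common index type for states, inputs and outputs, so that a single rank condition on
  subfamilies covers every codistribution that occurs.\<close>

datatype ('n, 'm) jet_coord = State 'n | Input nat 'm | Output nat 'm

primrec coord_fun ::
  "((real^'n) \<times> (real^'m) \<Rightarrow> real^'n) \<Rightarrow> ((real^'n) \<times> (real^'m) \<Rightarrow> real^'m) \<Rightarrow>
    ('n, 'm) jet_coord \<Rightarrow> ('n::finite, 'm::finite, 'l::{finite,linorder}) jet \<Rightarrow> real" where
  "coord_fun f \<phi> (State i) = (\<lambda>p. fst p $ i)"
| "coord_fun f \<phi> (Input \<alpha> j) = (\<lambda>p. snd p $ slot \<alpha> $ j)"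
| "coord_fun f \<phi> (Output \<beta> j) = (\<lambda>p. time_deriv f \<phi> \<beta> p $ j)"

locale flat_system =
  fixes S :: "((real^'n::finite) \<times> (real^'m::finite)) set"
    and f :: "(real^'n) \<times> (real^'m) \<Rightarrow> real^'n"
    and \<phi> :: "(real^'n) \<times> (real^'m) \<Rightarrow> real^'m"
    and V :: "('n, 'm, 'l::{finite,linorder}) jet set"
    and R :: "'m \<Rightarrow> nat"
  assumes open_S: "open S" and smooth_f: "smooth_on S f" and smooth_\<phi>: "smooth_on S \<phi>"
    and open_V: "open V" and xu_V: "xu ` V \<subseteq> S" and flat: "flat_with V f \<phi> R"
    and l_u_large: "\<And>j. (CARD('m) + 2) * (R j + 1) \<le> CARD('l)"
begin

abbreviation X :: "('n, 'm, 'l) jet \<Rightarrow> ('n, 'm, 'l) jet" where "X \<equiv> prolonged_field f"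

abbreviation y :: "nat \<Rightarrow> ('n, 'm, 'l) jet \<Rightarrow> real^'m" where "y \<equiv> time_deriv f \<phi>"

lemma smooth_xu_comp:
  fixes h :: "(real^'n) \<times> (real^'m) \<Rightarrow> 'b::real_normed_vector"
  assumes "smooth_on S h"
  shows "smooth_on V (h \<circ> xu)"
  unfolding o_def
  by (rule smooth_on_compose[OF open_V open_S xu_V smooth_on_linear[OF open_V bounded_linear_xu] assms])

lemma smooth_X: "smooth_on V X"
proof -
  have nth: "bounded_linear (\<lambda>p::('n, 'm, 'l) jet. snd p $ k)" for k
    by (rule bounded_linear_compose[OF bounded_linear_vec_nth bounded_linear_snd])
  have ax: "bounded_linear (\<lambda>v. axis k v :: ('m, 'l) derivs)" for k
    by (auto simp: axis_def vec_eq_iff linear_conv_bounded_linear[symmetric] intro!: linearI)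
  have "smooth_on V (\<lambda>p. (f (xu p), \<Sum>\<alpha><CARD('l) - 1. axis (slot \<alpha>) (snd p $ slot (Suc \<alpha>)) :: ('m, 'l) derivs))"
    by (rule smooth_on_Pair[OF open_V smooth_xu_comp[OF smooth_f, unfolded o_def]],
        rule smooth_on_linear[OF open_V],
        rule bounded_linear_sum, rule bounded_linear_compose[OF ax nth])
  then show ?thesis by (simp add: prolonged_field_def[abs_def])
qed

lemma y_0: "y 0 = \<phi> \<circ> xu"
  by (simp add: time_deriv_def)

lemma y_Suc: "y (Suc \<beta>) = lie_derivative X (y \<beta>)"
  by (simp add: time_deriv_def)

lemma smooth_y: "smooth_on V (y \<beta>)"
proof (induction \<beta>)
  case 0
  show ?case unfolding y_0 by (rule smooth_xu_comp[OF smooth_\<phi>])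
next
  case (Suc \<beta>)
  show ?case unfolding y_Suc by (rule smooth_on_lie_derivative[OF open_V smooth_X Suc])
qed

definition dy :: "nat \<Rightarrow> ('n, 'm, 'l) jet \<Rightarrow> ('n, 'm, 'l) jet \<Rightarrow> real^'m" where
  "dy \<beta> p = frechet_derivative (y \<beta>) (at p)"

lemma has_derivative_y: "p \<in> V \<Longrightarrow> (y \<beta> has_derivative dy \<beta> p) (at p)"
  unfolding dy_def by (rule smooth_on_has_derivative[OF smooth_y])

lemma dy_X: "dy \<beta> p (X p) = y (Suc \<beta>) p"
  by (simp add: y_Suc lie_derivative_def dy_def)

definition g :: "('n, 'm) jet_coord \<Rightarrow> ('n, 'm, 'l) jet \<Rightarrow> ('n, 'm, 'l) jet" where
  "g c = gradient (coord_fun f \<phi> c)"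

lemma smooth_coord_fun: "smooth_on V (coord_fun f \<phi> c)"
proof (cases c)
  case (State i)
  have "smooth_on V (\<lambda>p. fst p $ i)"
    by (intro smooth_on_linear open_V bounded_linear_compose[OF bounded_linear_vec_nth bounded_linear_fst])
  then show ?thesis by (simp add: State)
next
  case (Input \<alpha> j)
  have "smooth_on V (\<lambda>p. snd p $ slot \<alpha> $ j)"
    by (intro smooth_on_linear open_V bounded_linear_compose[OF bounded_linear_vec_nth]
        bounded_linear_compose[OF bounded_linear_vec_nth bounded_linear_snd])
  then show ?thesis by (simp add: Input)
next
  case (Output \<beta> j)
  have "smooth_on V (\<lambda>p. y \<beta> p $ j)"
    by (rule smooth_on_linear_comp[OF open_V bounded_linear_vec_nth smooth_y])
  then show ?thesis by (simp add: Output)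
qed

lemma g_State: "g (State i) p = (axis i 1, 0)"
proof -
  have "((\<lambda>q. fst q $ i) has_derivative (\<lambda>v. (axis i 1, 0) \<bullet> v)) (at p)"
  proof (rule has_derivative_eq_rhs)
    show "((\<lambda>q. fst q $ i) has_derivative (\<lambda>v. fst v $ i)) (at p)"
      by (intro bounded_linear_imp_has_derivative
          bounded_linear_compose[OF bounded_linear_vec_nth bounded_linear_fst])
  qed (auto simp: inner_prod_def inner_axis')
  then show ?thesis unfolding g_def coord_fun.simps by (rule gradient_eqI)
qed

lemma g_Input: "g (Input \<alpha> j) p = (0, axis (slot \<alpha>) (axis j 1))"
proof -
  have "((\<lambda>q. snd q $ slot \<alpha> $ j) has_derivative (\<lambda>v. (0, axis (slot \<alpha>) (axis j 1)) \<bullet> v)) (at p)"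
  proof (rule has_derivative_eq_rhs)
    show "((\<lambda>q. snd q $ slot \<alpha> $ j) has_derivative (\<lambda>v. snd v $ slot \<alpha> $ j)) (at p)"
      by (intro bounded_linear_imp_has_derivative bounded_linear_compose[OF bounded_linear_vec_nth]
          bounded_linear_compose[OF bounded_linear_vec_nth bounded_linear_snd])
  qed (auto simp: inner_prod_def inner_axis')
  then show ?thesis unfolding g_def coord_fun.simps by (rule gradient_eqI)
qed

lemma g_Output: "p \<in> V \<Longrightarrow> g (Output \<beta> j) p \<bullet> v = dy \<beta> p v $ j"
proof -
  assume p: "p \<in> V"
  have "((\<lambda>q. y \<beta> q $ j) has_derivative (\<lambda>v. dy \<beta> p v $ j)) (at p)"
    by (rule bounded_linear.has_derivative[OF bounded_linear_vec_nth has_derivative_y[OF p]])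
  moreover have "((\<lambda>q. y \<beta> q $ j) has_derivative (\<lambda>v. g (Output \<beta> j) p \<bullet> v)) (at p)"
    using has_derivative_gradient[OF smooth_coord_fun p, of "Output \<beta> j"] by (simp add: g_def)
  ultimately show ?thesis using has_derivative_unique by metis
qed

definition gL :: "('n, 'm) jet_coord \<Rightarrow> ('n, 'm, 'l) jet \<Rightarrow> ('n, 'm, 'l) jet" where
  "gL c = gradient (lie_derivative X (coord_fun f \<phi> c))"

lemma gL_Output:
  assumes "p \<in> V"
  shows "gL (Output \<beta> j) p = g (Output (Suc \<beta>) j) p"
  unfolding gL_def g_def
proof (rule gradient_cong[OF open_V assms])
  fix q assume q: "q \<in> V"
  have "((\<lambda>q. y \<beta> q $ j) has_derivative (\<lambda>v. dy \<beta> q v $ j)) (at q)"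
    by (rule bounded_linear.has_derivative[OF bounded_linear_vec_nth has_derivative_y[OF q]])
  from frechet_derivative_at[OF this, symmetric]
  show "lie_derivative X (coord_fun f \<phi> (Output \<beta> j)) q = coord_fun f \<phi> (Output (Suc \<beta>) j) q"
    by (simp add: lie_derivative_def[of X "\<lambda>p. y \<beta> p $ j"] dy_X)
qed (intro smooth_on_lie_derivative open_V smooth_X smooth_coord_fun)

lemma X_State: "fst (X p) = f (xu p)"
  by (simp add: prolonged_field_def)

lemma slot_eq_iff: "\<alpha> < CARD('l) \<Longrightarrow> \<beta> < CARD('l) \<Longrightarrow> (slot \<alpha> :: 'l) = slot \<beta> \<longleftrightarrow> \<alpha> = \<beta>"
  by (metis ord_of_slot)

lemma X_Input: "Suc \<alpha> < CARD('l) \<Longrightarrow> snd (X p) $ slot \<alpha> = snd p $ slot (Suc \<alpha>)"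
proof -
  assume \<alpha>: "Suc \<alpha> < CARD('l)"
  have "snd (X p) $ slot \<alpha> = (\<Sum>\<beta><CARD('l) - 1. if \<beta> = \<alpha> then snd p $ slot (Suc \<beta>) else 0)"
    unfolding prolonged_field_def snd_conv sum_component
    by (rule sum.cong[OF refl]) (use \<alpha> in \<open>auto simp: axis_def slot_eq_iff\<close>)
  then show ?thesis using \<alpha> by simp
qed

lemma gL_Input:
  assumes "p \<in> V" and "Suc \<alpha> < CARD('l)"
  shows "gL (Input \<alpha> j) p = g (Input (Suc \<alpha>) j) p"
  unfolding gL_def g_def
proof (rule gradient_cong[OF open_V assms(1)])
  fix q assume q: "q \<in> V"
  have "lie_derivative X (coord_fun f \<phi> (Input \<alpha> j)) q = g (Input \<alpha> j) q \<bullet> X q"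
    unfolding lie_derivative_def g_def
    by (rule gradient_inner[OF has_derivative_linear[OF smooth_on_has_derivative[OF smooth_coord_fun q]], symmetric])
  then show "lie_derivative X (coord_fun f \<phi> (Input \<alpha> j)) q = coord_fun f \<phi> (Input (Suc \<alpha>) j) q"
    using X_Input[OF assms(2)] by (simp add: g_Input inner_prod_def inner_axis')
qed (intro smooth_on_lie_derivative open_V smooth_X smooth_coord_fun)

text \<open>A tangent vector annihilated by all state and input differentials lies in the kernel of
  \<open>xu\<close>. This serves the components of \<open>f\<close>, for the derivative of the
  state, and those of \<open>\<phi>\<close>, for the outputs of order 0.\<close>

lemma gradient_xu_comp_in_span:
  assumes p: "p \<in> V" and h: "smooth_on S h"
  shows "gradient (h \<circ> xu) p \<in> span (range (\<lambda>i. g (State i) p) \<union> range (\<lambda>j. g (Input 0 j) p))"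
proof (rule in_span_if_orthogonal)
  fix v assume v: "\<And>t. t \<in> range (\<lambda>i. g (State i) p) \<union> range (\<lambda>j. g (Input 0 j) p) \<Longrightarrow> t \<bullet> v = 0"
  have "fst v $ i = 0" for i using v[of "g (State i) p"] by (auto simp: g_State inner_prod_def inner_axis')
  then have 1: "fst v = 0" by (simp add: vec_eq_iff)
  have "snd v $ slot 0 $ j = 0" for j
    using v[of "g (Input 0 j) p"] by (auto simp: g_Input inner_prod_def inner_axis')
  then have "xu v = 0" using 1 by (simp add: xu_def vec_eq_iff zero_prod_def)
  have hx: "(h has_derivative frechet_derivative h (at (xu p))) (at (xu p))"
    using smooth_on_has_derivative[OF h] xu_V p by blast
  have "(h \<circ> xu has_derivative frechet_derivative h (at (xu p)) \<circ> xu) (at p)"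
    by (rule diff_chain_at[OF bounded_linear_imp_has_derivative[OF bounded_linear_xu] hx])
  moreover have "(h \<circ> xu has_derivative (\<lambda>v. gradient (h \<circ> xu) p \<bullet> v)) (at p)"
    by (rule has_derivative_gradient[OF smooth_xu_comp[OF h] p])
  ultimately have "(frechet_derivative h (at (xu p)) \<circ> xu) v = gradient (h \<circ> xu) p \<bullet> v"
    using has_derivative_unique by metis
  then show "gradient (h \<circ> xu) p \<bullet> v = 0"
    using \<open>xu v = 0\<close> linear_0[OF has_derivative_linear[OF hx]] by simp
qed

lemma gL_State:
  assumes p: "p \<in> V"
  shows "gL (State i) p \<in> span (range (\<lambda>i. g (State i) p) \<union> range (\<lambda>j. g (Input 0 j) p))"
proof -
  have "gL (State i) p = gradient ((\<lambda>z. f z $ i) \<circ> xu) p"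
    unfolding gL_def
  proof (rule gradient_cong[OF open_V p])
    fix q assume q: "q \<in> V"
    have "lie_derivative X (coord_fun f \<phi> (State i)) q = g (State i) q \<bullet> X q"
      unfolding lie_derivative_def g_def
      by (rule gradient_inner[OF has_derivative_linear[OF smooth_on_has_derivative[OF smooth_coord_fun q]], symmetric])
    then show "lie_derivative X (coord_fun f \<phi> (State i)) q = ((\<lambda>z. f z $ i) \<circ> xu) q"
      by (simp add: g_State inner_prod_def inner_axis' X_State)
  qed (intro smooth_on_lie_derivative open_V smooth_X smooth_coord_fun)
  then show ?thesis
    using gradient_xu_comp_in_span[OF p smooth_on_linear_comp[OF open_S bounded_linear_vec_nth smooth_f]]
    by simp
qed

lemma flatE:
  assumes "p \<in> V"
  obtains N Yx Yu and Fx :: "('m, 'l) derivs \<Rightarrow> real^'n" and Fu :: "('m, 'l) derivs \<Rightarrow> real^'m"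
  where "open N" and "p \<in> N" and "N \<subseteq> V" and "open Yx" and "smooth_on Yx Fx"
    and "open Yu" and "smooth_on Yu Fu"
    and "\<And>q. q \<in> N \<Longrightarrow> collect R (\<lambda>\<beta>. y \<beta> q) \<in> Yx"
    and "\<And>q. q \<in> N \<Longrightarrow> collect (\<lambda>j. R j + 1) (\<lambda>\<beta>. y \<beta> q) \<in> Yu"
    and "\<And>q. q \<in> N \<Longrightarrow> xu q = (Fx (collect R (\<lambda>\<beta>. y \<beta> q)), Fu (collect (\<lambda>j. R j + 1) (\<lambda>\<beta>. y \<beta> q)))"
  using flat assms unfolding flat_with_def Let_def by metis

text \<open>Chain rule for the identities of flatness; as \<open>h\<close> is linear, it is its own
  derivative. With \<open>h\<close> the projection to the state or to the input, a tangent vector is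
  seen to be controlled there by its output derivatives.\<close>

lemma dx_eq:
  assumes "open N" and "p \<in> N" and "N \<subseteq> V" and "open Y" and "smooth_on Y F"
    and "\<And>q. q \<in> N \<Longrightarrow> collect B (\<lambda>\<beta>. y \<beta> q) \<in> Y"
    and "\<And>q. q \<in> N \<Longrightarrow> h q = F (collect B (\<lambda>\<beta>. y \<beta> q) :: ('m, 'l) derivs)"
    and "bounded_linear h"
  shows "h v = frechet_derivative F (at (collect B (\<lambda>\<beta>. y \<beta> p))) (collect B (\<lambda>\<beta>. dy \<beta> p v))"
proof -
  let ?c = "\<lambda>q. collect B (\<lambda>\<beta>. y \<beta> q) :: ('m, 'l) derivs"
  have c: "(?c has_derivative (\<lambda>v. collect B (\<lambda>\<beta>. dy \<beta> p v))) (at p)"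
    by (rule has_derivative_collect) (rule has_derivative_y, use assms in blast)
  have F: "(F has_derivative frechet_derivative F (at (?c p))) (at (?c p))"
    using smooth_on_has_derivative[OF assms(5)] assms(2,6) by blast
  have "((\<lambda>q. F (?c q)) has_derivative
      (\<lambda>v. frechet_derivative F (at (?c p)) (collect B (\<lambda>\<beta>. dy \<beta> p v)))) (at p)"
    using diff_chain_at[OF c F] by (simp add: o_def)
  from has_derivative_transform_within_open[OF this assms(1,2)]
  have "(h has_derivative
      (\<lambda>v. frechet_derivative F (at (?c p)) (collect B (\<lambda>\<beta>. dy \<beta> p v)))) (at p)"
    using assms(7) by simp
  from has_derivative_unique[OF this bounded_linear_imp_has_derivative[OF assms(8)]]
  show ?thesis by metis
qed

lemma collect_cong_zero: "(\<And>\<beta> j. \<beta> < B j \<Longrightarrow> h \<beta> $ j = 0) \<Longrightarrow> collect B h = 0"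
  by (simp add: vec_eq_iff collect_nth)

lemma g_State_in_span:
  assumes p: "p \<in> V"
  shows "g (State i) p \<in> span {g (Output \<beta> j) p |\<beta> j. \<beta> < R j}"
proof (rule in_span_if_orthogonal)
  fix v assume v: "\<And>t. t \<in> {g (Output \<beta> j) p |\<beta> j. \<beta> < R j} \<Longrightarrow> t \<bullet> v = 0"
  obtain N and Yx Yu :: "('m, 'l) derivs set" and Fx Fu where *: "open N" "p \<in> N" "N \<subseteq> V" "open Yx" "smooth_on Yx Fx"
    "\<And>q. q \<in> N \<Longrightarrow> collect R (\<lambda>\<beta>. y \<beta> q) \<in> Yx"
    "\<And>q. q \<in> N \<Longrightarrow> xu q = ((Fx :: ('m, 'l) derivs \<Rightarrow> real^'n) (collect R (\<lambda>\<beta>. y \<beta> q)),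
        (Fu :: ('m, 'l) derivs \<Rightarrow> real^'m) (collect (\<lambda>j. R j + 1) (\<lambda>\<beta>. y \<beta> q)))"
    by (rule flatE[OF p]) (rule that)
  have "dy \<beta> p v $ j = 0" if "\<beta> < R j" for \<beta> j
    using v[of "g (Output \<beta> j) p"] that g_Output[OF p] by auto
  then have "collect R (\<lambda>\<beta>. dy \<beta> p v) = (0 :: ('m, 'l) derivs)" by (rule collect_cong_zero)
  moreover have "(fst q) = Fx (collect R (\<lambda>\<beta>. y \<beta> q))" if "q \<in> N" for q
    using *(7)[OF that] by (simp add: xu_def)
  moreover have "linear (frechet_derivative Fx (at (collect R (\<lambda>\<beta>. y \<beta> p))))"
    using smooth_on_has_derivative[OF *(5) *(6)[OF *(2)]] has_derivative_linear by blast
  ultimately have "fst v = 0"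
    using dx_eq[OF *(1-6) _ bounded_linear_fst, where v=v] by (simp add: linear_0)
  then show "g (State i) p \<bullet> v = 0" by (simp add: g_State inner_prod_def)
qed

lemma g_Input_in_span:
  assumes p: "p \<in> V"
  shows "g (Input 0 i) p \<in> span {g (Output \<beta> j) p |\<beta> j. \<beta> < R j + 1}"
proof (rule in_span_if_orthogonal)
  fix v assume v: "\<And>t. t \<in> {g (Output \<beta> j) p |\<beta> j. \<beta> < R j + 1} \<Longrightarrow> t \<bullet> v = 0"
  obtain N and Yx Yu :: "('m, 'l) derivs set" and Fx Fu where *: "open N" "p \<in> N" "N \<subseteq> V" "open Yu" "smooth_on Yu Fu"
    "\<And>q. q \<in> N \<Longrightarrow> collect (\<lambda>j. R j + 1) (\<lambda>\<beta>. y \<beta> q) \<in> Yu"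
    "\<And>q. q \<in> N \<Longrightarrow> xu q = ((Fx :: ('m, 'l) derivs \<Rightarrow> real^'n) (collect R (\<lambda>\<beta>. y \<beta> q)),
        (Fu :: ('m, 'l) derivs \<Rightarrow> real^'m) (collect (\<lambda>j. R j + 1) (\<lambda>\<beta>. y \<beta> q)))"
    by (rule flatE[OF p]) (rule that)
  have "dy \<beta> p v $ j = 0" if "\<beta> < R j + 1" for \<beta> j
    using v[of "g (Output \<beta> j) p"] that g_Output[OF p] by auto
  then have "collect (\<lambda>j. R j + 1) (\<lambda>\<beta>. dy \<beta> p v) = (0 :: ('m, 'l) derivs)" by (rule collect_cong_zero)
  moreover have "snd q $ slot 0 = Fu (collect (\<lambda>j. R j + 1) (\<lambda>\<beta>. y \<beta> q))" if "q \<in> N" for q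
    using *(7)[OF that] by (simp add: xu_def)
  moreover have "linear (frechet_derivative Fu (at (collect (\<lambda>j. R j + 1) (\<lambda>\<beta>. y \<beta> p))))"
    using smooth_on_has_derivative[OF *(5) *(6)[OF *(2)]] has_derivative_linear by blast
  ultimately have "snd v $ slot 0 = 0"
    using dx_eq[OF *(1-6) _ bounded_linear_compose[OF bounded_linear_vec_nth bounded_linear_snd], where v=v]
    by (simp add: linear_0)
  then show "g (Input 0 i) p \<bullet> v = 0" by (simp add: g_Input inner_prod_def inner_axis')
qed

end

section \<open>Regular points and the propagation of linear dependence\<close>

context flat_system
begin

definition r :: nat where "r = Max (range R)"

definition s :: nat where "s = CARD('m) * r"

lemma R_le: "R j \<le> r"
  by (simp add: r_def)

text \<open>Some \<open>R j\<close> equals \<open>r\<close>, so \<open>CARD('l)\<close> is at least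
  \<open>(m + 2) (r + 1)\<close> and exceeds \<open>r + m r + 1\<close>. Input derivatives up to
  order \<open>s\<close> are then distinct coordinates, and the Lie derivatives taken of them are
  not cut off at the top order.\<close>

lemma s_less: "Suc (r + s) < CARD('l)"
proof -
  have "r \<in> range R" unfolding r_def by (rule Max_in) auto
  then obtain j where "r = R j" by blast
  then have "(CARD('m) + 2) * (r + 1) \<le> CARD('l)" using l_u_large[of j] by simp
  then have "r * CARD('m) + CARD('m) + 2 * r + 2 \<le> CARD('l)" by (simp add: algebra_simps)
  moreover have "CARD('m) > 0" by simp
  ultimately show ?thesis unfolding s_def by (simp add: algebra_simps)
qed

text \<open>The orders are those of the dimension count: inputs up to \<open>s\<close>, and the
  outputs up to \<open>r + s\<close> that generate them. Finiteness is what gives density of the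
  points of constant rank.\<close>

definition coords :: "('n, 'm) jet_coord set" where
  "coords = range State \<union> (\<lambda>(\<alpha>, j). Input \<alpha> j) ` ({..s} \<times> UNIV)
    \<union> (\<lambda>(\<beta>, j). Output \<beta> j) ` ({..r + s} \<times> UNIV)"

lemma finite_coords: "finite coords"
  by (simp add: coords_def)

lemma State_in_coords: "State i \<in> coords"
  by (simp add: coords_def)

lemma Input_in_coords: "\<alpha> \<le> s \<Longrightarrow> Input \<alpha> j \<in> coords"
  by (auto simp: coords_def)

lemma Output_in_coords: "\<beta> \<le> r + s \<Longrightarrow> Output \<beta> j \<in> coords"
  by (auto simp: coords_def)

abbreviation dX :: "('n, 'm, 'l) jet \<Rightarrow> ('n, 'm, 'l) jet set" where
  "dX p \<equiv> (\<lambda>c. g c p) ` range State"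

abbreviation dU :: "('n, 'm, 'l) jet \<Rightarrow> nat \<Rightarrow> 'm \<Rightarrow> ('n, 'm, 'l) jet" where
  "dU p \<alpha> j \<equiv> g (Input \<alpha> j) p"

abbreviation dY :: "('n, 'm, 'l) jet \<Rightarrow> nat \<Rightarrow> 'm \<Rightarrow> ('n, 'm, 'l) jet" where
  "dY p \<beta> j \<equiv> g (Output \<beta> j) p"

definition regular :: "('n, 'm, 'l) jet \<Rightarrow> bool" where
  "regular p \<longleftrightarrow> p \<in> V \<and>
    (\<forall>\<^sub>F q in nhds p. \<forall>K\<subseteq>coords. dim ((\<lambda>c. g c q) ` K) = dim ((\<lambda>c. g c p) ` K))"

lemma gL_in_span:
  assumes "regular p" and "c \<in> coords" and "H \<subseteq> coords" and "g c p \<in> span ((\<lambda>c. g c p) ` H)"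
  shows "gL c p \<in> span ((\<lambda>c. g c p) ` H \<union> (\<lambda>c. gL c p) ` H)"
  unfolding g_def gL_def
proof (rule gradient_lie_derivative_in_span[OF open_V _ smooth_X smooth_coord_fun])
  show "p \<in> V" using assms(1) by (simp add: regular_def)
  show "finite H" using assms(3) finite_coords finite_subset by blast
  show "gradient (coord_fun f \<phi> c) p \<in> span ((\<lambda>i. gradient (coord_fun f \<phi> i) p) ` H)"
    using assms(4) by (simp add: g_def)
  fix K assume K: "K \<subseteq> insert c H"
  have "\<forall>\<^sub>F q in nhds p. \<forall>K\<subseteq>coords. dim ((\<lambda>c. g c q) ` K) = dim ((\<lambda>c. g c p) ` K)"
    using assms(1) by (simp add: regular_def)
  then have "\<forall>\<^sub>F q in nhds p. dim ((\<lambda>c. g c q) ` K) = dim ((\<lambda>c. g c p) ` K)"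
    by (rule eventually_mono) (use K assms(2,3) in blast)
  then show "\<forall>\<^sub>F q in nhds p. dim ((\<lambda>i. gradient (coord_fun f \<phi> i) q) ` K)
      = dim ((\<lambda>i. gradient (coord_fun f \<phi> i) p) ` K)"
    by (simp add: g_def)
qed

definition Outputs :: "nat \<Rightarrow> 'm set \<Rightarrow> ('n, 'm) jet_coord set" where
  "Outputs \<beta> J = (\<lambda>(\<gamma>, j). Output \<gamma> j) ` ({..<\<beta>} \<times> UNIV) \<union> Output \<beta> ` J"

lemma g_Outputs: "(\<lambda>c. g c p) ` Outputs \<beta> J = lower (dY p) \<beta> \<union> dY p \<beta> ` J"
  unfolding Outputs_def lower_eq_image image_Un image_image by (simp add: case_prod_unfold)

lemma Outputs_in_coords: "\<beta> \<le> r + s \<Longrightarrow> Outputs \<beta> J \<subseteq> coords"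
  by (auto simp: Outputs_def intro!: Output_in_coords)

lemma gL_Outputs:
  assumes "p \<in> V"
  shows "(\<lambda>c. gL c p) ` Outputs \<beta> J \<subseteq> lower (dY p) (Suc \<beta>) \<union> dY p (Suc \<beta>) ` J"
proof
  fix x assume "x \<in> (\<lambda>c. gL c p) ` Outputs \<beta> J"
  then consider \<gamma> j where "\<gamma> < \<beta>" "x = dY p (Suc \<gamma>) j" | j where "j \<in> J" "x = dY p (Suc \<beta>) j"
    unfolding Outputs_def using gL_Output[OF assms] by fastforce
  then show "x \<in> lower (dY p) (Suc \<beta>) \<union> dY p (Suc \<beta>) ` J"
  proof cases
    case 1
    then have "Suc \<gamma> < Suc \<beta>" by simp
    then show ?thesis using 1 unfolding Un_iff in_lower_iff by blast
  qed auto
qed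

lemma step_Y:
  assumes "regular p" and "\<beta> \<le> r + s" and "dY p \<beta> j \<in> span (lower (dY p) \<beta> \<union> dY p \<beta> ` J)"
  shows "dY p (Suc \<beta>) j \<in> span (lower (dY p) (Suc \<beta>) \<union> dY p (Suc \<beta>) ` J)"
proof -
  have p: "p \<in> V" using assms(1) by (simp add: regular_def)
  have "gL (Output \<beta> j) p \<in> span ((\<lambda>c. g c p) ` Outputs \<beta> J \<union> (\<lambda>c. gL c p) ` Outputs \<beta> J)"
    using assms by (intro gL_in_span Output_in_coords Outputs_in_coords) (auto simp: g_Outputs)
  moreover have "(\<lambda>c. g c p) ` Outputs \<beta> J \<union> (\<lambda>c. gL c p) ` Outputs \<beta> J
      \<subseteq> lower (dY p) (Suc \<beta>) \<union> dY p (Suc \<beta>) ` J"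
    using gL_Outputs[OF p, of \<beta> J] unfolding g_Outputs lower_Suc by auto
  ultimately show ?thesis unfolding gL_Output[OF p] using span_mono by blast
qed

text \<open>Differentiating a relation also differentiates the state differentials in it, and those
  of the components of \<open>f\<close> involve the input. Hence \<open>dU p 0\<close> joins the
  right-hand side.\<close>

lemma step_XU:
  assumes "regular p" and "\<beta> \<le> r + s"
    and "dY p \<beta> j \<in> span (dX p \<union> lower (dY p) \<beta> \<union> dY p \<beta> ` J)"
  shows "dY p (Suc \<beta>) j \<in> span (dX p \<union> range (dU p 0) \<union> lower (dY p) (Suc \<beta>) \<union> dY p (Suc \<beta>) ` J)"
    (is "_ \<in> span ?T")
proof -
  have p: "p \<in> V" using assms(1) by (simp add: regular_def)
  let ?H = "range State \<union> Outputs \<beta> J"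
  have "gL (Output \<beta> j) p \<in> span ((\<lambda>c. g c p) ` ?H \<union> (\<lambda>c. gL c p) ` ?H)"
  proof (rule gL_in_span[OF assms(1) Output_in_coords[OF assms(2)]])
    show "?H \<subseteq> coords" using State_in_coords Outputs_in_coords[OF assms(2)] by blast
    show "dY p \<beta> j \<in> span ((\<lambda>c. g c p) ` ?H)"
      using assms(3) unfolding image_Un g_Outputs by (simp add: Un_assoc)
  qed
  moreover have "(\<lambda>c. g c p) ` ?H \<union> (\<lambda>c. gL c p) ` ?H \<subseteq> span ?T"
  proof -
    have "gL (State i) p \<in> span ?T" for i
    proof -
      have "range (\<lambda>i. g (State i) p) \<union> range (\<lambda>j. g (Input 0 j) p) \<subseteq> ?T" by auto
      then show ?thesis using gL_State[OF p, of i] span_mono by blast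
    qed
    moreover have "(\<lambda>c. g c p) ` ?H \<union> (\<lambda>c. gL c p) ` Outputs \<beta> J \<subseteq> ?T"
      using gL_Outputs[OF p, of \<beta> J] unfolding image_Un g_Outputs lower_Suc by blast
    ultimately show ?thesis using span_superset[of ?T] by blast
  qed
  ultimately show ?thesis unfolding gL_Output[OF p] using span_minimal[OF _ subspace_span] by blast
qed

text \<open>At order 0 this is the differential of \<open>u = Fu\<close>. Each Lie derivative then
  raises the order of the input and the orders of the generating outputs by one.\<close>

lemma dU_in_span:
  assumes "regular p" and "\<alpha> \<le> s"
  shows "dU p \<alpha> j \<in> span (lower (dY p) (Suc (r + \<alpha>)))"
  using assms(2)
proof (induction \<alpha> arbitrary: j)
  case 0
  have p: "p \<in> V" using assms(1) by (simp add: regular_def)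
  have "{g (Output \<beta> j) p |\<beta> j. \<beta> < R j + 1} \<subseteq> lower (dY p) (Suc r)"
  proof
    fix x assume "x \<in> {g (Output \<beta> j) p |\<beta> j. \<beta> < R j + 1}"
    then obtain \<beta> j where \<beta>: "\<beta> < R j + 1" and x: "x = dY p \<beta> j" by blast
    have "\<beta> < Suc r" using \<beta> R_le[of j] by simp
    then show "x \<in> lower (dY p) (Suc r)" unfolding in_lower_iff x by blast
  qed
  then show ?case using g_Input_in_span[OF p, of j] span_mono by auto
next
  case (Suc \<alpha>)
  have p: "p \<in> V" using assms(1) by (simp add: regular_def)
  let ?H = "Outputs (r + \<alpha>) UNIV"
  have H: "(\<lambda>c. g c p) ` ?H = lower (dY p) (Suc (r + \<alpha>))" by (simp add: g_Outputs lower_Suc)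
  have "gL (Input \<alpha> j) p \<in> span ((\<lambda>c. g c p) ` ?H \<union> (\<lambda>c. gL c p) ` ?H)"
    using Suc.prems Suc.IH[of j]
    by (intro gL_in_span assms(1) Input_in_coords Outputs_in_coords) (simp_all add: H)
  moreover have sub: "(\<lambda>c. g c p) ` ?H \<union> (\<lambda>c. gL c p) ` ?H \<subseteq> lower (dY p) (Suc (r + Suc \<alpha>))"
    using gL_Outputs[OF p, of "r + \<alpha>" UNIV] unfolding H by (auto simp: lower_Suc)
  moreover have "gL (Input \<alpha> j) p = dU p (Suc \<alpha>) j"
    using gL_Input[OF p] Suc.prems s_less by simp
  ultimately show ?case using span_mono[OF sub] by auto
qed

section \<open>Dimensions of the state and input codistributions\<close>

lemma dim_coordinates:
  assumes "finite I" and "inj_on w I" and "w ` I \<subseteq> Basis"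
  shows "dim (w ` I) = card I"
proof -
  have "independent (w ` I)" using assms(3) independent_Basis independent_mono by blast
  then show ?thesis using assms(2) by (simp add: dim_eq_card_independent card_image)
qed

lemma dX_Basis: "g (State i) p \<in> Basis"
  by (simp add: g_State Basis_prod_def)

lemma dU_Basis: "dU p \<alpha> j \<in> Basis"
  by (simp add: g_Input Basis_prod_def axis_in_Basis_iff)

lemma dU_inj: "\<alpha> \<le> s \<Longrightarrow> \<beta> \<le> s \<Longrightarrow> dU p \<alpha> i = dU p \<beta> j \<longleftrightarrow> \<alpha> = \<beta> \<and> i = j"
  using s_less slot_eq_iff[of \<alpha> \<beta>] by (auto simp: g_Input axis_eq_axis)

lemma dim_dX: "dim (dX p) = CARD('n)"
  unfolding image_image using dX_Basis
  by (subst dim_coordinates) (auto simp: inj_def g_State axis_eq_axis)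

lemma dim_dXU: "dim (dX p \<union> range (dU p 0)) = CARD('n) + CARD('m)"
proof -
  have eq: "dX p \<union> range (dU p 0) = (\<lambda>c. g c p) ` (range State \<union> range (Input 0))"
    by (simp add: image_Un image_image)
  have inj: "inj_on (\<lambda>c. g c p) (range State \<union> range (Input 0))"
    unfolding inj_on_def by (auto simp: g_State g_Input axis_eq_axis)
  have "card (range State \<union> range (Input 0) :: ('n, 'm) jet_coord set) = CARD('n) + CARD('m)"
  proof (subst card_Un_disjoint)
    show "card (range State :: ('n, 'm) jet_coord set) + card (range (Input 0 :: _ \<Rightarrow> ('n, 'm) jet_coord))
        = CARD('n) + CARD('m)"
      by (simp add: card_image inj_def)
  qed auto
  then show ?thesis unfolding eq
    by (subst dim_coordinates[OF _ inj]) (auto simp: dX_Basis dU_Basis)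
qed

lemma dim_lower_dU: "dim (lower (dU p) (Suc s)) = CARD('m) * Suc s"
proof -
  have "inj_on (\<lambda>(\<alpha>, j). dU p \<alpha> j) ({..<Suc s} \<times> UNIV)"
    unfolding inj_on_def by (auto simp: dU_inj)
  then show ?thesis unfolding lower_eq_image
    by (subst dim_coordinates) (auto simp: dU_Basis mult.commute)
qed

definition independent_outputs :: "('n, 'm, 'l) jet \<Rightarrow> bool" where
  "independent_outputs p \<longleftrightarrow> dim (lower (dY p) (Suc r)) = CARD('m) * Suc r"

definition triangular :: "('m \<Rightarrow> nat) \<Rightarrow> ('n, 'm, 'l) jet \<Rightarrow> bool" where
  "triangular \<kappa> p \<longleftrightarrow>
    (\<forall>j \<beta>. \<beta> < \<kappa> j \<longrightarrow> dY p \<beta> j \<in> span (dX p \<union> lower (dY p) \<beta> \<union> dY p \<beta> ` {i. \<kappa> i \<le> \<beta>}))"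

lemma exists_triangular:
  assumes "regular p"
  obtains \<kappa> where "\<kappa> \<le> R" and "(\<Sum>j\<in>UNIV. \<kappa> j) = CARD('n)" and "triangular \<kappa> p"
    and "independent_outputs p"
proof -
  have p: "p \<in> V" using assms by (simp add: regular_def)
  have Y: "dim (lower (dY p) \<beta>) = CARD('m) * \<beta>" if "\<beta> \<le> Suc r" for \<beta>
    by (rule flat_output_independent[of r "dY p" "dU p"])
      (use that assms dim_lower_dU[of p] in
        \<open>auto simp: s_def[symmetric] intro!: step_Y dU_in_span intro: less_imp_le\<close>)
  have U: "range (dU p 0) \<subseteq> span (lower (dY p) (Suc r))" using dU_in_span[OF assms, of 0] by auto
  have X: "dX p \<subseteq> span {dY p \<gamma> j |\<gamma> j. \<gamma> < R j}" using g_State_in_span[OF p] by auto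
  have Y0: "dY p 0 j \<in> span (dX p \<union> range (dU p 0))" for j
  proof -
    have "smooth_on S (\<lambda>z. \<phi> z $ j)"
      by (rule smooth_on_linear_comp[OF open_S bounded_linear_vec_nth smooth_\<phi>])
    from gradient_xu_comp_in_span[OF p this] show ?thesis
      by (simp add: g_def y_0 o_def image_image)
  qed
  have step: "dY p (Suc \<beta>) j \<in>
      span (dX p \<union> range (dU p 0) \<union> lower (dY p) (Suc \<beta>) \<union> dY p (Suc \<beta>) ` J)"
    if "\<beta> < r" "dY p \<beta> j \<in> span (dX p \<union> lower (dY p) \<beta> \<union> dY p \<beta> ` J)" for \<beta> J j
    using step_XU[OF assms _ that(2)] that(1) by simp
  show thesis
  proof (rule exists_triangular_multi_index[OF Y step Y0 dim_dX dim_dXU R_le X U])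
    fix \<kappa> assume "\<kappa> \<le> R" "(\<Sum>j\<in>UNIV. \<kappa> j) = CARD('n)"
      "\<And>j \<beta>. \<beta> < \<kappa> j \<Longrightarrow> dY p \<beta> j \<in> span (dX p \<union> lower (dY p) \<beta> \<union> dY p \<beta> ` {i. \<kappa> i \<le> \<beta>})"
    then show thesis
      using that Y[of "Suc r"] by (simp add: triangular_def independent_outputs_def)
  qed
qed

text \<open>Membership in a span is the equality of two ranks of subfamilies of
  \<open>coords\<close>, so constant ranks carry it from \<open>p\<close> to \<open>q\<close>, and
  one \<open>\<kappa>\<close> serves a whole neighbourhood.\<close>

lemma triangular_transfer:
  assumes "\<forall>K\<subseteq>coords. dim ((\<lambda>c. g c q) ` K) = dim ((\<lambda>c. g c p) ` K)"
    and "\<kappa> \<le> R" and "triangular \<kappa> p"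
  shows "triangular \<kappa> q"
  unfolding triangular_def
proof (intro allI impI)
  fix j \<beta> assume \<beta>: "\<beta> < \<kappa> j"
  then have "\<beta> \<le> r + s" using le_funD[OF assms(2), of j] R_le[of j] by linarith
  let ?H = "range State \<union> Outputs \<beta> {i. \<kappa> i \<le> \<beta>}"
  have im: "(\<lambda>c. g c q) ` ?H = dX q \<union> lower (dY q) \<beta> \<union> dY q \<beta> ` {i. \<kappa> i \<le> \<beta>}" for q
    unfolding image_Un g_Outputs by (simp add: Un_assoc)
  have H: "?H \<subseteq> coords" "insert (Output \<beta> j) ?H \<subseteq> coords"
    using State_in_coords Outputs_in_coords Output_in_coords \<open>\<beta> \<le> r + s\<close> by blast+
  have "dY p \<beta> j \<in> span ((\<lambda>c. g c p) ` ?H)"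
    using assms(3) \<beta> unfolding triangular_def im by blast
  then have "dim ((\<lambda>c. g c p) ` insert (Output \<beta> j) ?H) = dim ((\<lambda>c. g c p) ` ?H)"
    by (simp only: image_insert dim_insert if_True)
  then have "dim ((\<lambda>c. g c q) ` insert (Output \<beta> j) ?H) = dim ((\<lambda>c. g c q) ` ?H)"
    using assms(1) H by metis
  then have "dY q \<beta> j \<in> span ((\<lambda>c. g c q) ` ?H)"
    unfolding image_insert dim_insert by (auto split: if_splits)
  then show "dY q \<beta> j \<in> span (dX q \<union> lower (dY q) \<beta> \<union> dY q \<beta> ` {i. \<kappa> i \<le> \<beta>})"
    unfolding im .
qed

lemma dense_triangular:
  obtains D where "open D" and "D \<subseteq> V" and "V \<subseteq> closure D"
    and "\<And>p. p \<in> D \<Longrightarrow> \<exists>N \<kappa>. open N \<and> p \<in> N \<and> N \<subseteq> D \<and> \<kappa> \<le> R \<and> (\<Sum>j\<in>UNIV. \<kappa> j) = CARD('n) \<and>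
      (\<forall>q\<in>N. triangular \<kappa> q \<and> independent_outputs q)"
proof -
  have lim: "((\<lambda>q. g c q) \<longlongrightarrow> g c p) (nhds p)" if "p \<in> V" for c p
    using gradient_tendsto[OF open_V that smooth_coord_fun] by (simp add: g_def)
  obtain D where D: "open D" "D \<subseteq> V" "V \<subseteq> closure D"
    and N: "\<And>p. p \<in> D \<Longrightarrow> \<exists>N. open N \<and> p \<in> N \<and> N \<subseteq> D \<and>
      (\<forall>q\<in>N. \<forall>K\<subseteq>coords. dim ((\<lambda>c. g c q) ` K) = dim ((\<lambda>c. g c p) ` K))"
    by (rule dense_constant_dim[OF open_V finite_coords, of "\<lambda>q c. g c q"]) (erule lim, rule that)
  have reg: "regular p" if p: "p \<in> D" for p
  proof -
    obtain N where "open N" "p \<in> N"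
      "\<forall>q\<in>N. \<forall>K\<subseteq>coords. dim ((\<lambda>c. g c q) ` K) = dim ((\<lambda>c. g c p) ` K)"
      using N[OF p] by blast
    then show ?thesis unfolding regular_def eventually_nhds using D(2) p by blast
  qed
  have "\<exists>N \<kappa>. open N \<and> p \<in> N \<and> N \<subseteq> D \<and> \<kappa> \<le> R \<and> (\<Sum>j\<in>UNIV. \<kappa> j) = CARD('n) \<and>
      (\<forall>q\<in>N. triangular \<kappa> q \<and> independent_outputs q)" if p: "p \<in> D" for p
  proof -
    obtain N where N: "open N" "p \<in> N" "N \<subseteq> D"
      "\<forall>q\<in>N. \<forall>K\<subseteq>coords. dim ((\<lambda>c. g c q) ` K) = dim ((\<lambda>c. g c p) ` K)"
      using N[OF p] by (elim exE conjE)
    obtain \<kappa> where \<kappa>: "\<kappa> \<le> R" "(\<Sum>j\<in>UNIV. \<kappa> j) = CARD('n)" "triangular \<kappa> p"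
      by (rule exists_triangular[OF reg[OF p]]) (rule that)
    have "triangular \<kappa> q \<and> independent_outputs q" if "q \<in> N" for q
    proof
      show "triangular \<kappa> q" by (rule triangular_transfer[OF bspec[OF N(4) that] \<kappa>(1,3)])
      have "q \<in> D" using that N(3) by blast
      then show "independent_outputs q" by (rule exists_triangular[OF reg])
    qed
    with N(1-3) \<kappa>(1,2) show ?thesis by (intro exI conjI ballI) auto
  qed
  with D show thesis by (rule that)
qed

end

section \<open>The tracking error recurrence\<close>

text \<open>The derivatives that a linear equation of order \<open>k\<close> with coefficients
  \<open>a\<close> determines from the first \<open>k\<close> values \<open>c\<close>, by
  differentiating the equation \<open>\<beta> - k\<close> times. For \<open>k = 0\<close> the empty
  sum makes the sequence vanish, as for an error that is identically zero.\<close>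

function lin_rec :: "nat \<Rightarrow> (nat \<Rightarrow> real) \<Rightarrow> (nat \<Rightarrow> real) \<Rightarrow> nat \<Rightarrow> real" where
  "lin_rec k a c \<beta> = (if \<beta> < k then c \<beta> else - (\<Sum>i<k. a i * lin_rec k a c (\<beta> - k + i)))"
  by auto
termination
  by (relation "Wellfounded.measure (\<lambda>(k, a, c, \<beta>). \<beta>)") auto

declare lin_rec.simps [simp del]

lemma lin_rec_less: "\<beta> < k \<Longrightarrow> lin_rec k a c \<beta> = c \<beta>"
  by (simp add: lin_rec.simps)

lemma lin_rec_add: "lin_rec k a c (k + \<beta>) = - (\<Sum>i<k. a i * lin_rec k a c (\<beta> + i))"
  by (subst lin_rec.simps) simp

lemma lin_rec_unique:
  assumes "\<And>\<beta>. h (k + \<beta>) = - (\<Sum>i<k. a i * h (\<beta> + i))" and "\<And>\<beta>. \<beta> < k \<Longrightarrow> c \<beta> = h \<beta>"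
  shows "lin_rec k a c \<beta> = h \<beta>"
proof (induction \<beta> rule: less_induct)
  case (less \<beta>)
  show ?case
  proof (cases "\<beta> < k")
    case True
    then show ?thesis by (simp add: lin_rec_less assms(2))
  next
    case False
    then obtain \<gamma> where \<gamma>: "\<beta> = k + \<gamma>" using le_Suc_ex not_less by blast
    have "(\<Sum>i<k. a i * lin_rec k a c (\<gamma> + i)) = (\<Sum>i<k. a i * h (\<gamma> + i))"
      by (rule sum.cong) (auto simp: less \<gamma>)
    then show ?thesis unfolding \<gamma> lin_rec_add assms(1) by simp
  qed
qed

lemma lin_rec_linear:
  "lin_rec k a (\<lambda>i. s * c i + d i) \<beta> = s * lin_rec k a c \<beta> + lin_rec k a d \<beta>"
proof (rule lin_rec_unique)
  show "s * lin_rec k a c (k + \<gamma>) + lin_rec k a d (k + \<gamma>) =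
      - (\<Sum>i<k. a i * (s * lin_rec k a c (\<gamma> + i) + lin_rec k a d (\<gamma> + i)))" for \<gamma>
    unfolding lin_rec_add by (simp add: sum.distrib sum_distrib_left distrib_left mult.left_commute)
qed (simp add: lin_rec_less)

text \<open>Iterating \<open>deriv\<close> does not by itself show differentiability. The iterates
  are identified with the known family \<open>h\<close> one order at a time on the open set, which
  yields both.\<close>

lemma deriv_chain:
  fixes h :: "nat \<Rightarrow> real \<Rightarrow> real"
  assumes "open I" and e: "\<And>t. t \<in> I \<Longrightarrow> e t = h 0 t"
    and h: "\<And>\<beta> t. \<beta> < k \<Longrightarrow> t \<in> I \<Longrightarrow> (h \<beta> has_real_derivative h (Suc \<beta>) t) (at t)"
  shows "\<beta> \<le> k \<Longrightarrow> t \<in> I \<Longrightarrow> (deriv ^^ \<beta>) e t = h \<beta> t" and "times_differentiable_on k I e"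
proof -
  have D: "((deriv ^^ \<beta>) e has_real_derivative h (Suc \<beta>) t) (at t)"
    if "\<beta> < k" "\<And>t. t \<in> I \<Longrightarrow> (deriv ^^ \<beta>) e t = h \<beta> t" "t \<in> I" for \<beta> t
    by (rule has_field_derivative_transform_within_open[OF h[OF that(1,3)] assms(1) that(3)])
      (simp add: that(2))
  have eq: "(deriv ^^ \<beta>) e t = h \<beta> t" if "\<beta> \<le> k" "t \<in> I" for \<beta> t
    using that
  proof (induction \<beta> arbitrary: t)
    case 0
    then show ?case by (simp add: e)
  next
    case (Suc \<beta>)
    then show ?case using DERIV_imp_deriv[OF D[of \<beta> t]] by simp
  qed
  then show "\<beta> \<le> k \<Longrightarrow> t \<in> I \<Longrightarrow> (deriv ^^ \<beta>) e t = h \<beta> t" .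
  show "times_differentiable_on k I e"
    unfolding times_differentiable_on_def
    using D eq by (metis less_imp_le real_differentiable_def)
qed

text \<open>Projection onto the orders below \<open>B\<close>. Jets built by
  \<open>collect B\<close> are fixed by it, so \<open>trunc B Y = Y\<close> describes the entries
  that such a jet may have.\<close>

definition trunc :: "('m::finite \<Rightarrow> nat) \<Rightarrow> ('m, 'l::{finite,linorder}) derivs \<Rightarrow> ('m, 'l) derivs" where
  "trunc B Y = (\<chi> k j. if ord_of k < B j then Y $ k $ j else 0)"

lemma trunc_nth: "trunc B Y $ k $ j = (if ord_of k < B j then Y $ k $ j else 0)"
  by (simp add: trunc_def)

lemma bounded_linear_trunc: "bounded_linear (trunc B)"
  unfolding linear_conv_bounded_linear[symmetric]
  by (rule linearI) (auto simp: vec_eq_iff trunc_nth)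

lemma trunc_add: "trunc B (Y + Z) = trunc B Y + trunc B Z"
  by (auto simp: vec_eq_iff trunc_nth)

lemma trunc_diff: "trunc B (Y - Z) = trunc B Y - trunc B Z"
  by (auto simp: vec_eq_iff trunc_nth)

lemma trunc_trunc: "B \<le> C \<Longrightarrow> trunc B (trunc C Y) = trunc B Y"
  by (auto simp: vec_eq_iff trunc_nth le_fun_def dest: order_less_le_trans)

lemma trunc_collect: "B \<le> C \<Longrightarrow> trunc B (collect C h) = collect B h"
  by (auto simp: vec_eq_iff trunc_nth collect_nth le_fun_def dest: order_less_le_trans)

section \<open>The tracking law at a point\<close>

text \<open>\<open>idx\<close> arranges the unknown errors of orders below \<open>\<kappa> j\<close>
  as a vector with as many entries as the state, so that the equation for them is between spaces of
  equal dimension. \<open>Fx\<close> and \<open>Fu\<close> are one local choice of the flat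
  parametrisation around \<open>p0\<close>.\<close>

locale tracking_point = flat_system S f \<phi> V R
  for S :: "((real^'n::finite) \<times> (real^'m::finite)) set"
    and f :: "(real^'n) \<times> (real^'m) \<Rightarrow> real^'n"
    and \<phi> :: "(real^'n) \<times> (real^'m) \<Rightarrow> real^'m"
    and V :: "('n, 'm, 'l::{finite,linorder}) jet set"
    and R :: "'m \<Rightarrow> nat" +
  fixes \<kappa> :: "'m \<Rightarrow> nat" and a :: "'m \<Rightarrow> nat \<Rightarrow> real" and idx :: "'m \<times> nat \<Rightarrow> 'n"
    and p0 :: "('n, 'm, 'l) jet" and N :: "('n, 'm, 'l) jet set"
    and Yx Yu :: "('m, 'l) derivs set"
    and Fx :: "('m, 'l) derivs \<Rightarrow> real^'n" and Fu :: "('m, 'l) derivs \<Rightarrow> real^'m"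
  assumes \<kappa>_le_R: "\<kappa> \<le> R" and idx: "bij_betw idx (SIGMA j:UNIV. {..<\<kappa> j}) UNIV"
    and triangular_p0: "triangular \<kappa> p0" and independent_p0: "independent_outputs p0"
    and open_N: "open N" and p0_N: "p0 \<in> N" and N_V: "N \<subseteq> V"
    and open_Yx: "open Yx" and smooth_Fx: "smooth_on Yx Fx"
    and open_Yu: "open Yu" and smooth_Fu: "smooth_on Yu Fu"
    and in_Yx: "\<And>q. q \<in> N \<Longrightarrow> collect R (\<lambda>\<beta>. y \<beta> q) \<in> Yx"
    and in_Yu: "\<And>q. q \<in> N \<Longrightarrow> collect (\<lambda>j. R j + 1) (\<lambda>\<beta>. y \<beta> q) \<in> Yu"
    and xu_eq: "\<And>q. q \<in> N \<Longrightarrow>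
      xu q = (Fx (collect R (\<lambda>\<beta>. y \<beta> q)), Fu (collect (\<lambda>j. R j + 1) (\<lambda>\<beta>. y \<beta> q)))"
begin

abbreviation R1 :: "'m \<Rightarrow> nat" where "R1 \<equiv> \<lambda>j. R j + 1"

definition yx :: "('n, 'm, 'l) jet \<Rightarrow> ('m, 'l) derivs" where "yx q = collect R (\<lambda>\<beta>. y \<beta> q)"

definition yu :: "('n, 'm, 'l) jet \<Rightarrow> ('m, 'l) derivs" where "yu q = collect R1 (\<lambda>\<beta>. y \<beta> q)"

lemma R_le_R1: "R \<le> R1"
  by (simp add: le_fun_def)

lemma trunc_yu: "trunc R (yu q) = yx q" "trunc R1 (yu q) = yu q"
  unfolding yu_def yx_def by (rule trunc_collect, rule R_le_R1, rule trunc_collect, simp)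

lemma p0_V: "p0 \<in> V"
  using p0_N N_V by blast

lemma order_less: "\<beta> < R1 j \<Longrightarrow> \<beta> < CARD('l)"
  using R_le[of j] s_less by simp

lemma DFx: "Y \<in> Yx \<Longrightarrow> (Fx has_derivative frechet_derivative Fx (at Y)) (at Y)"
  by (rule smooth_on_has_derivative[OF smooth_Fx])

text \<open>\<open>E \<epsilon> j \<beta>\<close> is the \<open>\<beta>\<close>-th derivative of the error \<open>e\<^sup>j\<close> which the error dynamics prescribes, where
  \<open>\<epsilon>\<close> collects the derivatives of order less than \<open>\<kappa> j\<close>.\<close>

definition E :: "real^'n \<Rightarrow> 'm \<Rightarrow> nat \<Rightarrow> real" where
  "E \<epsilon> j = lin_rec (\<kappa> j) (a j) (\<lambda>i. \<epsilon> $ idx (j, i))"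

definition A :: "real^'n \<Rightarrow> ('m, 'l) derivs" where
  "A \<epsilon> = (\<chi> k j. E \<epsilon> j (ord_of k))"

lemma E_less: "\<beta> < \<kappa> j \<Longrightarrow> E \<epsilon> j \<beta> = \<epsilon> $ idx (j, \<beta>)"
  by (simp add: E_def lin_rec_less)

lemma E_add: "E \<epsilon> j (\<kappa> j + \<beta>) = - (\<Sum>i<\<kappa> j. a j i * E \<epsilon> j (\<beta> + i))"
  unfolding E_def by (rule lin_rec_add)

lemma E_linear: "E (c *\<^sub>R \<epsilon> + \<eta>) j \<beta> = c * E \<epsilon> j \<beta> + E \<eta> j \<beta>"
  unfolding E_def by (simp add: lin_rec_linear)

lemma bounded_linear_A: "bounded_linear A"
  unfolding linear_conv_bounded_linear[symmetric]
proof (rule linearI)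
  show "A (\<epsilon> + \<eta>) = A \<epsilon> + A \<eta>" for \<epsilon> \<eta>
    using E_linear[of 1 \<epsilon> \<eta>] by (simp add: vec_eq_iff A_def)
  have "E 0 j \<beta> = 0" for j \<beta> using E_linear[of 1 0 0 j \<beta>] by simp
  then show "A (c *\<^sub>R \<epsilon>) = c *\<^sub>R A \<epsilon>" for c \<epsilon>
    using E_linear[of c \<epsilon> 0] by (simp add: vec_eq_iff A_def)
qed

lemma A_0: "A 0 = 0"
  using bounded_linear_A by (simp add: linear_0 linear_conv_bounded_linear)

lemma vec_eq_0_if_components:
  assumes "\<And>j i. i < \<kappa> j \<Longrightarrow> v $ idx (j, i) = 0"
  shows "v = 0"
proof -
  have "v $ k = 0" for k
  proof -
    obtain j i where "i < \<kappa> j" "k = idx (j, i)"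
      using idx unfolding bij_betw_def by (metis (no_types, lifting) SigmaE UNIV_I imageE lessThan_iff)
    then show ?thesis using assms by simp
  qed
  then show ?thesis by (simp add: vec_eq_iff)
qed

text \<open>Independent differentials take arbitrary prescribed values on a suitable tangent vector.
  This serves both the injectivity at \<open>p0\<close> and the surjectivity behind the openness of
  attained jets.\<close>

lemma prescribe_dy:
  obtains \<delta> where "\<And>\<beta> j. \<beta> \<le> r \<Longrightarrow> dy \<beta> p0 \<delta> $ j = c \<beta> j"
proof -
  let ?I = "{..<Suc r} \<times> (UNIV :: 'm set)" and ?w = "\<lambda>(\<beta>, j). dY p0 \<beta> j"
  have dim: "dim (?w ` ?I) = card ?I"
    using independent_p0 unfolding independent_outputs_def lower_eq_image by (simp add: mult.commute)
  have fin: "finite ?I" by simp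
  show thesis
  proof (rule dual_vector[OF fin dim])
    fix \<delta> assume \<delta>: "\<And>i. i \<in> ?I \<Longrightarrow> ?w i \<bullet> \<delta> = (\<lambda>(\<beta>, j). c \<beta> j) i"
    have "dy \<beta> p0 \<delta> $ j = c \<beta> j" if "\<beta> \<le> r" for \<beta> j
      using \<delta>[of "(\<beta>, j)"] that g_Output[OF p0_V] by simp
    then show thesis by (rule that)
  qed
qed

lemma fst_eq_DFx:
  assumes "q \<in> N"
  shows "fst v = frechet_derivative Fx (at (yx q)) (collect R (\<lambda>\<beta>. dy \<beta> q v))"
  unfolding yx_def
  by (rule dx_eq[OF open_N assms N_V open_Yx smooth_Fx in_Yx _ bounded_linear_fst])
    (use xu_eq in \<open>auto simp: xu_def\<close>)

text \<open>This is the reason for the triangular choice of \<open>\<kappa>\<close>: an infinitesimal error with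
  \<open>dx = 0\<close> vanishes order by order, since at each order the components below \<open>\<kappa>\<close> depend on those from
  \<open>\<kappa>\<close> on, and the error dynamics gives the latter in terms of lower orders.\<close>

lemma DFx_A_injective_p0:
  assumes "frechet_derivative Fx (at (yx p0)) (trunc R (A v)) = 0"
  shows "v = 0"
proof -
  \<comment> \<open>The error jet is realised as the output variation of a tangent vector at
    \<open>p0\<close>. The hypothesis then says that \<open>\<delta>\<close> does not move the
    state, and the relations in \<open>triangular\<close> can be evaluated on
    \<open>\<delta>\<close>.\<close>
  obtain \<delta> where \<delta>: "\<And>\<beta> j. \<beta> \<le> r \<Longrightarrow> dy \<beta> p0 \<delta> $ j = E v j \<beta>"
    using prescribe_dy[of "\<lambda>\<beta> j. E v j \<beta>"] by blast
  have "collect R (\<lambda>\<beta>. dy \<beta> p0 \<delta>) = trunc R (A v)"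
    unfolding vec_eq_iff collect_nth trunc_nth
  proof (intro allI)
    fix k :: 'l and j
    show "(if ord_of k < R j then dy (ord_of k) p0 \<delta> $ j else 0) = (if ord_of k < R j then A v $ k $ j else 0)"
      using R_le[of j] \<delta>[of "ord_of k" j] by (simp add: A_def)
  qed
  then have "fst \<delta> = 0" using fst_eq_DFx[OF p0_N, of \<delta>] assms by simp
  then have dX: "t \<bullet> \<delta> = 0" if "t \<in> dX p0" for t
    using that by (auto simp: g_State inner_prod_def)
  have E0: "E v j \<beta> = 0" if "\<beta> \<le> r" for \<beta> j
    using that
  proof (induction \<beta> arbitrary: j rule: less_induct)
    case (less \<beta>)
    have step: "E v i \<beta> = 0" if \<kappa>: "\<kappa> i \<le> \<beta>" for i
    proof -
      obtain \<gamma> where \<gamma>: "\<beta> = \<kappa> i + \<gamma>" using \<kappa> le_Suc_ex by blast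
      have "E v i (\<gamma> + k) = 0" if "k < \<kappa> i" for k
        using less.IH[of "\<gamma> + k" i] less.prems that \<gamma> by simp
      then show ?thesis unfolding \<gamma> E_add by simp
    qed
    show ?case
    proof (cases "\<kappa> j \<le> \<beta>")
      case True
      then show ?thesis by (rule step)
    next
      case False
      then have "dY p0 \<beta> j \<in> span (dX p0 \<union> lower (dY p0) \<beta> \<union> dY p0 \<beta> ` {i. \<kappa> i \<le> \<beta>})"
        using triangular_p0 by (simp add: triangular_def)
      then have "dY p0 \<beta> j \<bullet> \<delta> = 0"
      proof (rule span_orthogonal)
        fix t assume "t \<in> dX p0 \<union> lower (dY p0) \<beta> \<union> dY p0 \<beta> ` {i. \<kappa> i \<le> \<beta>}"
        then consider "t \<in> dX p0" | \<gamma> i where "\<gamma> < \<beta>" "t = dY p0 \<gamma> i"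
          | i where "\<kappa> i \<le> \<beta>" "t = dY p0 \<beta> i"
          unfolding Un_iff in_lower_iff by blast
        then show "t \<bullet> \<delta> = 0"
        proof cases
          case 1
          then show ?thesis by (rule dX)
        next
          case 2
          then show ?thesis using less.IH[of \<gamma> i] less.prems \<delta>[of \<gamma> i] g_Output[OF p0_V] by simp
        next
          case 3
          then show ?thesis using step[of i] less.prems \<delta>[of \<beta> i] g_Output[OF p0_V] by simp
        qed
      qed
      then show ?thesis using \<delta>[of \<beta> j] less.prems g_Output[OF p0_V] by simp
    qed
  qed
  show ?thesis
  proof (rule vec_eq_0_if_components)
    fix j i assume i: "i < \<kappa> j"
    then have "i \<le> r" using le_funD[OF \<kappa>_le_R, of j] R_le[of j] by simp
    then show "v $ idx (j, i) = 0" using E0[of i j] E_less[OF i] by simp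
  qed
qed

text \<open>In this way the identities between \<open>y\<close> and \<open>(x, u)\<close> carry over to the output jets prescribed by
  the control law, which are not known in advance to stem from a point of \<open>V\<close>.\<close>

lemma yu_open_image:
  obtains Q where "open Q" and "yu p0 \<in> Q"
    and "\<And>Y. Y \<in> Q \<Longrightarrow> trunc R1 Y = Y \<Longrightarrow> \<exists>q\<in>N. yu q = Y"
proof -
  \<comment> \<open>The values of \<open>yu\<close> have zero entries above order
    \<open>R j\<close>. Adding these entries as free variables makes the derivative at
    \<open>p0\<close> surjective onto the whole space, as the open mapping argument
    requires.\<close>
  define \<Psi> where "\<Psi> z = yu (fst z) + (snd z - trunc R1 (snd z))" for z
  define \<Psi>' where "\<Psi>' q z = collect R1 (\<lambda>\<beta>. dy \<beta> q (fst z)) + (snd z - trunc R1 (snd z))"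
    for q and z :: "('n, 'm, 'l) jet \<times> ('m, 'l) derivs"
  have \<Psi>': "(\<Psi> has_derivative \<Psi>' (fst z)) (at z)" if "fst z \<in> N" for z
  proof -
    have "(yu has_derivative (\<lambda>v. collect R1 (\<lambda>\<beta>. dy \<beta> (fst z) v))) (at (fst z))"
      unfolding yu_def[abs_def] by (rule has_derivative_collect[OF has_derivative_y]) (use that N_V in blast)
    from diff_chain_at[OF bounded_linear_imp_has_derivative[OF bounded_linear_fst] this]
    have "((\<lambda>z. yu (fst z)) has_derivative (\<lambda>v. collect R1 (\<lambda>\<beta>. dy \<beta> (fst z) (fst v)))) (at z)"
      by (simp add: o_def)
    then show ?thesis unfolding \<Psi>_def[abs_def] \<Psi>'_def[abs_def]
      by (intro has_derivative_add has_derivative_diff bounded_linear_imp_has_derivative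
          bounded_linear_snd bounded_linear_compose[OF bounded_linear_trunc bounded_linear_snd])
  qed
  have "surj (\<Psi>' p0)"
  proof (rule surjI)
    fix w :: "('m, 'l) derivs"
    define \<delta> where "\<delta> = (SOME \<delta>. \<forall>\<beta> j. \<beta> \<le> r \<longrightarrow> dy \<beta> p0 \<delta> $ j = w $ slot \<beta> $ j)"
    have "\<exists>\<delta>. \<forall>\<beta> j. \<beta> \<le> r \<longrightarrow> dy \<beta> p0 \<delta> $ j = w $ slot \<beta> $ j"
      using prescribe_dy[of "\<lambda>\<beta> j. w $ slot \<beta> $ j"] by blast
    then have \<delta>: "\<forall>\<beta> j. \<beta> \<le> r \<longrightarrow> dy \<beta> p0 \<delta> $ j = w $ slot \<beta> $ j"
      unfolding \<delta>_def by (rule someI_ex)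
    have "collect R1 (\<lambda>\<beta>. dy \<beta> p0 \<delta>) = trunc R1 w"
      unfolding vec_eq_iff collect_nth trunc_nth
    proof (intro allI)
      fix k :: 'l and j
      show "(if ord_of k < R1 j then dy (ord_of k) p0 \<delta> $ j else 0) = (if ord_of k < R1 j then w $ k $ j else 0)"
        using R_le[of j] \<delta>[rule_format, of "ord_of k" j] by simp
    qed
    then show "\<Psi>' p0 (SOME \<delta>. \<forall>\<beta> j. \<beta> \<le> r \<longrightarrow> dy \<beta> p0 \<delta> $ j = w $ slot \<beta> $ j, w) = w"
      by (simp add: \<Psi>'_def \<delta>_def)
  qed
  moreover have lin: "linear (\<Psi>' p0)" using has_derivative_linear[OF \<Psi>'[of "(p0, 0)"]] p0_N by simp
  ultimately obtain j where j: "linear j" "\<Psi>' p0 \<circ> j = id"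
    using linear_surjective_right_inverse by blast
  have cont: "continuous_on (N \<times> UNIV) \<Psi>"
    by (rule differentiable_imp_continuous_on, rule differentiable_at_imp_differentiable_on)
      (use \<Psi>' in \<open>force simp: differentiable_def\<close>)
  have opn: "open (N \<times> (UNIV :: ('m, 'l) derivs set))" by (intro open_Times open_N open_UNIV)
  have "\<Psi> (p0, 0) \<in> interior (\<Psi> ` (N \<times> UNIV))"
  proof (rule sussmann_open_mapping[OF opn cont])
    show "(\<Psi> has_derivative \<Psi>' p0) (at (p0, 0))" using \<Psi>'[of "(p0, 0)"] p0_N by simp
    show "bounded_linear j" using j(1) by (simp add: linear_conv_bounded_linear)
    show "(p0, 0) \<in> interior (N \<times> (UNIV :: ('m, 'l) derivs set))" using opn p0_N by (simp add: interior_open)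
  qed (use p0_N j in auto)
  then have "yu p0 \<in> interior (\<Psi> ` (N \<times> UNIV))"
    by (simp add: \<Psi>_def vec_eq_iff trunc_nth linear_0[OF bounded_linear.linear[OF bounded_linear_trunc]])
  moreover have "\<exists>q\<in>N. yu q = Y" if Y: "Y \<in> interior (\<Psi> ` (N \<times> UNIV))" and tr: "trunc R1 Y = Y" for Y
  proof -
    have "Y \<in> \<Psi> ` (N \<times> UNIV)" using Y interior_subset by blast
    then obtain q Z where q: "q \<in> N" "Y = yu q + (Z - trunc R1 Z)" by (auto simp: \<Psi>_def)
    have "Y = trunc R1 (yu q + (Z - trunc R1 Z))"
      using tr unfolding q(2) by (rule sym)
    then have "Y = trunc R1 (yu q) + (trunc R1 Z - trunc R1 (trunc R1 Z))"
      unfolding trunc_add trunc_diff .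
    then have "Y = yu q" unfolding trunc_yu trunc_trunc[OF order_refl] by simp
    then show ?thesis using q(1) by blast
  qed
  ultimately show thesis by (rule that[OF open_interior])
qed

end

section \<open>The error as an implicit function of state and reference\<close>

context tracking_point
begin

definition U :: "((real^'n) \<times> ('m, 'l) derivs) set" where
  "U = {z. trunc R (snd z + A (fst z)) \<in> Yx}"

definition G :: "(real^'n) \<times> ('m, 'l) derivs \<Rightarrow> real^'n" where
  "G z = Fx (trunc R (snd z + A (fst z)))"

lemma bounded_linear_shifted_jet: "bounded_linear (\<lambda>z. trunc R (snd z + A (fst z)))"
  by (intro bounded_linear_compose[OF bounded_linear_trunc] bounded_linear_add bounded_linear_snd
      bounded_linear_compose[OF bounded_linear_A bounded_linear_fst])

lemma open_U: "open U"
proof -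
  have "U = (\<lambda>z. trunc R (snd z + A (fst z))) -` Yx" by (auto simp: U_def)
  then show ?thesis
    using open_Yx linear_continuous_on[OF bounded_linear_shifted_jet, of UNIV]
    by (simp add: continuous_on_open_vimage[OF open_UNIV])
qed

lemma smooth_G: "smooth_on U G"
  unfolding G_def[abs_def]
  by (rule smooth_on_compose[OF open_U open_Yx _ smooth_on_linear[OF open_U bounded_linear_shifted_jet] smooth_Fx])
    (auto simp: U_def)

lemma DG:
  assumes "z \<in> U"
  shows "frechet_derivative G (at z) (v, 0)
    = frechet_derivative Fx (at (trunc R (snd z + A (fst z)))) (trunc R (A v))"
proof -
  have "(Fx has_derivative frechet_derivative Fx (at (trunc R (snd z + A (fst z)))))
      (at (trunc R (snd z + A (fst z))))"
    using assms by (intro DFx) (simp add: U_def)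
  from diff_chain_at[OF bounded_linear_imp_has_derivative[OF bounded_linear_shifted_jet] this]
  have "(G has_derivative frechet_derivative Fx (at (trunc R (snd z + A (fst z))))
      \<circ> (\<lambda>z. trunc R (snd z + A (fst z)))) (at z)"
    by (simp add: G_def[abs_def] o_def)
  from frechet_derivative_at[OF this, symmetric] show ?thesis by simp
qed

text \<open>The equation is solved around the output jet of \<open>p0\<close> taken as reference,
  where the error is 0 and \<open>DFx_A_injective_p0\<close> gives regularity.\<close>

lemma implicit_error:
  obtains T \<zeta> where "open T" and "(fst p0, yx p0) \<in> T" and "smooth_on T \<zeta>"
    and "\<zeta> (fst p0, yx p0) = 0"
    and "\<And>x d. (x, d) \<in> T \<Longrightarrow> Fx (trunc R (d + A (\<zeta> (x, d)))) = x"
    and "\<And>x d v. (x, d) \<in> T \<Longrightarrow>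
      frechet_derivative Fx (at (trunc R (d + A (\<zeta> (x, d))))) (trunc R (A v)) = 0 \<Longrightarrow> v = 0"
proof -
  have tr: "trunc R (yx p0) = yx p0" unfolding yx_def by (rule trunc_collect) simp
  have z0: "(0, yx p0) \<in> U"
    using in_Yx[OF p0_N] by (simp add: U_def A_0 tr) (simp add: yx_def)
  have G0: "G (0, yx p0) = fst p0"
    using xu_eq[OF p0_N] by (simp add: G_def A_0 tr) (simp add: yx_def xu_def)
  have inj0: "v = 0" if "frechet_derivative G (at (0, yx p0)) (v, 0) = 0" for v
    by (rule DFx_A_injective_p0) (use that DG[OF z0, of v] in \<open>simp add: A_0 tr\<close>)
  show thesis
  proof (rule smooth_implicit_function[OF open_U smooth_G z0 inj0])
    fix T \<zeta> assume T: "open T" "(G (0, yx p0), yx p0) \<in> T" "smooth_on T \<zeta>"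
      and \<zeta>0: "\<zeta> (G (0, yx p0), yx p0) = 0"
      and sol: "\<And>x d. (x, d) \<in> T \<Longrightarrow> (\<zeta> (x, d), d) \<in> U \<and> G (\<zeta> (x, d), d) = x"
      and inj: "\<And>x d v. (x, d) \<in> T \<Longrightarrow> frechet_derivative G (at (\<zeta> (x, d), d)) (v, 0) = 0 \<Longrightarrow> v = 0"
    show thesis
    proof (rule that[of T \<zeta>])
      show "Fx (trunc R (d + A (\<zeta> (x, d)))) = x" if "(x, d) \<in> T" for x d
        using sol[OF that] by (simp add: G_def)
      show "v = 0" if "(x, d) \<in> T"
        "frechet_derivative Fx (at (trunc R (d + A (\<zeta> (x, d))))) (trunc R (A v)) = 0" for x d v
        using inj[OF that(1), of v] DG[of "(\<zeta> (x, d), d)" v] sol[OF that(1)] that(2) by simp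
    qed (use T \<zeta>0 in \<open>simp_all add: G0\<close>)
  qed
qed

text \<open>A shifted solution of the recurrence is a solution, and so is a difference of two. Hence
  the defect between a derivative and a shift is determined by its first \<open>\<kappa> j\<close>
  entries.\<close>

lemma E_shift:
  assumes "\<And>i. i < \<kappa> j \<Longrightarrow> \<mu> $ idx (j, i) = \<eta> $ idx (j, i) - E \<epsilon> j (Suc i)"
  shows "E \<mu> j \<beta> = E \<eta> j \<beta> - E \<epsilon> j (Suc \<beta>)"
  unfolding E_def[of \<mu>]
proof (rule lin_rec_unique)
  show "\<mu> $ idx (j, i) = E \<eta> j i - E \<epsilon> j (Suc i)" if "i < \<kappa> j" for i
    using assms[OF that] E_less[OF that] by simp
  show "E \<eta> j (\<kappa> j + \<gamma>) - E \<epsilon> j (Suc (\<kappa> j + \<gamma>)) =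
      - (\<Sum>i<\<kappa> j. a j i * (E \<eta> j (\<gamma> + i) - E \<epsilon> j (Suc (\<gamma> + i))))" for \<gamma>
    using E_add[of \<eta> j \<gamma>] E_add[of \<epsilon> j "Suc \<gamma>"]
    by (simp add: right_diff_distrib sum_subtractf)
qed

lemma tracking_law: "tracking_law_at S f \<phi> R \<kappa> a p0"
proof -
  obtain T \<zeta> where open_T: "open T" and T0: "(fst p0, yx p0) \<in> T" and smooth_\<zeta>: "smooth_on T \<zeta>"
    and \<zeta>0: "\<zeta> (fst p0, yx p0) = 0"
    and sol: "\<And>x d. (x, d) \<in> T \<Longrightarrow> Fx (trunc R (d + A (\<zeta> (x, d)))) = x"
    and inj: "\<And>x d v. (x, d) \<in> T \<Longrightarrow>
      frechet_derivative Fx (at (trunc R (d + A (\<zeta> (x, d))))) (trunc R (A v)) = 0 \<Longrightarrow> v = 0"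
    by (rule implicit_error) (rule that)
  obtain Q where open_Q: "open Q" and Q0: "yu p0 \<in> Q"
    and Q: "\<And>Y. Y \<in> Q \<Longrightarrow> trunc R1 Y = Y \<Longrightarrow> \<exists>q\<in>N. yu q = Y"
    by (rule yu_open_image) (rule that)
  \<comment> \<open>Only reference orders below \<open>R\<close> enter the error, so it is
    differentiable along the loop when \<open>yd\<close> has \<open>R j\<close> derivatives. Order
    \<open>R j\<close> enters only through \<open>Z\<close>, that is, through the input.\<close>
  define err where "err \<xi> = \<zeta> (fst \<xi>, trunc R (snd \<xi>))" for \<xi> :: "(real^'n) \<times> ('m, 'l) derivs"
  define Z where "Z \<xi> = trunc R1 (snd \<xi> + A (err \<xi>))" for \<xi>
  define \<alpha> where "\<alpha> \<xi> = Fu (Z \<xi>)" for \<xi>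
  define W0 where "W0 = {\<xi>. (fst \<xi>, trunc R (snd \<xi>)) \<in> T}"
  define W where "W = {\<xi> \<in> W0. Z \<xi> \<in> Q}"
  have bl: "bounded_linear (\<lambda>\<xi>. (fst \<xi>, trunc R (snd \<xi>)) :: (real^'n) \<times> ('m, 'l) derivs)"
    by (intro bounded_linear_Pair bounded_linear_fst bounded_linear_compose[OF bounded_linear_trunc bounded_linear_snd])
  have open_W0: "open W0"
  proof -
    have "W0 = (\<lambda>\<xi>. (fst \<xi>, trunc R (snd \<xi>))) -` T" by (auto simp: W0_def)
    then show ?thesis
      using open_T linear_continuous_on[OF bl, of UNIV]
      by (simp add: continuous_on_open_vimage[OF open_UNIV])
  qed
  have smooth_err: "smooth_on W0 err"
    unfolding err_def[abs_def]
    by (rule smooth_on_compose[OF open_W0 open_T _ smooth_on_linear[OF open_W0 bl] smooth_\<zeta>])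
      (auto simp: W0_def)
  have smooth_Z: "smooth_on W0 Z"
    unfolding Z_def[abs_def]
    by (rule smooth_on_linear_comp[OF open_W0 bounded_linear_trunc],
        rule smooth_on_add[OF open_W0 smooth_on_linear[OF open_W0 bounded_linear_snd]],
        rule smooth_on_linear_comp[OF open_W0 bounded_linear_A smooth_err])
  have open_W: "open W"
  proof -
    have "W = W0 \<inter> Z -` Q" by (auto simp: W_def)
    then show ?thesis
      using continuous_open_preimage[OF smooth_on_imp_continuous_on[OF smooth_Z] open_W0 open_Q] by simp
  qed
  have trunc_Z: "trunc R1 (Z \<xi>) = Z \<xi>" for \<xi> unfolding Z_def by (rule trunc_trunc) simp
  \<comment> \<open>An actual point \<open>q\<close> with the prescribed output jet supplies what
    \<open>Fx\<close> and \<open>Fu\<close> alone do not: \<open>\<phi>\<close> at the closed loop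
    is the entry of order 0 of that jet, and the field there shifts its entries.\<close>
  have attained: "\<exists>q\<in>N. yu q = Z \<xi> \<and> xu q = (fst \<xi>, \<alpha> \<xi>)" if \<xi>: "\<xi> \<in> W" for \<xi>
  proof -
    obtain q where q: "q \<in> N" "yu q = Z \<xi>" using Q[OF _ trunc_Z[of \<xi>]] \<xi> by (auto simp: W_def)
    have "yx q = trunc R (Z \<xi>)" using trunc_yu(1)[of q] q(2) by simp
    also have "\<dots> = trunc R (snd \<xi> + A (err \<xi>))" unfolding Z_def by (rule trunc_trunc[OF R_le_R1])
    also have "\<dots> = trunc R (trunc R (snd \<xi>) + A (err \<xi>))"
      unfolding trunc_add trunc_trunc[OF order_refl] ..
    finally have "Fx (yx q) = fst \<xi>"
      using sol[of "fst \<xi>" "trunc R (snd \<xi>)"] \<xi> by (simp add: W_def W0_def err_def)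
    moreover have "xu q = (Fx (yx q), Fu (yu q))" using xu_eq[OF q(1)] by (simp add: yx_def yu_def)
    ultimately show ?thesis using q by (auto simp: \<alpha>_def)
  qed
  have smooth_\<alpha>: "smooth_on W \<alpha>"
  proof -
    have "Z ` W \<subseteq> Yu" using attained in_Yu by (fastforce simp: yu_def)
    moreover have "smooth_on W Z" by (rule smooth_on_subset[OF smooth_Z]) (auto simp: W_def)
    ultimately show ?thesis
      unfolding \<alpha>_def[abs_def] by (intro smooth_on_compose[OF open_W open_Yu _ _ smooth_Fu])
  qed
  have in_S: "(fst \<xi>, \<alpha> \<xi>) \<in> S" if "\<xi> \<in> W" for \<xi>
    using attained[OF that] N_V xu_V by (metis image_subset_iff subsetD)
  define c where "c = (fst p0, yu p0)"
  have err_c: "err c = 0" using \<zeta>0 by (simp only: err_def c_def fst_conv snd_conv trunc_yu)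
  have Z_c: "Z c = yu p0"
    unfolding Z_def err_c by (simp only: A_0 c_def snd_conv add_0_right trunc_yu)
  have c_W: "c \<in> W"
    using T0 Q0 unfolding W_def W0_def by (simp add: Z_c) (simp only: c_def fst_conv snd_conv trunc_yu)
  have \<alpha>_c: "(fst c, \<alpha> c) = xu p0"
  proof -
    have "snd (xu p0) = Fu (yu p0)" using xu_eq[OF p0_N] by (simp only: yu_def snd_conv)
    moreover have "fst (xu p0) = fst p0" by (simp add: xu_def)
    ultimately show ?thesis unfolding \<alpha>_def Z_c by (simp only: prod_eq_iff c_def fst_conv snd_conv)
  qed
  have dynamics: "linear_error_dynamics \<kappa> a I (\<lambda>t. \<phi> (x t, \<alpha> (x t, ref_jet R yd t)) - yd t)"
    if I: "open I" and yd: "\<And>j. times_differentiable_on (R j) I (\<lambda>t. yd t $ j)"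
      and cl: "closed_loop_solution f \<alpha> W R yd I x" for I yd x
  proof -
    define ref where "ref t = (ref_jet R yd t :: ('m, 'l) derivs)" for t
    define yb where "yb \<beta> t = (\<chi> j. (deriv ^^ \<beta>) (\<lambda>s. yd s $ j) t)" for \<beta> t
    have ref_eq: "ref t = collect R1 (\<lambda>\<beta>. yb \<beta> t)" for t by (simp add: ref_def ref_jet_def yb_def)
    define d where "d t = (collect R (\<lambda>\<beta>. yb \<beta> t) :: ('m, 'l) derivs)" for t
    define d' where "d' t = (collect R (\<lambda>\<beta>. yb (Suc \<beta>) t) :: ('m, 'l) derivs)" for t
    have trunc_ref: "trunc R (ref t) = d t" for t
      unfolding ref_eq d_def by (rule trunc_collect[OF R_le_R1])
    define \<epsilon> where "\<epsilon> t = \<zeta> (x t, d t)" for t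
    have err_eq: "err (x t, ref t) = \<epsilon> t" for t by (simp add: err_def \<epsilon>_def trunc_ref)
    have in_W: "(x t, ref t) \<in> W"
      and x': "(x has_vector_derivative f (x t, \<alpha> (x t, ref t))) (at t)" if "t \<in> I" for t
      using cl that by (auto simp: closed_loop_solution_def ref_def)
    have in_T: "(x t, d t) \<in> T" if "t \<in> I" for t
      using in_W[OF that] by (simp add: W_def W0_def trunc_ref)
    have d_deriv: "(d has_vector_derivative d' t) (at t)" if t: "t \<in> I" for t
      unfolding has_vector_derivative_def
    proof (intro has_derivative_vecI)
      fix k :: 'l and j
      show "((\<lambda>t. d t $ k $ j) has_derivative (\<lambda>h. (h *\<^sub>R d' t) $ k $ j)) (at t)"
      proof (cases "ord_of k < R j")
        case True
        have "(deriv ^^ ord_of k) (\<lambda>s. yd s $ j) differentiable (at t)"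
          using yd[of j] True t by (simp add: times_differentiable_on_def)
        then have "((\<lambda>t. yb (ord_of k) t $ j) has_real_derivative yb (Suc (ord_of k)) t $ j) (at t)"
          by (simp add: yb_def DERIV_deriv_iff_real_differentiable)
        then show ?thesis
          using True unfolding has_field_derivative_def d_def d'_def
          by (simp add: collect_nth mult.commute[of "yb _ _ $ _"] mult_commute_abs)
      next
        case False
        then show ?thesis by (simp add: d_def d'_def collect_nth)
      qed
    qed
    define \<epsilon>' where "\<epsilon>' t = frechet_derivative \<zeta> (at (x t, d t)) (f (x t, \<alpha> (x t, ref t)), d' t)" for t
    have \<epsilon>_deriv: "(\<epsilon> has_vector_derivative \<epsilon>' t) (at t)" if t: "t \<in> I" for t
    proof -
      have z: "(\<zeta> has_derivative frechet_derivative \<zeta> (at (x t, d t))) (at (x t, d t))"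
        by (rule smooth_on_has_derivative[OF smooth_\<zeta> in_T[OF t]])
      have "((\<lambda>t. (x t, d t)) has_derivative
          (\<lambda>h. (h *\<^sub>R f (x t, \<alpha> (x t, ref t)), h *\<^sub>R d' t))) (at t)"
        using x'[OF t] d_deriv[OF t] unfolding has_vector_derivative_def by (rule has_derivative_Pair)
      from diff_chain_at[OF this z]
      show ?thesis
        using linear_scale[OF has_derivative_linear[OF z], of _ "(f (x t, \<alpha> (x t, ref t)), d' t)"]
        unfolding has_vector_derivative_def \<epsilon>_def[abs_def] \<epsilon>'_def by (simp add: o_def)
    qed
    \<comment> \<open>The defect \<open>\<epsilon>' - (shift of \<epsilon>)\<close> solves the error recurrence and is mapped to \<open>0\<close> by \<open>dx\<close>.\<close>
    have shift: "\<epsilon>' t $ idx (j, i) = E (\<epsilon> t) j (Suc i)" if t: "t \<in> I" and i: "i < \<kappa> j" for t j i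
    proof -
      obtain q where q: "q \<in> N" "yu q = Z (x t, ref t)" "xu q = (x t, \<alpha> (x t, ref t))"
        using attained[OF in_W[OF t]] by auto
      have Z_eq: "yu q = trunc R1 (ref t + A (\<epsilon> t))" by (simp add: q(2) Z_def err_eq)
      have yx_q: "yx q = trunc R (d t + A (\<epsilon> t))"
        unfolding trunc_yu(1)[symmetric] Z_eq trunc_trunc[OF R_le_R1] trunc_add trunc_ref[symmetric]
          trunc_trunc[OF order_refl] ..
      let ?DF = "frechet_derivative Fx (at (yx q))"
      have "yx q \<in> Yx" using in_Yx[OF q(1)] by (simp add: yx_def)
      note DF = DFx[OF this]
      \<comment> \<open>The prolonged field raises every output derivative by one order, so the
        closed-loop velocity is the image of the shifted jet \<open>\<sigma>\<close> under the
        derivative of \<open>Fx\<close>.\<close>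
      define \<sigma> where "\<sigma> = (collect R (\<lambda>\<beta>. y (Suc \<beta>) q) :: ('m, 'l) derivs)"
      have "fst (X q) = ?DF \<sigma>"
        using fst_eq_DFx[OF q(1), of "X q"] by (simp add: dy_X \<sigma>_def)
      then have f_eq: "f (x t, \<alpha> (x t, ref t)) = ?DF \<sigma>" by (simp add: X_State q(3))
      \<comment> \<open>The same velocity, now from differentiating the implicit equation in time.
        Comparing the two puts the defect in the kernel of \<open>?DF\<close>.\<close>
      have "(x has_vector_derivative ?DF (trunc R (d' t + A (\<epsilon>' t)))) (at t)"
      proof -
        have bl: "bounded_linear (\<lambda>Y. trunc R (Y :: ('m, 'l) derivs))" by (rule bounded_linear_trunc)
        have "((\<lambda>t. d t + A (\<epsilon> t)) has_vector_derivative d' t + A (\<epsilon>' t)) (at t)"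
          by (rule has_vector_derivative_add[OF d_deriv[OF t]
                bounded_linear.has_vector_derivative[OF bounded_linear_A \<epsilon>_deriv[OF t]]])
        from bounded_linear.has_vector_derivative[OF bl this]
        have inner: "((\<lambda>t. trunc R (d t + A (\<epsilon> t))) has_vector_derivative trunc R (d' t + A (\<epsilon>' t))) (at t)" .
        have "(Fx has_derivative ?DF) (at (trunc R (d t + A (\<epsilon> t))))" using DF by (simp add: yx_q)
        from diff_chain_at[OF inner[unfolded has_vector_derivative_def] this]
        have "((\<lambda>t. Fx (trunc R (d t + A (\<epsilon> t)))) has_vector_derivative ?DF (trunc R (d' t + A (\<epsilon>' t)))) (at t)"
          using linear_scale[OF has_derivative_linear[OF DF], of _ "trunc R (d' t + A (\<epsilon>' t))"]
          unfolding has_vector_derivative_def by (simp add: o_def)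
        then show ?thesis
          by (rule has_vector_derivative_transform_within_open[OF _ I t]) (simp add: \<epsilon>_def sol[OF in_T])
      qed
      then have "?DF (trunc R (d' t + A (\<epsilon>' t))) = ?DF \<sigma>"
        using x'[OF t] f_eq vector_derivative_unique_at by metis
      then have DF0: "?DF (trunc R (d' t + A (\<epsilon>' t)) - \<sigma>) = 0"
        using linear_diff[OF has_derivative_linear[OF DF]] by simp
      \<comment> \<open>Undoes \<open>idx\<close>: the vector of the first \<open>\<kappa> j\<close>
        entries of the defect in each component \<open>j\<close>.\<close>
      define \<mu> where "\<mu> = (\<chi> k. case inv_into (SIGMA j:UNIV. {..<\<kappa> j}) idx k of
        (j, i) \<Rightarrow> \<epsilon>' t $ idx (j, i) - E (\<epsilon> t) j (Suc i))"
      have \<mu>: "\<mu> $ idx (j, i) = \<epsilon>' t $ idx (j, i) - E (\<epsilon> t) j (Suc i)" if "i < \<kappa> j" for j i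
        using that bij_betw_imp_inj_on[OF idx] by (simp add: \<mu>_def inv_into_f_f)
      have "trunc R (d' t + A (\<epsilon>' t)) - \<sigma> = trunc R (A \<mu>)"
        unfolding vec_eq_iff
      proof (intro allI)
        fix k :: 'l and j
        show "(trunc R (d' t + A (\<epsilon>' t)) - \<sigma>) $ k $ j = trunc R (A \<mu>) $ k $ j"
        proof (cases "ord_of k < R j")
          case True
          \<comment> \<open>An order below \<open>R j\<close> still has its successor among the
            \<open>R j + 1\<close> orders in \<open>yu\<close>; this is why the law needs the
            reference up to order \<open>R j\<close>, one more than the state equation uses.\<close>
          have ok: "ord_of (slot (Suc (ord_of k)) :: 'l) = Suc (ord_of k)"
            using order_less[of "Suc (ord_of k)" j] True by simp
          have "y (Suc (ord_of k)) q $ j = yu q $ slot (Suc (ord_of k)) $ j"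
            using True by (simp add: yu_def collect_nth ok)
          also have "\<dots> = yb (Suc (ord_of k)) t $ j + E (\<epsilon> t) j (Suc (ord_of k))"
            using True unfolding Z_eq by (simp add: trunc_nth ref_eq collect_nth A_def ok)
          finally show ?thesis
            using True E_shift[of j \<mu> "\<epsilon>' t" "\<epsilon> t" "ord_of k", OF \<mu>]
            by (simp add: trunc_nth \<sigma>_def d'_def collect_nth A_def)
        qed (simp add: trunc_nth \<sigma>_def collect_nth)
      qed
      then have "?DF (trunc R (A \<mu>)) = 0" using DF0 by simp
      then have "\<mu> = 0" using inj[OF in_T[OF t], of \<mu>] by (simp add: yx_q \<epsilon>_def)
      then show ?thesis using \<mu>[OF i] by simp
    qed
    have e_eq: "(\<phi> (x t, \<alpha> (x t, ref_jet R yd t)) - yd t) $ j = E (\<epsilon> t) j 0" if t: "t \<in> I" for t j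
    proof -
      obtain q where q: "q \<in> N" "yu q = Z (x t, ref t)" "xu q = (x t, \<alpha> (x t, ref t))"
        using attained[OF in_W[OF t]] by auto
      have ok: "ord_of (slot 0 :: 'l) = 0" using order_less[of 0 j] by simp
      have "\<phi> (x t, \<alpha> (x t, ref t)) = y 0 q" by (simp add: y_0 q(3))
      also have "\<dots> $ j = yu q $ slot 0 $ j" by (simp add: yu_def collect_nth ok)
      also have "\<dots> = yd t $ j + E (\<epsilon> t) j 0"
        by (simp add: q(2) Z_def err_eq trunc_nth A_def ok) (simp add: ref_eq collect_nth ok yb_def)
      finally show ?thesis by (simp add: ref_def)
    qed
    \<comment> \<open>Below \<open>\<kappa> j\<close> the entries of \<open>E\<close> are
      coordinates of \<open>\<epsilon>\<close>, whose derivatives are known from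
      \<open>shift\<close>. The recurrence relates order \<open>\<kappa> j\<close> to the lower
      ones, so no higher derivative has to be followed.\<close>
    have chain: "((\<lambda>t. E (\<epsilon> t) j \<beta>) has_real_derivative E (\<epsilon> t) j (Suc \<beta>)) (at t)"
      if "\<beta> < \<kappa> j" "t \<in> I" for j \<beta> t
    proof -
      have "((\<lambda>t. \<epsilon> t $ idx (j, \<beta>)) has_vector_derivative \<epsilon>' t $ idx (j, \<beta>)) (at t)"
        by (rule bounded_linear.has_vector_derivative[OF bounded_linear_vec_nth \<epsilon>_deriv[OF that(2)]])
      then show ?thesis
        using shift[OF that(2,1)] E_less[OF that(1)]
        by (simp add: has_real_derivative_iff_has_vector_derivative)
    qed
    show ?thesis
      unfolding linear_error_dynamics_def
    proof (intro allI conjI ballI)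
      fix j
      let ?e = "\<lambda>t. (\<phi> (x t, \<alpha> (x t, ref_jet R yd t)) - yd t) $ j"
      have e1: "(deriv ^^ \<beta>) ?e t = E (\<epsilon> t) j \<beta>" if "\<beta> \<le> \<kappa> j" "t \<in> I" for \<beta> t
        by (rule deriv_chain(1)[where h="\<lambda>\<beta> t. E (\<epsilon> t) j \<beta>" and k="\<kappa> j" and I=I])
          (rule I, erule e_eq, erule (1) chain, rule that(1), rule that(2))
      show "times_differentiable_on (\<kappa> j) I ?e"
        by (rule deriv_chain(2)[where h="\<lambda>\<beta> t. E (\<epsilon> t) j \<beta>"]) (rule I, erule e_eq, erule (1) chain)
      fix t assume t: "t \<in> I"
      have "(\<Sum>\<beta><\<kappa> j. a j \<beta> * (deriv ^^ \<beta>) ?e t) = (\<Sum>\<beta><\<kappa> j. a j \<beta> * E (\<epsilon> t) j \<beta>)"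
        by (rule sum.cong[OF refl], subst e1) (use t in auto)
      then show "(deriv ^^ \<kappa> j) ?e t + (\<Sum>\<beta><\<kappa> j. a j \<beta> * (deriv ^^ \<beta>) ?e t) = 0"
        using e1[OF order_refl t] E_add[of "\<epsilon> t" j 0] by simp
    qed
  qed
  show ?thesis
    unfolding tracking_law_at_def Let_def yu_def[symmetric] c_def[symmetric]
    by (rule exI[of _ W], rule exI[of _ \<alpha>])
      (use open_W c_W smooth_\<alpha> \<alpha>_c in_S dynamics in \<open>intro conjI ballI allI impI; blast\<close>)
qed

end

lemma (in flat_system) tracking_law_at_triangular:
  assumes "p \<in> V" and "\<kappa> \<le> R" and "(\<Sum>j\<in>UNIV. \<kappa> j) = CARD('n)" and "triangular \<kappa> p"
    and "independent_outputs p"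
  shows "tracking_law_at S f \<phi> R \<kappa> a p"
proof -
  have card: "card (SIGMA j:UNIV. {..<\<kappa> j}) = CARD('n)" using assms(3) by (simp add: card_SigmaI)
  have "finite (SIGMA j:UNIV. {..<\<kappa> j})" by simp
  from finite_same_card_bij[OF this finite card]
  obtain idx :: "'m \<times> nat \<Rightarrow> 'n" where idx: "bij_betw idx (SIGMA j:UNIV. {..<\<kappa> j}) UNIV" ..
  show ?thesis
  proof (rule flatE[OF assms(1)])
    fix N Yx Yu and Fx :: "('m, 'l) derivs \<Rightarrow> real^'n" and Fu :: "('m, 'l) derivs \<Rightarrow> real^'m"
    assume "open N" "p \<in> N" "N \<subseteq> V" "open Yx" "smooth_on Yx Fx" "open Yu" "smooth_on Yu Fu"
      "\<And>q. q \<in> N \<Longrightarrow> collect R (\<lambda>\<beta>. y \<beta> q) \<in> Yx"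
      "\<And>q. q \<in> N \<Longrightarrow> collect (\<lambda>j. R j + 1) (\<lambda>\<beta>. y \<beta> q) \<in> Yu"
      "\<And>q. q \<in> N \<Longrightarrow> xu q = (Fx (collect R (\<lambda>\<beta>. y \<beta> q)), Fu (collect (\<lambda>j. R j + 1) (\<lambda>\<beta>. y \<beta> q)))"
    then interpret tracking_point S f \<phi> V R \<kappa> a idx p N Yx Yu Fx Fu
      using assms(2,4,5) idx by unfold_locales
    show ?thesis by (rule tracking_law)
  qed
qed

theorem mainTheorem4:
  fixes S :: "((real^'n) \<times> (real^'m)) set"
    and f :: "(real^'n) \<times> (real^'m) \<Rightarrow> real^'n"
    and \<phi> :: "(real^'n) \<times> (real^'m) \<Rightarrow> real^'m"
    and V :: "('n::finite, 'm::finite, 'l::{finite,linorder}) jet set"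
    and R :: "'m \<Rightarrow> nat"
  assumes "open S" and "smooth_on S f" and "smooth_on S \<phi>"
    and "open V" and "xu ` V \<subseteq> S"
    and "xu_flat_output V f \<phi> R"
    and l_u_large: "\<forall>j. (CARD('m) + 2) * (R j + 1) \<le> CARD('l)"
  shows "\<exists>D. open D \<and> D \<subseteq> V \<and> V \<subseteq> closure D \<and>
    (\<forall>p\<in>D. \<exists>N \<kappa>. open N \<and> p \<in> N \<and> N \<subseteq> D \<and>
       \<kappa> \<le> R \<and> (\<Sum>j\<in>UNIV. \<kappa> j) = CARD('n) \<and>
       (\<forall>a. \<forall>q\<in>N. tracking_law_at S f \<phi> R \<kappa> a q))"
proof -
  interpret flat_system S f \<phi> V R
    using assms by unfold_locales (auto simp: xu_flat_output_def)
  show ?thesis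
  proof (rule dense_triangular)
    fix D assume D: "open D" "D \<subseteq> V" "V \<subseteq> closure D"
      and N: "\<And>p. p \<in> D \<Longrightarrow> \<exists>N \<kappa>. open N \<and> p \<in> N \<and> N \<subseteq> D \<and> \<kappa> \<le> R \<and>
        (\<Sum>j\<in>UNIV. \<kappa> j) = CARD('n) \<and> (\<forall>q\<in>N. triangular \<kappa> q \<and> independent_outputs q)"
    have law: "\<exists>N \<kappa>. open N \<and> p \<in> N \<and> N \<subseteq> D \<and> \<kappa> \<le> R \<and> (\<Sum>j\<in>UNIV. \<kappa> j) = CARD('n) \<and>
        (\<forall>a. \<forall>q\<in>N. tracking_law_at S f \<phi> R \<kappa> a q)" if p: "p \<in> D" for p
    proof -
      obtain N \<kappa> where N: "open N" "p \<in> N" "N \<subseteq> D" and \<kappa>: "\<kappa> \<le> R" "(\<Sum>j\<in>UNIV. \<kappa> j) = CARD('n)"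
        and tri: "\<forall>q\<in>N. triangular \<kappa> q \<and> independent_outputs q"
        using N[OF p] by (elim exE conjE)
      \<comment> \<open>\<open>triangular\<close> does not mention the coefficients, so
        \<open>\<kappa>\<close> can be fixed before \<open>a\<close>.\<close>
      have "tracking_law_at S f \<phi> R \<kappa> a q" if "q \<in> N" for a q
        using tri that N(3) D(2) by (intro tracking_law_at_triangular \<kappa>) auto
      with N \<kappa> show ?thesis by (intro exI conjI allI ballI) auto
    qed
    show ?thesis by (rule exI[of _ D], intro conjI D ballI law)
  qed
qed

end
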